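(* Let $\mathscr{C}$ be a subgraph-closed class of graphs that admits efficient encoding of topological minors. Then the model-checking problem of $\mathsf{FO}+\mathsf{conn}$ on $\mathscr{C}$ (given $G\in\mathscr{C}$ and a sentence $\varphi$, decide whether $G\models\varphi$, parameterized by $|\varphi|$) is $\mathsf{AW}[\star]$-hard, even for the fragment that uses only $\mathsf{conn}_k$ predicates with $k\le 2$.
   Context: Graphs are finite, undirected and loopless. A topological minor model of $H$ in $G$ is an injective map sending vertices of $H$ to vertices of $G$ and edges $uv$ of $H$ to pairwise internally vertex-disjoint paths in $G$ with endpoints the images of $u$ and $v$. A class $\mathscr{C}$ admits efficient encoding of topological minors if for every graph $H$ there exists $G\in\mathscr{C}$ such that $H$ is a topological minor of $G$, and given $H$, such a $G$ together with a topological minor model of $H$ in $G$ can be computed in time polynomial in $|H|$. Separator logic $\mathsf{FO}+\mathsf{conn}$ is first-order logic over graphs (binary edge relation $E$) extended with atomic predicates $\mathsf{conn}_k(x,y,z_1,\ldots,z_k)$ for every $k\ge 0$; $\mathsf{conn}_k(s,t,u_1,\ldots,u_k)$ holds iff there is an $s$-$t$ path in the graph containing none of $u_1,\ldots,u_k$. *)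

theory Defs
  imports Main
begin

section \<open>Computations\<close>

text \<open>
  All inputs and outputs are binary trees. Programs are written in a first-order LISP, a mild
  variant of the language F of N. D. Jones (Computability and Complexity from a Programming
  Perspective): a program \<open>f\<close> is the body of a one-argument recursive function, in
  which \<open>Arg\<close> is the argument, \<open>Self e\<close> is the recursive call of the
  function on the value of \<open>e\<close>, and \<open>Apply g e\<close> calls the function with
  (closed) body \<open>g\<close>.

  In \<open>eval f e x v t\<close>, the expression \<open>e\<close>, occurring in the body
  \<open>f\<close> of a function called with argument \<open>x\<close>, evaluates to \<open>v\<close>
  in time \<open>t\<close>. Reading the argument is charged with its size, as if it were copied, and
  every other operation with one unit. Hence the time bounds the size of all intermediate values,
  so that evaluation is simulated by a Turing machine with polynomial overhead; the converse
  simulation is standard. Polynomial time, fpt time and computability are therefore the usual ones.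
\<close>

datatype val = Leaf | Node val val

fun vsize :: "val \<Rightarrow> nat" where
  "vsize Leaf = 1"
| "vsize (Node u v) = 1 + vsize u + vsize v"

fun left :: "val \<Rightarrow> val" where
  "left Leaf = Leaf"
| "left (Node u v) = u"

fun right :: "val \<Rightarrow> val" where
  "right Leaf = Leaf"
| "right (Node u v) = v"

datatype prog =
    Arg
  | Empty
  | Cons prog prog
  | Hd prog
  | Tl prog
  | Cond prog prog prog
  | Self prog
  | Apply prog prog

inductive eval :: "prog \<Rightarrow> prog \<Rightarrow> val \<Rightarrow> val \<Rightarrow> nat \<Rightarrow> bool" where
  Arg: "eval f Arg x x (vsize x)"
| Empty: "eval f Empty x Leaf 1"
| Cons: "eval f a x u s \<Longrightarrow> eval f b x v t \<Longrightarrow> eval f (Cons a b) x (Node u v) (s + t + 1)"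
| Hd: "eval f a x u s \<Longrightarrow> eval f (Hd a) x (left u) (s + 1)"
| Tl: "eval f a x u s \<Longrightarrow> eval f (Tl a) x (right u) (s + 1)"
| Cond_then: "eval f c x u s \<Longrightarrow> u \<noteq> Leaf \<Longrightarrow> eval f a x v t \<Longrightarrow> eval f (Cond c a b) x v (s + t + 1)"
| Cond_else: "eval f c x Leaf s \<Longrightarrow> eval f b x v t \<Longrightarrow> eval f (Cond c a b) x v (s + t + 1)"
| Self: "eval f a x u s \<Longrightarrow> eval f f u v t \<Longrightarrow> eval f (Self a) x v (s + t + 1)"
| Apply: "eval f a x u s \<Longrightarrow> eval g g u v t \<Longrightarrow> eval f (Apply g a) x v (s + t + 1)"

definition run :: "prog \<Rightarrow> val \<Rightarrow> val \<Rightarrow> nat \<Rightarrow> bool" where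
  "run p x y t \<longleftrightarrow> eval p p x y t"

lemma vsize_pos: "vsize x > 0"
  by (cases x) auto

lemma vsize_le_time: "eval f e x v t \<Longrightarrow> vsize v \<le> t"
proof (induction rule: eval.induct)
  case (Hd f a x u s)
  then show ?case by (cases u) auto
next
  case (Tl f a x u s)
  then show ?case by (cases u) auto
qed auto

lemma eval_deterministic:
  "eval f e x v t \<Longrightarrow> eval f e x v' t' \<Longrightarrow> v' = v \<and> t' = t"
proof (induction arbitrary: v' t' rule: eval.induct)
  case Arg
  then show ?case by (auto elim: eval.cases)
next
  case Empty
  then show ?case by (auto elim: eval.cases)
next
  case Cons
  from Cons.prems show ?case by (cases rule: eval.cases) (use Cons.IH in blast)+
next
  case Hd
  from Hd.prems show ?case by (cases rule: eval.cases) (use Hd.IH in blast)+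
next
  case Tl
  from Tl.prems show ?case by (cases rule: eval.cases) (use Tl.IH in blast)+
next
  case Cond_then
  from Cond_then.prems show ?case
    by (cases rule: eval.cases) (use Cond_then.IH Cond_then.hyps in blast)+
next
  case Cond_else
  from Cond_else.prems show ?case
    by (cases rule: eval.cases) (use Cond_else.IH Cond_else.hyps in blast)+
next
  case Self
  from Self.prems show ?case by (cases rule: eval.cases) (use Self.IH in blast)+
next
  case Apply
  from Apply.prems show ?case by (cases rule: eval.cases) (use Apply.IH in blast)+
qed

fun enc_nat :: "nat \<Rightarrow> val" where
  "enc_nat 0 = Leaf"
| "enc_nat (Suc n) = Node Leaf (enc_nat n)"

fun enc_list :: "('a \<Rightarrow> val) \<Rightarrow> 'a list \<Rightarrow> val" where
  "enc_list c [] = Leaf"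
| "enc_list c (x # xs) = Node (c x) (enc_list c xs)"

lemma enc_nat_inj: "enc_nat m = enc_nat n \<longleftrightarrow> m = n"
proof (induction m arbitrary: n)
  case 0
  then show ?case by (cases n) auto
next
  case (Suc m)
  then show ?case by (cases n) auto
qed

lemma enc_list_inj:
  assumes "\<And>x y. c x = c y \<longleftrightarrow> x = y"
  shows "enc_list c xs = enc_list c ys \<longleftrightarrow> xs = ys"
proof (induction xs arbitrary: ys)
  case Nil
  then show ?case by (cases ys) auto
next
  case (Cons x xs)
  then show ?case by (cases ys) (auto simp: assms)
qed

definition computable :: "(nat \<Rightarrow> nat) \<Rightarrow> bool" where
  "computable f \<longleftrightarrow> (\<exists>p. \<forall>n. \<exists>t. run p (enc_nat n) (enc_nat (f n)) t)"


section \<open>Parameterized problems\<close>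

text \<open>
  Problems may come with a promise: only the elements of \<open>instances\<close> are inputs. Ordinary
  problems are those with \<open>instances P = UNIV\<close>.
\<close>

record param_problem =
  instances :: "val set"
  yes :: "val set"
  param :: "val \<Rightarrow> nat"

definition fpt_reducible :: "param_problem \<Rightarrow> param_problem \<Rightarrow> bool" where
  "fpt_reducible P Q \<longleftrightarrow>
     (\<exists>r f g d. computable f \<and> computable g \<and>
        (\<forall>x \<in> instances P. \<exists>y t. run r x y t \<and> t \<le> f (param P x) * vsize x ^ d \<and>
           y \<in> instances Q \<and> (x \<in> yes P \<longleftrightarrow> y \<in> yes Q) \<and> param Q y \<le> g (param P x)))"


section \<open>First-order formulas\<close>

datatype 'a fm =
    Atom 'a
  | Neg "'a fm"
  | Conj "'a fm" "'a fm"
  | Disj "'a fm" "'a fm"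
  | Exists nat "'a fm"
  | Forall nat "'a fm"

fun free_vars :: "('a \<Rightarrow> nat set) \<Rightarrow> 'a fm \<Rightarrow> nat set" where
  "free_vars av (Atom a) = av a"
| "free_vars av (Neg \<phi>) = free_vars av \<phi>"
| "free_vars av (Conj \<phi> \<psi>) = free_vars av \<phi> \<union> free_vars av \<psi>"
| "free_vars av (Disj \<phi> \<psi>) = free_vars av \<phi> \<union> free_vars av \<psi>"
| "free_vars av (Exists x \<phi>) = free_vars av \<phi> - {x}"
| "free_vars av (Forall x \<phi>) = free_vars av \<phi> - {x}"

fun sat :: "'u set \<Rightarrow> ((nat \<Rightarrow> 'u) \<Rightarrow> 'a \<Rightarrow> bool) \<Rightarrow> (nat \<Rightarrow> 'u) \<Rightarrow> 'a fm \<Rightarrow> bool" where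
  "sat U I \<sigma> (Atom a) \<longleftrightarrow> I \<sigma> a"
| "sat U I \<sigma> (Neg \<phi>) \<longleftrightarrow> \<not> sat U I \<sigma> \<phi>"
| "sat U I \<sigma> (Conj \<phi> \<psi>) \<longleftrightarrow> sat U I \<sigma> \<phi> \<and> sat U I \<sigma> \<psi>"
| "sat U I \<sigma> (Disj \<phi> \<psi>) \<longleftrightarrow> sat U I \<sigma> \<phi> \<or> sat U I \<sigma> \<psi>"
| "sat U I \<sigma> (Exists x \<phi>) \<longleftrightarrow> (\<exists>a \<in> U. sat U I (\<sigma>(x := a)) \<phi>)"
| "sat U I \<sigma> (Forall x \<phi>) \<longleftrightarrow> (\<forall>a \<in> U. sat U I (\<sigma>(x := a)) \<phi>)"

fun enc_fm :: "('a \<Rightarrow> val) \<Rightarrow> 'a fm \<Rightarrow> val" where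
  "enc_fm c (Atom a) = Node (enc_nat 0) (c a)"
| "enc_fm c (Neg \<phi>) = Node (enc_nat 1) (enc_fm c \<phi>)"
| "enc_fm c (Conj \<phi> \<psi>) = Node (enc_nat 2) (Node (enc_fm c \<phi>) (enc_fm c \<psi>))"
| "enc_fm c (Disj \<phi> \<psi>) = Node (enc_nat 3) (Node (enc_fm c \<phi>) (enc_fm c \<psi>))"
| "enc_fm c (Exists x \<phi>) = Node (enc_nat 4) (Node (enc_nat x) (enc_fm c \<phi>))"
| "enc_fm c (Forall x \<phi>) = Node (enc_nat 5) (Node (enc_nat x) (enc_fm c \<phi>))"

lemma enc_fm_inj:
  assumes "\<And>a b. c a = c b \<longleftrightarrow> a = b"
  shows "enc_fm c \<phi> = enc_fm c \<psi> \<longleftrightarrow> \<phi> = \<psi>"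
proof (induction \<phi> arbitrary: \<psi>)
qed (case_tac \<psi>; simp add: assms enc_nat_inj del: enc_nat.simps)+

text \<open>
  Instances of model-checking problems are trees \<open>Node a w\<close>, where \<open>a\<close>
  encodes the structure and \<open>w\<close> the sentence; the length of a formula is the size of
  its encoding.
\<close>

definition formula_length :: "val \<Rightarrow> nat" where
  "formula_length x = vsize (right x)"


section \<open>The class AW[*]\<close>

text \<open>
  A structure \<open>(n, [(r\<^sub>0, T\<^sub>0), (r\<^sub>1, T\<^sub>1), \<dots>])\<close> has universe
  \<open>{0, \<dots>, n - 1}\<close>, and its \<open>i\<close>-th relation has arity \<open>r\<^sub>i\<close>
  and consists of the tuples listed in \<open>T\<^sub>i\<close>.
\<close>

type_synonym struct = "nat \<times> (nat \<times> nat list list) list"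

definition is_struct :: "struct \<Rightarrow> bool" where
  "is_struct A \<longleftrightarrow> fst A > 0 \<and>
     (\<forall>(r, T) \<in> set (snd A). r > 0 \<and> distinct T \<and>
        (\<forall>t \<in> set T. length t = r \<and> set t \<subseteq> {..<fst A}))"

definition enc_struct :: "struct \<Rightarrow> val" where
  "enc_struct A =
     Node (enc_nat (fst A))
       (enc_list (\<lambda>(r, T). Node (enc_nat r) (enc_list (enc_list enc_nat) T)) (snd A))"

datatype fo_atom = FO_Eq nat nat | FO_Rel nat "nat list"

fun fo_atom_vars :: "fo_atom \<Rightarrow> nat set" where
  "fo_atom_vars (FO_Eq x y) = {x, y}"
| "fo_atom_vars (FO_Rel i xs) = set xs"

fun fo_atom_fits :: "struct \<Rightarrow> fo_atom \<Rightarrow> bool" where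
  "fo_atom_fits A (FO_Eq x y) \<longleftrightarrow> True"
| "fo_atom_fits A (FO_Rel i xs) \<longleftrightarrow> i < length (snd A) \<and> length xs = fst (snd A ! i)"

fun fo_atom_holds :: "struct \<Rightarrow> (nat \<Rightarrow> nat) \<Rightarrow> fo_atom \<Rightarrow> bool" where
  "fo_atom_holds A \<sigma> (FO_Eq x y) \<longleftrightarrow> \<sigma> x = \<sigma> y"
| "fo_atom_holds A \<sigma> (FO_Rel i xs) \<longleftrightarrow> map \<sigma> xs \<in> set (snd (snd A ! i))"

fun enc_fo_atom :: "fo_atom \<Rightarrow> val" where
  "enc_fo_atom (FO_Eq x y) = Node (enc_nat 0) (Node (enc_nat x) (enc_nat y))"
| "enc_fo_atom (FO_Rel i xs) = Node (enc_nat 1) (Node (enc_nat i) (enc_list enc_nat xs))"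

lemma enc_struct_inj: "enc_struct A = enc_struct B \<longleftrightarrow> A = B"
  unfolding enc_struct_def
  by (subst val.inject, subst enc_list_inj)
    (auto simp: enc_nat_inj enc_list_inj prod_eq_iff split: prod.splits)

lemma enc_fo_atom_inj: "enc_fo_atom a = enc_fo_atom b \<longleftrightarrow> a = b"
  by (cases a; cases b) (simp_all add: enc_nat_inj enc_list_inj del: enc_nat.simps)

definition struct_models :: "struct \<Rightarrow> fo_atom fm \<Rightarrow> bool" where
  "struct_models A \<phi> \<longleftrightarrow> (\<forall>\<sigma>. sat {..<fst A} (fo_atom_holds A) \<sigma> \<phi>)"

definition fo_sentence_for :: "struct \<Rightarrow> fo_atom fm \<Rightarrow> bool" where
  "fo_sentence_for A \<phi> \<longleftrightarrow> free_vars fo_atom_vars \<phi> = {} \<and> (\<forall>a \<in> set_fm \<phi>. fo_atom_fits A a)"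

text \<open>The problem p-MC(FO): first-order model checking on arbitrary finite relational structures.\<close>

definition MC_FO :: param_problem where
  "MC_FO =
     \<lparr>instances = {Node (enc_struct A) (enc_fm enc_fo_atom \<phi>) | A \<phi>.
         is_struct A \<and> fo_sentence_for A \<phi>},
      yes = {Node (enc_struct A) (enc_fm enc_fo_atom \<phi>) | A \<phi>.
         is_struct A \<and> fo_sentence_for A \<phi> \<and> struct_models A \<phi>},
      param = formula_length\<rparr>"

text \<open>
  AW[*] as in Flum and Grohe, Parameterized Complexity Theory: the closure of p-MC(FO) under
  fpt-reductions. The parameter of a problem is not required to be computable, which for hardness
  only makes the class larger.
\<close>

definition AW_star :: "param_problem set" where
  "AW_star = {P. fpt_reducible P MC_FO}"

definition AW_star_hard :: "param_problem \<Rightarrow> bool" where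
  "AW_star_hard Q \<longleftrightarrow> (\<forall>P \<in> AW_star. fpt_reducible P Q)"


section \<open>Graphs and topological minors\<close>

text \<open>
  A class of graphs is any set of such graphs. Subgraphs are taken literally, and a class need not
  be closed under isomorphism.
\<close>

record graph =
  verts :: "nat set"
  edges :: "nat set set"

definition is_graph :: "graph \<Rightarrow> bool" where
  "is_graph G \<longleftrightarrow> finite (verts G) \<and> (\<forall>e \<in> edges G. e \<subseteq> verts G \<and> card e = 2)"

definition subgraph :: "graph \<Rightarrow> graph \<Rightarrow> bool" where
  "subgraph H G \<longleftrightarrow> is_graph H \<and> verts H \<subseteq> verts G \<and> edges H \<subseteq> edges G"

definition subgraph_closed :: "graph set \<Rightarrow> bool" where
  "subgraph_closed \<C> \<longleftrightarrow> (\<forall>G \<in> \<C>. \<forall>H. subgraph H G \<longrightarrow> H \<in> \<C>)"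

definition is_path :: "graph \<Rightarrow> nat list \<Rightarrow> bool" where
  "is_path G p \<longleftrightarrow> p \<noteq> [] \<and> set p \<subseteq> verts G \<and> distinct p \<and>
     successively (\<lambda>u v. {u, v} \<in> edges G) p"

text \<open>
  Two paths are internally vertex-disjoint if neither contains an inner vertex of the other.
  It follows that no inner vertex is the image of a vertex with an incident edge in \<open>H\<close>;
  that it is not the image of an isolated vertex of \<open>H\<close> either is not demanded.
\<close>

definition topological_minor_model ::
  "graph \<Rightarrow> graph \<Rightarrow> (nat \<Rightarrow> nat) \<Rightarrow> (nat set \<Rightarrow> nat list) \<Rightarrow> bool" where
  "topological_minor_model H G \<eta> \<pi> \<longleftrightarrow>
     inj_on \<eta> (verts H) \<and> \<eta> ` verts H \<subseteq> verts G \<and>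
     (\<forall>e \<in> edges H. is_path G (\<pi> e) \<and> {hd (\<pi> e), last (\<pi> e)} = \<eta> ` e) \<and>
     (\<forall>e \<in> edges H. \<forall>f \<in> edges H. e \<noteq> f \<longrightarrow>
        (set (\<pi> e) - {hd (\<pi> e), last (\<pi> e)}) \<inter> set (\<pi> f) = {})"

text \<open>
  A graph is encoded by a list of its vertices and a list of its edges, in any order and with each
  edge oriented arbitrarily.
\<close>

definition lists_graph :: "nat list \<Rightarrow> (nat \<times> nat) list \<Rightarrow> graph \<Rightarrow> bool" where
  "lists_graph vs es G \<longleftrightarrow>
     distinct vs \<and> set vs = verts G \<and>
     distinct (map (\<lambda>(u, v). {u, v}) es) \<and> (\<lambda>(u, v). {u, v}) ` set es = edges G"

definition enc_graph :: "nat list \<Rightarrow> (nat \<times> nat) list \<Rightarrow> val" where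
  "enc_graph vs es =
     Node (enc_list enc_nat vs) (enc_list (\<lambda>(u, v). Node (enc_nat u) (enc_nat v)) es)"

lemma enc_graph_inj: "enc_graph vs es = enc_graph vs' es' \<longleftrightarrow> vs = vs' \<and> es = es'"
  unfolding enc_graph_def
  by (subst val.inject, subst (2) enc_list_inj)
    (auto simp: enc_nat_inj enc_list_inj split: prod.splits)

text \<open>A model is encoded by listing the images of the vertices and edges of \<open>H\<close>, in the order of its lists.\<close>

definition enc_model ::
  "nat list \<Rightarrow> (nat \<times> nat) list \<Rightarrow> (nat \<Rightarrow> nat) \<Rightarrow> (nat set \<Rightarrow> nat list) \<Rightarrow> val" where
  "enc_model vs es \<eta> \<pi> =
     Node (enc_list (\<lambda>v. enc_nat (\<eta> v)) vs)
          (enc_list (\<lambda>(u, v). enc_list enc_nat (\<pi> {u, v})) es)"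

definition efficient_encoding_of_topological_minors :: "graph set \<Rightarrow> bool" where
  "efficient_encoding_of_topological_minors \<C> \<longleftrightarrow>
     (\<exists>p c d. \<forall>H vs es. is_graph H \<and> lists_graph vs es H \<longrightarrow>
        (\<exists>G \<in> \<C>. \<exists>\<eta> \<pi> ws ds t.
           topological_minor_model H G \<eta> \<pi> \<and> lists_graph ws ds G \<and>
           run p (enc_graph vs es) (Node (enc_graph ws ds) (enc_model vs es \<eta> \<pi>)) t \<and>
           t \<le> c * vsize (enc_graph vs es) ^ d))"


section \<open>Separator logic\<close>

text \<open>In \<open>Conn x y zs\<close>, which is the atom conn\<open>\<^sub>k\<close>, \<open>k\<close> is the length of \<open>zs\<close>.\<close>

datatype conn_atom = Eq nat nat | Edge nat nat | Conn nat nat "nat list"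

fun conn_atom_vars :: "conn_atom \<Rightarrow> nat set" where
  "conn_atom_vars (Eq x y) = {x, y}"
| "conn_atom_vars (Edge x y) = {x, y}"
| "conn_atom_vars (Conn x y zs) = {x, y} \<union> set zs"

fun conn_atom_holds :: "graph \<Rightarrow> (nat \<Rightarrow> nat) \<Rightarrow> conn_atom \<Rightarrow> bool" where
  "conn_atom_holds G \<sigma> (Eq x y) \<longleftrightarrow> \<sigma> x = \<sigma> y"
| "conn_atom_holds G \<sigma> (Edge x y) \<longleftrightarrow> {\<sigma> x, \<sigma> y} \<in> edges G"
| "conn_atom_holds G \<sigma> (Conn x y zs) \<longleftrightarrow>
     (\<exists>p. is_path G p \<and> hd p = \<sigma> x \<and> last p = \<sigma> y \<and> set p \<inter> \<sigma> ` set zs = {})"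

fun enc_conn_atom :: "conn_atom \<Rightarrow> val" where
  "enc_conn_atom (Eq x y) = Node (enc_nat 0) (Node (enc_nat x) (enc_nat y))"
| "enc_conn_atom (Edge x y) = Node (enc_nat 1) (Node (enc_nat x) (enc_nat y))"
| "enc_conn_atom (Conn x y zs) =
     Node (enc_nat 2) (Node (enc_nat x) (Node (enc_nat y) (enc_list enc_nat zs)))"

lemma enc_conn_atom_inj: "enc_conn_atom a = enc_conn_atom b \<longleftrightarrow> a = b"
  by (cases a; cases b) (simp_all add: enc_nat_inj enc_list_inj del: enc_nat.simps)

definition FO_conn :: "conn_atom fm set" where
  "FO_conn = {\<phi>. free_vars conn_atom_vars \<phi> = {}}"

definition FO_conn_upto :: "nat \<Rightarrow> conn_atom fm set" where
  "FO_conn_upto m = {\<phi> \<in> FO_conn. \<forall>x y zs. Conn x y zs \<in> set_fm \<phi> \<longrightarrow> length zs \<le> m}"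

definition graph_models :: "graph \<Rightarrow> conn_atom fm \<Rightarrow> bool" where
  "graph_models G \<phi> \<longleftrightarrow> (\<forall>\<sigma>. sat (verts G) (conn_atom_holds G) \<sigma> \<phi>)"

definition MC_conn :: "conn_atom fm set \<Rightarrow> graph set \<Rightarrow> param_problem" where
  "MC_conn \<Phi> \<C> =
     \<lparr>instances = {Node (enc_graph vs es) (enc_fm enc_conn_atom \<phi>) | vs es G \<phi>.
         G \<in> \<C> \<and> lists_graph vs es G \<and> \<phi> \<in> \<Phi>},
      yes = {Node (enc_graph vs es) (enc_fm enc_conn_atom \<phi>) | vs es G \<phi>.
         G \<in> \<C> \<and> lists_graph vs es G \<and> \<phi> \<in> \<Phi> \<and> graph_models G \<phi>},
      param = formula_length\<rparr>"

end

theory Submission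
  imports Defs
begin

text \<open>
  Model checking on finite structures reduces to model checking in the class. A structure \<open>A\<close> is
  turned into a core graph, with a vertex for every element, every tuple and every position in a
  tuple; the relation of a tuple and the number of a position are recorded by the number, at least
  three, of pendant vertices attached. The class contains a subdivision of the resulting graph
  \<open>H\<close>, which the encoding computes.

  In a subdivision of \<open>H\<close> the core consists of the vertices of degree at least three. A neighbour
  \<open>w\<close> of a core vertex \<open>u\<close> lies on a path towards a pendant vertex iff deleting \<open>u\<close> separates \<open>w\<close>
  from the whole core; and \<open>u\<close>, \<open>v\<close> are joined by an edge of \<open>H\<close> iff some neighbour \<open>w\<close> of \<open>u\<close> is
  connected to \<open>v\<close> outside \<open>u\<close> but separated from the whole core by \<open>u\<close> and \<open>v\<close>. So \<open>conn\<^sub>1\<close> and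
  \<open>conn\<^sub>2\<close> recover adjacency in the core and the number of pendant vertices, hence \<open>A\<close>.
\<close>

section \<open>Polynomial time\<close>

text \<open>The encoding controls neither the host graph nor the lengths of its paths, so formulas
  can rely on connectivity but not on distances. The threshold three serves twice: it makes every
  core vertex branching, and, as all other vertices have degree at most two, a vertex with three or
  more pendant neighbours must belong to the core, so that a label alone identifies it. A separate
  vertex for every position records the order of a tuple and avoids multiple edges when an element
  is repeated in it. The labels mentioned by a formula grow with the relation index and the arity,
  both of which are paid for by the unary encoding of the sentence; so the new parameter is
  polynomial in the old one, independently of the structure. Running times are obtained
  compositionally: whatever is computed is a function on trees, assembled from operations that
  preserve polynomial time.\<close>

inductive polyf :: "(nat \<Rightarrow> nat) \<Rightarrow> bool" where
  polyf_id: "polyf (\<lambda>n. n)"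
| polyf_const: "polyf (\<lambda>n. c)"
| polyf_add: "polyf h \<Longrightarrow> polyf k \<Longrightarrow> polyf (\<lambda>n. h n + k n)"
| polyf_mult: "polyf h \<Longrightarrow> polyf k \<Longrightarrow> polyf (\<lambda>n. h n * k n)"

text \<open>All generators are monotone, as there is no subtraction. This is what allows a bound on
  the size of an intermediate result to be substituted for the size itself.\<close>

lemma polyf_mono: "polyf h \<Longrightarrow> m \<le> n \<Longrightarrow> h m \<le> h n"
  by (induction rule: polyf.induct) (auto intro: add_mono mult_mono)

lemma polyf_comp: "polyf h \<Longrightarrow> polyf k \<Longrightarrow> polyf (\<lambda>n. h (k n))"
  by (induction rule: polyf.induct) (auto intro: polyf.intros)

lemma polyf_power: "polyf h \<Longrightarrow> polyf (\<lambda>n. h n ^ d)"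
  by (induction d) (auto intro: polyf.intros)

lemmas polyf_intros = polyf.intros polyf_power

text \<open>Connects these bounds with the shape \<open>f (param P x) * vsize x ^ d\<close> in
  \<open>fpt_reducible\<close>. Comparing powers needs \<open>n \<ge> 1\<close>, which
  \<open>vsize\<close> always satisfies.\<close>

lemma polyf_bound:
  assumes "polyf h"
  shows "\<exists>c d. \<forall>n\<ge>1. h n \<le> c * n ^ d"
  using assms
proof (induction rule: polyf.induct)
  case polyf_id
  show ?case by (intro exI[of _ 1]) simp
next
  case (polyf_const c)
  then show ?case by (intro exI[of _ c] exI[of _ 0]) auto
next
  case (polyf_add h k)
  then obtain c d c' d' where *: "\<forall>n\<ge>1. h n \<le> c * n ^ d" "\<forall>n\<ge>1. k n \<le> c' * n ^ d'"
    by blast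
  show ?case
  proof (intro exI allI impI)
    fix n :: nat assume n: "1 \<le> n"
    have "n ^ d \<le> n ^ (d + d')" "n ^ d' \<le> n ^ (d + d')"
      using n by (simp_all add: power_increasing)
    then have "h n \<le> c * n ^ (d + d')" "k n \<le> c' * n ^ (d + d')"
      using * n by (meson mult_le_mono2 order_trans)+
    then show "h n + k n \<le> (c + c') * n ^ (d + d')" by (simp add: add_mult_distrib)
  qed
next
  case (polyf_mult h k)
  then obtain c d c' d' where *: "\<forall>n\<ge>1. h n \<le> c * n ^ d" "\<forall>n\<ge>1. k n \<le> c' * n ^ d'"
    by blast
  show ?case
  proof (intro exI allI impI)
    fix n :: nat assume n: "1 \<le> n"
    have "h n * k n \<le> (c * n ^ d) * (c' * n ^ d')"
      using * n by (intro mult_mono) auto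
    then show "h n * k n \<le> (c * c') * n ^ (d + d')" by (simp add: power_add mult_ac)
  qed
qed

text \<open>Total functions spare the closure lemmas all conditions of well-formedness; in return,
  sizes must also be bounded on trees that encode nothing.\<close>

definition ptime :: "(val \<Rightarrow> val) \<Rightarrow> bool" where
  "ptime F \<longleftrightarrow> (\<exists>p h. polyf h \<and> (\<forall>x. \<exists>t \<le> h (vsize x). run p x (F x) t))"

lemma ptimeE:
  assumes "ptime F"
  obtains p h where "polyf h" "\<And>x n. vsize x \<le> n \<Longrightarrow> \<exists>t \<le> h n. eval p p x (F x) t"
proof -
  from assms obtain p h where *: "polyf h" "\<And>x. \<exists>t \<le> h (vsize x). eval p p x (F x) t"
    unfolding ptime_def run_def by blast
  have "\<exists>t \<le> h n. eval p p x (F x) t" if "vsize x \<le> n" for x n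
    using *(2)[of x] polyf_mono[OF *(1) that] by (meson order_trans)
  with *(1) show thesis by (rule that)
qed

text \<open>A result is never larger than the time spent on it. The size bounds required for
  recursive functions are built from this.\<close>

lemma ptime_vsize:
  assumes "ptime F"
  obtains h where "polyf h" "\<And>x n. vsize x \<le> n \<Longrightarrow> vsize (F x) \<le> h n"
  using assms by (elim ptimeE) (meson order_trans vsize_le_time)

lemma ptimeI:
  assumes "polyf h" "\<And>x. \<exists>t \<le> h (vsize x). eval p p x (F x) t"
  shows "ptime F"
  using assms unfolding ptime_def run_def by blast

lemma eval_Hd: "eval f a x (Node u w) s \<Longrightarrow> eval f (Hd a) x u (s + 1)"
  using eval.Hd[of f a x "Node u w"] by simp

lemma eval_Tl: "eval f a x (Node u w) s \<Longrightarrow> eval f (Tl a) x w (s + 1)"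
  using eval.Tl[of f a x "Node u w"] by simp

section \<open>Closure properties of polynomial time\<close>

lemma ptime_id: "ptime (\<lambda>x. x)"
  by (rule ptimeI[where p = Arg, OF polyf_id]) (blast intro: eval.Arg)

lemma ptime_const: "ptime (\<lambda>x. c)"
proof (induction c)
  case Leaf
  show ?case
    by (rule ptimeI[where p = Empty, OF polyf_const[of 1]]) (blast intro: eval.Empty)
next
  case (Node u v)
  obtain p h where p: "polyf h" "\<And>x n. vsize x \<le> n \<Longrightarrow> \<exists>t \<le> h n. eval p p x u t"
    using Node.IH(1) by (rule ptimeE) blast
  obtain q k where q: "polyf k" "\<And>x n. vsize x \<le> n \<Longrightarrow> \<exists>t \<le> k n. eval q q x v t"
    using Node.IH(2) by (rule ptimeE) blast
  \<comment> \<open>Programs are always plugged in by \<open>Apply\<close> and never by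
    substitution: inside the new body, a \<open>Self\<close> of \<open>p\<close> would call the new
    body instead of \<open>p\<close>.\<close>
  show ?case
  proof (rule ptimeI[where p = "Cons (Apply p Arg) (Apply q Arg)"])
    show "polyf (\<lambda>n. (n + h n + 1) + (n + k n + 1) + 1)"
      by (intro polyf_intros p q)
    fix x
    obtain s t where "eval p p x u s" "s \<le> h (vsize x)" "eval q q x v t" "t \<le> k (vsize x)"
      using p(2)[OF order_refl, of x] q(2)[OF order_refl, of x] by blast
    then show "\<exists>t \<le> (vsize x + h (vsize x) + 1) + (vsize x + k (vsize x) + 1) + 1.
        eval (Cons (Apply p Arg) (Apply q Arg)) (Cons (Apply p Arg) (Apply q Arg)) x (Node u v) t"
      by (intro exI[of _ "(vsize x + s + 1) + (vsize x + t + 1) + 1"] conjI eval.intros) (auto intro: eval.Arg)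
  qed
qed

lemma ptime_comp:
  assumes "ptime F" "ptime G"
  shows "ptime (\<lambda>x. F (G x))"
proof -
  obtain p h where p: "polyf h" "\<And>x n. vsize x \<le> n \<Longrightarrow> \<exists>t \<le> h n. eval p p x (F x) t"
    using assms(1) by (rule ptimeE) blast
  obtain q k where q: "polyf k" "\<And>x n. vsize x \<le> n \<Longrightarrow> \<exists>t \<le> k n. eval q q x (G x) t"
    using assms(2) by (rule ptimeE) blast
  show ?thesis
  proof (rule ptimeI[where p = "Apply p (Apply q Arg)"])
    show "polyf (\<lambda>n. (n + k n + 1) + h (k n) + 1)"
      by (intro polyf_intros p q polyf_comp[OF p(1) q(1)])
    fix x
    obtain s where s: "eval q q x (G x) s" "s \<le> k (vsize x)"
      using q(2)[OF order_refl, of x] by blast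
    with p(2)[of "G x" "k (vsize x)"] vsize_le_time[OF s(1)] obtain t where
      "eval p p (G x) (F (G x)) t" "t \<le> h (k (vsize x))" by auto
    with s show "\<exists>t \<le> (vsize x + k (vsize x) + 1) + h (k (vsize x)) + 1.
        eval (Apply p (Apply q Arg)) (Apply p (Apply q Arg)) x (F (G x)) t"
      by (intro exI[of _ "(vsize x + s + 1) + t + 1"] conjI eval.intros) (auto intro: eval.Arg)
  qed
qed

lemma ptime_Node:
  assumes "ptime F" "ptime G"
  shows "ptime (\<lambda>x. Node (F x) (G x))"
proof -
  obtain p h where p: "polyf h" "\<And>x n. vsize x \<le> n \<Longrightarrow> \<exists>t \<le> h n. eval p p x (F x) t"
    using assms(1) by (rule ptimeE) blast
  obtain q k where q: "polyf k" "\<And>x n. vsize x \<le> n \<Longrightarrow> \<exists>t \<le> k n. eval q q x (G x) t"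
    using assms(2) by (rule ptimeE) blast
  show ?thesis
  proof (rule ptimeI[where p = "Cons (Apply p Arg) (Apply q Arg)"])
    show "polyf (\<lambda>n. (n + h n + 1) + (n + k n + 1) + 1)"
      by (intro polyf_intros p q)
    fix x
    obtain s t where "eval p p x (F x) s" "s \<le> h (vsize x)" "eval q q x (G x) t" "t \<le> k (vsize x)"
      using p(2)[OF order_refl, of x] q(2)[OF order_refl, of x] by blast
    then show "\<exists>t \<le> (vsize x + h (vsize x) + 1) + (vsize x + k (vsize x) + 1) + 1.
        eval (Cons (Apply p Arg) (Apply q Arg)) (Cons (Apply p Arg) (Apply q Arg)) x
          (Node (F x) (G x)) t"
      by (intro exI[of _ "(vsize x + s + 1) + (vsize x + t + 1) + 1"] conjI eval.intros) (auto intro: eval.Arg)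
  qed
qed

lemma ptime_left: 
  assumes "ptime F"
  shows "ptime (\<lambda>x. left (F x))"
proof -
  have "ptime left"
  proof (rule ptimeI[where p = "Hd Arg"])
    show "polyf (\<lambda>n. n + 1)" by (intro polyf_intros)
    show "\<exists>t \<le> vsize x + 1. eval (Hd Arg) (Hd Arg) x (left x) t" for x
      by (intro exI[of _ "vsize x + 1"] conjI order_refl eval.Hd eval.Arg)
  qed
  from ptime_comp[OF this assms] show ?thesis .
qed

lemma ptime_right: 
  assumes "ptime F"
  shows "ptime (\<lambda>x. right (F x))"
proof -
  have "ptime right"
  proof (rule ptimeI[where p = "Tl Arg"])
    show "polyf (\<lambda>n. n + 1)" by (intro polyf_intros)
    show "\<exists>t \<le> vsize x + 1. eval (Tl Arg) (Tl Arg) x (right x) t" for x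
      by (intro exI[of _ "vsize x + 1"] conjI order_refl eval.Tl eval.Arg)
  qed
  from ptime_comp[OF this assms] show ?thesis .
qed

text \<open>\<open>Leaf\<close> selects the first branch, whereas \<open>Cond\<close> takes its
  first branch on nonempty trees; hence the swapped order in the program. In all tests below
  \<open>Leaf\<close> acts as truth.\<close>

lemma ptime_if:
  assumes "ptime C" "ptime F" "ptime G"
  shows "ptime (\<lambda>x. if C x = Leaf then F x else G x)"
proof -
  obtain p h where p: "polyf h" "\<And>x n. vsize x \<le> n \<Longrightarrow> \<exists>t \<le> h n. eval p p x (F x) t"
    using assms(2) by (rule ptimeE) blast
  obtain q k where q: "polyf k" "\<And>x n. vsize x \<le> n \<Longrightarrow> \<exists>t \<le> k n. eval q q x (G x) t"
    using assms(3) by (rule ptimeE) blast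
  obtain r l where r: "polyf l" "\<And>x n. vsize x \<le> n \<Longrightarrow> \<exists>t \<le> l n. eval r r x (C x) t"
    using assms(1) by (rule ptimeE) blast
  let ?p = "Cond (Apply r Arg) (Apply q Arg) (Apply p Arg)"
  show ?thesis
  proof (rule ptimeI[where p = ?p])
    show "polyf (\<lambda>n. (n + l n + 1) + (n + h n + k n + 1) + 1)"
      by (intro polyf_intros p q r)
    fix x
    obtain s t w where *: "eval p p x (F x) s" "s \<le> h (vsize x)" "eval q q x (G x) t"
      "t \<le> k (vsize x)" "eval r r x (C x) w" "w \<le> l (vsize x)"
      using p(2)[OF order_refl, of x] q(2)[OF order_refl, of x] r(2)[OF order_refl, of x] by blast
    have C: "eval ?p (Apply r Arg) x (C x) (vsize x + w + 1)"
      using eval.Apply[OF eval.Arg *(5)] .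
    show "\<exists>t \<le> (vsize x + l (vsize x) + 1) + (vsize x + h (vsize x) + k (vsize x) + 1) + 1.
        eval ?p ?p x (if C x = Leaf then F x else G x) t"
    proof (cases "C x = Leaf")
      case True
      have "eval ?p ?p x (F x) ((vsize x + w + 1) + (vsize x + s + 1) + 1)"
        using eval.Cond_else[OF C[unfolded True] eval.Apply[OF eval.Arg *(1)]] True by simp
      with True * show ?thesis by (intro exI conjI) auto
    next
      case False
      have "eval ?p ?p x (G x) ((vsize x + w + 1) + (vsize x + t + 1) + 1)"
        using eval.Cond_then[OF C False eval.Apply[OF eval.Arg *(3)]] by simp
      with False * show ?thesis by (intro exI conjI) auto
    qed
  qed
qed

text \<open>Functions of two arguments are curried in statements but take a pair in programs; this
  passes from one form to the other.\<close>

lemma ptime_comp2: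
  assumes "ptime (\<lambda>z. F (left z) (right z))" "ptime G" "ptime H"
  shows "ptime (\<lambda>x. F (G x) (H x))"
  using ptime_comp[OF assms(1) ptime_Node[OF assms(2,3)]] by simp

text \<open>
  Structural recursion is polynomial as soon as the size of the results is: a tree has
  at most \<open>vsize v\<close> subtrees, each is visited once, and the context never grows.
\<close>

lemma ptime_rec:
  assumes B: "ptime B"
    and G: "ptime (\<lambda>z. G (left (left z)) (right (left z)) (left (right z)) (right (right z)))"
    and C: "ptime C" "\<And>x. vsize (C x) \<le> vsize x"
    and D: "ptime D" "\<And>x. vsize (D x) \<le> vsize x"
    and Leaf: "\<And>x. F x Leaf = B x"
    and Node: "\<And>x a l. F x (Node a l) = G x (Node a l) (F (C x) a) (F (D x) l)"
    and S: "polyf S" "\<And>x v. vsize (F x v) \<le> S (vsize x + vsize v)"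
  shows "ptime (\<lambda>z. F (left z) (right z))"
proof -
  obtain pb hb where b: "polyf hb" "\<And>x n. vsize x \<le> n \<Longrightarrow> \<exists>t \<le> hb n. eval pb pb x (B x) t"
    using B by (rule ptimeE) blast
  obtain pc hc where c: "polyf hc" "\<And>x n. vsize x \<le> n \<Longrightarrow> \<exists>t \<le> hc n. eval pc pc x (C x) t"
    using C(1) by (rule ptimeE) blast
  obtain pd hd where d: "polyf hd" "\<And>x n. vsize x \<le> n \<Longrightarrow> \<exists>t \<le> hd n. eval pd pd x (D x) t"
    using D(1) by (rule ptimeE) blast
  obtain pg hg where g: "polyf hg" "\<And>x n. vsize x \<le> n \<Longrightarrow> \<exists>t \<le> hg n. eval pg pg x
      (G (left (left x)) (right (left x)) (left (right x)) (right (right x))) t"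
    using G by (rule ptimeE) blast
  \<comment> \<open>The argument pairs the context with the tree, so \<open>Tl Arg\<close> asks
    whether the tree is a leaf; \<open>pg\<close> receives the whole argument together with both
    recursive results.\<close>
  define p where "p = Cond (Tl Arg)
    (Apply pg (Cons Arg (Cons (Self (Cons (Apply pc (Hd Arg)) (Hd (Tl Arg))))
      (Self (Cons (Apply pd (Hd Arg)) (Tl (Tl Arg)))))))
    (Apply pb (Hd Arg))"
  \<comment> \<open>\<open>K n\<close> pays for one node of the tree. Here \<open>n\<close> bounds
    context and tree together, which remains true in the recursive calls since \<open>C\<close> and
    \<open>D\<close> do not enlarge the context; \<open>pg\<close> is run on the argument and two
    results of size at most \<open>S n\<close>.\<close>
  define K where "K n = hb n + hc n + hd n + hg (n + 3 + S n + S n) + 10 * n + 30" for n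
  have K: "polyf K"
    unfolding K_def
    by (intro polyf_intros b c d polyf_comp[OF g(1)] S)
  have *: "\<exists>t \<le> vsize v * K n. eval p p (Node x v) (F x v) t" if "vsize x + vsize v \<le> n" for x v n
    using that
  proof (induction v arbitrary: x)
    case Leaf
    obtain t where t: "eval pb pb x (B x) t" "t \<le> hb n"
      using b(2)[of x n] Leaf by auto
    \<comment> \<open>The running time is left schematic and gets instantiated by evaluating the
      program in the second goal; only then is the bound in the first goal checked.\<close>
    have "\<exists>s \<le> 2 * n + 8 + t. eval p p (Node x Leaf) (F x Leaf) s"
      unfolding assms(7)
      apply (subst (2) p_def)
      apply (rule exI, rule conjI)
       apply (rule_tac [2] eval.Cond_else)
        apply (rule_tac [2] eval_Tl, rule_tac [2] eval.Arg)
       apply (rule_tac [2] eval.Apply)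
        apply (rule_tac [2] eval_Hd, rule_tac [2] eval.Arg)
       apply (rule_tac [2] t)
      using Leaf by simp
    then obtain s where s: "eval p p (Node x Leaf) (F x Leaf) s" "s \<le> 2 * n + 8 + t"
      by blast
    have "s \<le> K n" using s(2) t(2) unfolding K_def by linarith
    with s(1) show ?case by auto
  next
    case (Node a l)
    obtain tc where tc: "eval pc pc x (C x) tc" "tc \<le> hc n"
      using c(2)[of x n] Node.prems by auto
    obtain td where td: "eval pd pd x (D x) td" "td \<le> hd n"
      using d(2)[of x n] Node.prems by auto
    obtain ta where ta: "eval p p (Node (C x) a) (F (C x) a) ta" "ta \<le> vsize a * K n"
      using Node.IH(1)[of "C x"] Node.prems C(2)[of x] by auto
    obtain tl where tl: "eval p p (Node (D x) l) (F (D x) l) tl" "tl \<le> vsize l * K n"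
      using Node.IH(2)[of "D x"] Node.prems D(2)[of x] by auto
    let ?i = "Node (Node x (Node a l)) (Node (F (C x) a) (F (D x) l))"
    have "vsize (F (C x) a) \<le> S n"
      using S(2)[of "C x" a] polyf_mono[OF S(1), of "vsize (C x) + vsize a" n] Node.prems C(2)[of x]
      by auto
    moreover have "vsize (F (D x) l) \<le> S n"
      using S(2)[of "D x" l] polyf_mono[OF S(1), of "vsize (D x) + vsize l" n] Node.prems D(2)[of x]
      by auto
    ultimately have "vsize ?i \<le> n + 3 + S n + S n" using Node.prems by simp
    from g(2)[OF this] obtain tg where
      tg: "eval pg pg ?i (F x (Node a l)) tg" "tg \<le> hg (n + 3 + S n + S n)"
      unfolding assms(8) by auto
    have "\<exists>s \<le> 6 * n + 26 + tc + td + ta + tl + tg. eval p p (Node x (Node a l)) (F x (Node a l)) s"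
      apply (subst (2) p_def)
      apply (rule exI, rule conjI)
       apply (rule_tac [2] eval.Cond_then)
         apply (rule_tac [2] eval_Tl, rule_tac [2] eval.Arg)
        apply simp_all [2]
       apply (rule_tac [2] eval.Apply)
        apply (rule_tac [2] eval.Cons)
         apply (rule_tac [2] eval.Arg)
        apply (rule_tac [2] eval.Cons)
         apply (rule_tac [2] eval.Self)
          apply (rule_tac [2] eval.Cons)
           apply (rule_tac [2] eval.Apply)
            apply (rule_tac [2] eval_Hd, rule_tac [2] eval.Arg)
           apply (rule_tac [2] tc)
          apply (rule_tac [2] eval_Hd, rule_tac [2] eval_Tl, rule_tac [2] eval.Arg)
         apply (rule_tac [2] ta)
        apply (rule_tac [2] eval.Self)
         apply (rule_tac [2] eval.Cons)
          apply (rule_tac [2] eval.Apply)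
           apply (rule_tac [2] eval_Hd, rule_tac [2] eval.Arg)
          apply (rule_tac [2] td)
         apply (rule_tac [2] eval_Tl, rule_tac [2] eval_Tl, rule_tac [2] eval.Arg)
        apply (rule_tac [2] tl)
       apply (rule_tac [2] tg(1))
      using Node.prems by simp
    then obtain s where s: "eval p p (Node x (Node a l)) (F x (Node a l)) s"
      "s \<le> 6 * n + 26 + tc + td + ta + tl + tg" by blast
    have "s \<le> K n + vsize a * K n + vsize l * K n"
      using s(2) tc td ta tl tg(2) unfolding K_def[of n] by linarith
    with s(1) show ?case by (intro exI[of _ s]) (simp add: add_mult_distrib)
  qed
  show ?thesis
  proof (rule ptimeI[where p = "Apply p (Cons (Hd Arg) (Tl Arg))"])
    show "polyf (\<lambda>n. (2 * n + 3) + (n + 1) * K (n + 1) + 1)"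
      by (intro polyf_intros polyf_comp[OF K])
    fix z
    \<comment> \<open>The program rebuilds the pair, so that the input \<open>Leaf\<close> is
      treated as \<open>Node Leaf Leaf\<close>; the first bound needs \<open>+ 1\<close> for this
      case.\<close>
    have z: "vsize (left z) + vsize (right z) \<le> vsize z + 1" "vsize (right z) \<le> vsize z + 1"
      by (cases z; simp)+
    obtain t where t: "eval p p (Node (left z) (right z)) (F (left z) (right z)) t"
      "t \<le> vsize (right z) * K (vsize z + 1)"
      using *[OF z(1)] by blast
    have "t \<le> (vsize z + 1) * K (vsize z + 1)"
      using t(2) z(2) by (meson mult_le_mono1 order_trans)
    moreover have "eval (Apply p (Cons (Hd Arg) (Tl Arg))) (Cons (Hd Arg) (Tl Arg)) z
        (Node (left z) (right z)) ((vsize z + 1) + (vsize z + 1) + 1)"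
      by (intro eval.intros)
    from eval.Apply[OF this t(1)] have "eval (Apply p (Cons (Hd Arg) (Tl Arg)))
        (Apply p (Cons (Hd Arg) (Tl Arg))) z (F (left z) (right z))
        ((vsize z + 1) + (vsize z + 1) + 1 + t + 1)" .
    ultimately show "\<exists>t \<le> (2 * vsize z + 3) + (vsize z + 1) * K (vsize z + 1) + 1.
        eval (Apply p (Cons (Hd Arg) (Tl Arg))) (Apply p (Cons (Hd Arg) (Tl Arg))) z
          (F (left z) (right z)) t"
      by (intro exI conjI) auto
  qed
qed

text \<open>Recursion over a list, that is, along the right spine, with a fixed context. The program
  also computes the recursive result for the head and discards it, which is covered because the size
  bound ranges over all trees.\<close>

lemma ptime_lrec:
  assumes "ptime B"
    and "ptime (\<lambda>z. G (left (left z)) (right (left z)) (right z))"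
    and "\<And>x. F x Leaf = B x"
    and "\<And>x a l. F x (Node a l) = G x (Node a l) (F x l)"
    and "polyf S" "\<And>x v. vsize (F x v) \<le> S (vsize x + vsize v)"
    and L: "ptime C" "ptime L"
  shows "ptime (\<lambda>x. F (C x) (L x))"
proof -
  have "ptime (\<lambda>z. G (left (left z)) (right (left z)) (right (right z)))"
    using ptime_comp[OF assms(2) ptime_Node[OF ptime_left[OF ptime_id] ptime_right[OF ptime_right[OF ptime_id]]]]
    by simp
  from ptime_rec[OF assms(1) this ptime_id order_refl ptime_id order_refl assms(3-6)]
  have "ptime (\<lambda>z. F (left z) (right z))" .
  from ptime_comp2[OF this L] show ?thesis .
qed

lemmas ptime_intros = ptime_id ptime_const ptime_Node ptime_left ptime_right ptime_if

section \<open>Operations on lists encoded as trees\<close>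

fun app :: "val \<Rightarrow> val \<Rightarrow> val" where
  "app m Leaf = m"
| "app m (Node a l) = Node a (app m l)"

lemma vsize_app: "vsize (app m l) \<le> vsize m + vsize l"
  by (induction l) auto

lemma ptime_app: "ptime F \<Longrightarrow> ptime G \<Longrightarrow> ptime (\<lambda>x. app (F x) (G x))"
  by (rule ptime_lrec[where F = app and B = "\<lambda>x. x" and G = "\<lambda>x v r. Node (left v) r"])
    (auto intro!: ptime_intros polyf_id vsize_app)

text \<open>The recursion runs over the second argument, so this one comes first in the list; nested
  uses of \<open>app\<close> therefore name their pieces from the last to the first.\<close>

lemma app_enc_list: "app (enc_list c ys) (enc_list c xs) = enc_list c (xs @ ys)"
  by (induction xs) auto

fun vmap :: "(val \<Rightarrow> val) \<Rightarrow> val \<Rightarrow> val" where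
  "vmap f Leaf = Leaf"
| "vmap f (Node a l) = Node (f a) (vmap f l)"

lemma ptime_vmap:
  assumes F: "ptime (\<lambda>z. F (left z) (right z))" and L: "ptime L"
  shows "ptime (\<lambda>x. vmap (F x) (L x))"
proof -
  obtain h where h: "polyf h"
    "\<And>x n. vsize x \<le> n \<Longrightarrow> vsize (F (left x) (right x)) \<le> h n"
    using F by (rule ptime_vsize) blast
  show ?thesis
  proof (rule ptime_lrec[where F = "\<lambda>x. vmap (F x)"])
    show "ptime (\<lambda>x. Leaf)" by (rule ptime_const)
    show "ptime (\<lambda>z. (\<lambda>x v r. Node (F x (left v)) r) (left (left z)) (right (left z)) (right z))"
      by (intro ptime_intros ptime_comp2[OF F])
    show "polyf (\<lambda>n. n * (h (n + 1) + 1))"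
      by (intro polyf_intros polyf_comp[OF h(1)])
    fix x v
    show "vsize (vmap (F x) v) \<le> (vsize x + vsize v) * (h (vsize x + vsize v + 1) + 1)"
    proof -
      have "vsize (vmap (F x) w) \<le> vsize w * (h (vsize x + n + 1) + 1)" if "vsize w \<le> n" for w n
        using that
      proof (induction w)
        case (Node a l)
        then have "vsize (F x a) \<le> h (vsize x + n + 1)"
          using h(2)[of "Node x a" "vsize x + n + 1"] by simp
        with Node show ?case by (simp add: algebra_simps)
      qed simp
      from this[OF order_refl] show ?thesis
        by (rule order_trans) (simp add: add_mult_distrib)
    qed
  qed (auto intro: ptime_id L)
qed

lemma vmap_enc_list: "vmap f (enc_list c xs) = enc_list (\<lambda>x. f (c x)) xs"
  by (induction xs) auto

fun vconcat :: "val \<Rightarrow> val" where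
  "vconcat Leaf = Leaf"
| "vconcat (Node a l) = app (vconcat l) a"

lemma vsize_vconcat: "vsize (vconcat l) \<le> vsize l"
proof (induction l)
  case (Node a l)
  then show ?case using vsize_app[of "vconcat l" a] by simp
qed simp

lemma ptime_vconcat:
  assumes "ptime F"
  shows "ptime (\<lambda>x. vconcat (F x))"
  by (rule ptime_lrec[where F = "\<lambda>x. vconcat" and B = "\<lambda>x. Leaf" and C = "\<lambda>x. x"
        and G = "\<lambda>x v r. app r (left v)" and S = "\<lambda>n. n"])
    (auto intro!: ptime_intros ptime_app polyf_id assms intro: trans_le_add2 vsize_vconcat)

lemma vconcat_enc_list: "vconcat (enc_list (enc_list c) xss) = enc_list c (concat xss)"
  by (induction xss) (auto simp: app_enc_list)

text \<open>Applied to unary numbers: the tails of a number are all smaller ones, in decreasing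
  order. This is the source of the reversed intervals in the vertex lists.\<close>

fun vtails :: "val \<Rightarrow> val" where
  "vtails Leaf = Leaf"
| "vtails (Node a l) = Node l (vtails l)"

lemma vsize_vtails: "vsize (vtails v) \<le> vsize v * vsize v"
  by (induction v) (auto simp: algebra_simps)

lemma ptime_vtails:
  assumes "ptime F"
  shows "ptime (\<lambda>x. vtails (F x))"
proof (rule ptime_lrec[where F = "\<lambda>x. vtails" and B = "\<lambda>x. Leaf" and C = "\<lambda>x. x"
        and G = "\<lambda>x v r. Node (right v) r" and S = "\<lambda>n. n * n"])
  show "vsize (vtails v) \<le> (vsize x + vsize v) * (vsize x + vsize v)" for x v
    using vsize_vtails by (rule order_trans) (simp add: mult_mono)
qed (auto intro!: ptime_intros polyf_intros assms)

lemma vtails_enc_nat: "vtails (enc_nat n) = enc_list enc_nat (rev [0..<n])"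
  by (induction n) auto

text \<open>Indices are raised afterwards instead of being passed down by a counter, since the
  context of \<open>ptime_rec\<close> must not grow.\<close>

fun venum :: "val \<Rightarrow> val" where
  "venum Leaf = Leaf"
| "venum (Node a l) = Node (Node Leaf a) (vmap (\<lambda>p. Node (Node Leaf (left p)) (right p)) (venum l))"

fun vlen :: "val \<Rightarrow> nat" where
  "vlen Leaf = 0"
| "vlen (Node a l) = Suc (vlen l)"

lemma vlen_vmap [simp]: "vlen (vmap f v) = vlen v"
  by (induction v) auto

lemma vlen_venum [simp]: "vlen (venum v) = vlen v"
  by (induction v) auto

lemma vlen_le: "vlen v \<le> vsize v"
  by (induction v) auto

fun vlist_pairs :: "val \<Rightarrow> bool" where
  "vlist_pairs Leaf = True"
| "vlist_pairs (Node a l) = (a \<noteq> Leaf \<and> vlist_pairs l)"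

lemma vlist_pairs_vmap_Node: "vlist_pairs (vmap (\<lambda>p. Node (f p) (g p)) v)"
  by (induction v) auto

text \<open>Taking apart and reassembling a genuine pair does not change its size, so a shift adds
  two per entry. Only such additive growth survives being repeated along the list.\<close>

lemma vsize_shift_pairs: "vlist_pairs v \<Longrightarrow>
    vsize (vmap (\<lambda>p. Node (Node Leaf (left p)) (right p)) v) = vsize v + 2 * vlen v"
  by (induction v rule: vlist_pairs.induct; simp) (case_tac a; simp)

lemma vsize_venum: "vsize (venum v) \<le> 2 * vsize v * vsize v"
proof (induction v)
  case (Node a l)
  have "vlist_pairs (venum l)" by (cases l) (auto simp: vlist_pairs_vmap_Node)
  then have "vsize (venum (Node a l)) = 3 + vsize a + vsize (venum l) + 2 * vlen l"
    by (simp add: vsize_shift_pairs)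
  also have "\<dots> \<le> 3 + vsize a + 2 * vsize l * vsize l + 2 * vsize l"
    using Node vlen_le[of l] by simp
  also have "\<dots> \<le> 2 * vsize (Node a l) * vsize (Node a l)"
    using vsize_pos[of a] vsize_pos[of l] by (simp add: algebra_simps)
  finally show ?case .
qed simp

lemma ptime_venum:
  assumes "ptime F"
  shows "ptime (\<lambda>x. venum (F x))"
proof (rule ptime_lrec[where F = "\<lambda>x. venum" and B = "\<lambda>x. Leaf" and C = "\<lambda>x. x"
      and G = "\<lambda>x v r. Node (Node Leaf (left v)) (vmap (\<lambda>p. Node (Node Leaf (left p)) (right p)) r)"
      and S = "\<lambda>n. 2 * n * n"])
  show "vsize (venum v) \<le> 2 * (vsize x + vsize v) * (vsize x + vsize v)" for x v
    using vsize_venum by (rule order_trans) (simp add: mult_mono)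
qed (auto intro!: ptime_intros polyf_intros assms ptime_vmap)

lemma enc_list_map: "enc_list f (map g xs) = enc_list (\<lambda>x. f (g x)) xs"
  by (induction xs) auto

lemma venum_enc_list:
  "venum (enc_list c xs) = enc_list (\<lambda>(i, x). Node (enc_nat i) (c x)) (List.enumerate 0 xs)"
proof (induction xs)
  case (Cons x xs)
  have *: "enc_list (\<lambda>(i, x). Node (enc_nat i) (c x)) (enumerate (Suc 0) xs) =
      enc_list (\<lambda>(i, x). Node (Node Leaf (enc_nat i)) (c x)) (enumerate 0 xs)"
    by (simp add: enumerate_Suc_eq enc_list_map case_prod_unfold)
  show ?case by (simp add: Cons vmap_enc_list case_prod_unfold *[unfolded case_prod_unfold])
qed simp

text \<open>\<open>Leaf\<close> signals equality, in accordance with \<open>ptime_if\<close>. The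
  first argument is the context and is descended in parallel with the second; this is why
  \<open>ptime_rec\<close> admits the context maps \<open>C\<close> and \<open>D\<close>.\<close>

fun veq :: "val \<Rightarrow> val \<Rightarrow> val" where
  "veq x Leaf = x"
| "veq x (Node a l) = (if x = Leaf then Node Leaf Leaf
     else if veq (left x) a = Leaf then veq (right x) l else Node Leaf Leaf)"

lemma veq_iff: "veq x y = Leaf \<longleftrightarrow> x = y"
proof (induction y arbitrary: x)
  case (Node a l)
  then show ?case by (cases x) auto
qed simp

lemma vsize_left_right: "vsize (left x) \<le> vsize x" "vsize (right x) \<le> vsize x"
  by (cases x; simp)+

lemma vsize_veq: "vsize (veq x y) \<le> vsize x + 3"
proof (induction y arbitrary: x)
  case (Node a l)
  then show ?case using order_trans[OF Node.IH(2) add_right_mono[OF vsize_left_right(2)]] by auto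
qed simp

lemma ptime_veq:
  assumes "ptime F" "ptime G"
  shows "ptime (\<lambda>x. veq (F x) (G x))"
proof (rule ptime_comp2[OF ptime_rec[where B = "\<lambda>x. x" and C = left and D = right
        and S = "\<lambda>n. n + 3" and G = "\<lambda>x v ra rl. if x = Leaf then Node Leaf Leaf
          else if ra = Leaf then rl else Node Leaf Leaf"] assms])
  show "vsize (veq x y) \<le> vsize x + vsize y + 3" for x y
    using vsize_veq[of x y] by simp
qed (auto intro!: ptime_intros polyf_intros vsize_left_right)

fun vindex :: "val \<Rightarrow> val \<Rightarrow> val" where
  "vindex x Leaf = Leaf"
| "vindex x (Node a l) = (if veq a x = Leaf then Leaf else Node Leaf (vindex x l))"

lemma vsize_vindex: "vsize (vindex x l) \<le> vsize l"
proof (induction l)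
  case (Node a l)
  then show ?case using vsize_pos[of a] by simp
qed simp

lemma ptime_vindex: "ptime F \<Longrightarrow> ptime G \<Longrightarrow> ptime (\<lambda>x. vindex (F x) (G x))"
proof (rule ptime_lrec[where F = "vindex" and B = "\<lambda>x. Leaf"
        and G = "\<lambda>x v r. if veq (left v) x = Leaf then Leaf else Node Leaf r" and S = "\<lambda>n. n"])
  show "vsize (vindex x l) \<le> vsize x + vsize l" for x l
    using vsize_vindex by (rule trans_le_add2)
qed (auto intro!: ptime_intros ptime_veq polyf_intros)

fun index :: "'a \<Rightarrow> 'a list \<Rightarrow> nat" where
  "index x [] = 0"
| "index x (y # ys) = (if y = x then 0 else Suc (index x ys))"

lemma vindex_enc_list:
  "inj c \<Longrightarrow> vindex (c x) (enc_list c xs) = enc_nat (index x xs)"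
  by (induction xs) (auto simp: veq_iff inj_eq)

lemma nth_index: "x \<in> set xs \<Longrightarrow> index x xs < length xs \<and> xs ! index x xs = x"
  by (induction xs) auto

lemma inj_on_index: "inj_on (\<lambda>x. index x xs) (set xs)"
proof (rule inj_onI)
  fix x y
  assume "x \<in> set xs" "y \<in> set xs" "index x xs = index y xs"
  then show "x = y" using nth_index by metis
qed

fun vsucc_pairs :: "val \<Rightarrow> val" where
  "vsucc_pairs Leaf = Leaf"
| "vsucc_pairs (Node a l) = (if l = Leaf then Leaf else Node (Node a (left l)) (vsucc_pairs l))"

text \<open>The summand \<open>vsize (left v)\<close> reserves room for the copy of the head that a
  preceding entry puts into its pair; it makes the induction go through.\<close>

lemma vsize_vsucc_pairs: "vsize (vsucc_pairs v) + vsize (left v) \<le> 2 * vsize v"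
proof (induction v)
  case (Node a l)
  then show ?case by (cases l) auto
qed simp

lemma ptime_vsucc_pairs:
  assumes "ptime F"
  shows "ptime (\<lambda>x. vsucc_pairs (F x))"
proof (rule ptime_lrec[where F = "\<lambda>x. vsucc_pairs" and B = "\<lambda>x. Leaf" and C = "\<lambda>x. x"
      and G = "\<lambda>x v r. if right v = Leaf then Leaf else Node (Node (left v) (left (right v))) r"
      and S = "\<lambda>n. 2 * n"])
  show "vsize (vsucc_pairs v) \<le> 2 * (vsize x + vsize v)" for x v
    using vsize_vsucc_pairs[of v] by simp
qed (auto intro!: ptime_intros polyf_intros assms)

lemma vsucc_pairs_enc_list:
  "vsucc_pairs (enc_list c xs) = enc_list (\<lambda>(u, v). Node (c u) (c v)) (zip xs (tl xs))"
proof (induction xs)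
  case (Cons x xs)
  then show ?case by (cases xs) auto
qed simp

section \<open>Computable bounds and composition of reductions\<close>

fun vmul :: "val \<Rightarrow> val \<Rightarrow> val" where
  "vmul x Leaf = Leaf"
| "vmul x (Node a l) = app x (vmul x l)"

lemma vsize_vmul: "vsize (vmul x v) \<le> (vsize x + 1) * vsize v"
proof (induction v)
  case (Node a l)
  then show ?case using vsize_app[of x "vmul x l"] by (simp add: algebra_simps)
qed simp

lemma ptime_vmul: "ptime F \<Longrightarrow> ptime G \<Longrightarrow> ptime (\<lambda>x. vmul (F x) (G x))"
proof (rule ptime_lrec[where F = vmul and B = "\<lambda>x. Leaf" and G = "\<lambda>x v r. app x r"
      and S = "\<lambda>n. (n + 1) * n"])
  show "vsize (vmul x v) \<le> (vsize x + vsize v + 1) * (vsize x + vsize v)" for x v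
    using vsize_vmul by (rule order_trans) (intro mult_mono; simp)
qed (auto intro!: ptime_intros ptime_app polyf_intros)

lemma app_enc_nat: "app (enc_nat m) (enc_nat n) = enc_nat (m + n)"
  by (induction n) auto

lemma vmul_enc_nat: "vmul (enc_nat m) (enc_nat n) = enc_nat (m * n)"
  by (induction n) (auto simp: app_enc_nat)

text \<open>\<open>fpt_reducible\<close> demands computable bounds, so the polynomials that enter
  them must be computable too. Sum and product of unary numbers are \<open>app\<close> and
  \<open>vmul\<close>.\<close>

lemma polyf_unary:
  assumes "polyf h"
  shows "\<exists>F. ptime F \<and> (\<forall>n. F (enc_nat n) = enc_nat (h n))"
  using assms
proof (induction rule: polyf.induct)
  case polyf_id
  then show ?case by (intro exI[of _ "\<lambda>x. x"]) (auto intro: ptime_id)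
next
  case (polyf_const c)
  then show ?case by (intro exI[of _ "\<lambda>x. enc_nat c"]) (auto intro: ptime_const)
next
  case (polyf_add h k)
  then obtain F G where "ptime F \<and> (\<forall>n. F (enc_nat n) = enc_nat (h n))"
    "ptime G \<and> (\<forall>n. G (enc_nat n) = enc_nat (k n))" by blast
  then show ?case
    by (intro exI[of _ "\<lambda>x. app (F x) (G x)"]) (auto intro: ptime_app simp: app_enc_nat)
next
  case (polyf_mult h k)
  then obtain F G where "ptime F \<and> (\<forall>n. F (enc_nat n) = enc_nat (h n))"
    "ptime G \<and> (\<forall>n. G (enc_nat n) = enc_nat (k n))" by blast
  then show ?case
    by (intro exI[of _ "\<lambda>x. vmul (F x) (G x)"]) (auto intro: ptime_vmul simp: vmul_enc_nat)
qed

lemma computable_polyf: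
  assumes "computable f" "polyf h"
  shows "computable (\<lambda>n. h (f n))"
proof -
  obtain p where p: "\<And>n. \<exists>t. eval p p (enc_nat n) (enc_nat (f n)) t"
    using assms(1) unfolding computable_def run_def by blast
  obtain F where F: "ptime F" "\<And>n. F (enc_nat n) = enc_nat (h n)"
    using polyf_unary[OF assms(2)] by blast
  obtain q k where q: "\<And>x n. vsize x \<le> n \<Longrightarrow> \<exists>t \<le> k n. eval q q x (F x) t"
    using F(1) by (rule ptimeE) blast
  have "\<exists>t. eval (Apply q (Apply p Arg)) (Apply q (Apply p Arg)) (enc_nat n) (enc_nat (h (f n))) t" for n
  proof -
    obtain s where s: "eval p p (enc_nat n) (enc_nat (f n)) s" using p by blast
    obtain t where "eval q q (enc_nat (f n)) (enc_nat (h (f n))) t"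
      using q[OF order_refl, of "enc_nat (f n)"] unfolding F(2) by blast
    from eval.Apply[OF eval.Apply[OF eval.Arg s] this] show ?thesis by blast
  qed
  then show ?thesis unfolding computable_def run_def by blast
qed

text \<open>The parameter bound \<open>k\<close> is a polynomial, hence monotone, so it can be
  applied to the bound \<open>g\<close> of an arbitrary reduction. The program \<open>r\<close> is
  specified on instances of \<open>Q\<close> only, as the encoding of topological minors promises
  nothing for other inputs.\<close>

lemma fpt_reducible_polyf_trans:
  assumes "fpt_reducible P Q" "polyf h" "polyf k"
    and r: "\<And>y. y \<in> instances Q \<Longrightarrow> \<exists>z t. run r y z t \<and> t \<le> h (vsize y) \<and> z \<in> instances R \<and>
      (y \<in> yes Q \<longleftrightarrow> z \<in> yes R) \<and> param R z \<le> k (param Q y)"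
  shows "fpt_reducible P R"
proof -
  obtain q f g d where q: "computable f" "computable g"
    "\<And>x. x \<in> instances P \<Longrightarrow> \<exists>y t. eval q q x y t \<and> t \<le> f (param P x) * vsize x ^ d \<and>
      y \<in> instances Q \<and> (x \<in> yes P \<longleftrightarrow> y \<in> yes Q) \<and> param Q y \<le> g (param P x)"
    using assms(1) unfolding fpt_reducible_def run_def by blast
  obtain c e where c: "\<And>n. n \<ge> 1 \<Longrightarrow> h n \<le> c * n ^ e"
    using polyf_bound[OF assms(2)] by blast
  \<comment> \<open>Both \<open>?f\<close> and \<open>?d\<close> have one summand each for the first
    program, the second program and the copying of the input.\<close>
  let ?f = "\<lambda>n. f n + c * f n ^ e + 3"
  let ?d = "1 + d + d * e"
  have "\<exists>z t. eval (Apply r (Apply q Arg)) (Apply r (Apply q Arg)) x z t \<and>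
      t \<le> ?f (param P x) * vsize x ^ ?d \<and> z \<in> instances R \<and>
      (x \<in> yes P \<longleftrightarrow> z \<in> yes R) \<and> param R z \<le> k (g (param P x))" if "x \<in> instances P" for x
  proof -
    from q(3)[OF that] obtain y s where y: "eval q q x y s" "s \<le> f (param P x) * vsize x ^ d"
      "y \<in> instances Q" "x \<in> yes P \<longleftrightarrow> y \<in> yes Q" "param Q y \<le> g (param P x)" by blast
    from r[OF y(3)] obtain z t where z: "eval r r y z t" "t \<le> h (vsize y)" "z \<in> instances R"
      "y \<in> yes Q \<longleftrightarrow> z \<in> yes R" "param R z \<le> k (param Q y)" unfolding run_def by blast
    let ?m = "f (param P x) * vsize x ^ d"
    have n: "vsize x \<ge> 1" using vsize_pos[of x] by simp
    \<comment> \<open>The intermediate instance is no larger than the time spent on it; as its size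
      is positive, \<open>?m \<ge> 1\<close> follows, which the bound \<open>c * n ^ e\<close>
      requires.\<close>
    have "vsize y \<le> ?m" using vsize_le_time[OF y(1)] y(2) by simp
    moreover from this vsize_pos[of y] have "?m \<ge> 1" by linarith
    ultimately have "t \<le> c * ?m ^ e"
      using z(2) polyf_mono[OF assms(2), of "vsize y" ?m] c[of ?m] by linarith
    also have "\<dots> = c * f (param P x) ^ e * vsize x ^ (d * e)"
      by (simp add: power_mult_distrib power_mult)
    also have "\<dots> \<le> c * f (param P x) ^ e * vsize x ^ ?d"
      using n by (intro mult_le_mono2 power_increasing) auto
    finally have t: "t \<le> c * f (param P x) ^ e * vsize x ^ ?d" .
    have s: "s \<le> f (param P x) * vsize x ^ ?d"
      using y(2) n by (elim order_trans, intro mult_le_mono2 power_increasing) auto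
    have "vsize x ^ 1 \<le> vsize x ^ ?d" using n by (intro power_increasing) auto
    then have "vsize x + 2 \<le> 3 * vsize x ^ ?d" using n unfolding power_one_right by linarith
    with s t have "(vsize x + s + 1) + t + 1 \<le> ?f (param P x) * vsize x ^ ?d"
      by (simp add: algebra_simps)
    moreover have "eval (Apply r (Apply q Arg)) (Apply r (Apply q Arg)) x z ((vsize x + s + 1) + t + 1)"
      using eval.Apply[OF eval.Apply[OF eval.Arg y(1)] z(1)] .
    moreover have "param R z \<le> k (g (param P x))"
      using z(5) polyf_mono[OF assms(3) y(5)] by simp
    ultimately show ?thesis using y(4) z(3,4) by blast
  qed
  moreover have "computable ?f" using computable_polyf[OF q(1), of "\<lambda>n. n + c * n ^ e + 3"]
    by (simp add: polyf_intros)
  moreover have "computable (\<lambda>n. k (g n))" using computable_polyf[OF q(2) assms(3)] .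
  ultimately show ?thesis unfolding fpt_reducible_def run_def
    by (intro exI[of _ "Apply r (Apply q Arg)"] exI[of _ ?f] exI[of _ "\<lambda>n. k (g n)"] exI[of _ ?d]) blast
qed

section \<open>Subdivided graphs\<close>

text \<open>The complement of the relation defined by \<open>Conn\<close>. It holds in particular
  whenever \<open>x\<close> or \<open>y\<close> lies in \<open>Z\<close>.\<close>

definition separated :: "graph \<Rightarrow> nat set \<Rightarrow> nat \<Rightarrow> nat \<Rightarrow> bool" where
  "separated G Z x y \<longleftrightarrow> \<not> (\<exists>p. is_path G p \<and> hd p = x \<and> last p = y \<and> set p \<inter> Z = {})"

lemma path_in_closed_set:
  assumes "is_path G p" "hd p \<in> S" "set p \<inter> Z = {}"
    and "\<And>u v. u \<in> S \<Longrightarrow> {u, v} \<in> edges G \<Longrightarrow> v \<in> S \<union> Z"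
  shows "set p \<subseteq> S"
  using assms(1-3)
proof (induction p)
  case (Cons x p)
  show ?case
  proof (cases p)
    case (Cons y q)
    with Cons.prems have "is_path G p" "{x, y} \<in> edges G" "x \<in> S" "y \<notin> Z" "set p \<inter> Z = {}"
      by (auto simp: is_path_def)
    with assms(4)[of x y] Cons Cons.IH show ?thesis by simp
  qed (use Cons.prems in simp)
qed simp

text \<open>A path avoiding \<open>Z\<close> cannot leave a set whose outgoing edges all end in
  \<open>Z\<close>. Such a set certifies all nontrivial separations below.\<close>

lemma separated_by_closed_set:
  assumes "x \<in> S" "y \<notin> S" "\<And>u v. u \<in> S \<Longrightarrow> {u, v} \<in> edges G \<Longrightarrow> v \<in> S \<union> Z"
  shows "separated G Z x y"
  unfolding separated_def
proof (intro notI, elim exE conjE)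
  fix p assume p: "is_path G p" "hd p = x" "last p = y" "set p \<inter> Z = {}"
  from path_in_closed_set[OF p(1) _ p(4) assms(3)] p(2) assms(1) have "set p \<subseteq> S" by simp
  moreover from p(1,3) have "y \<in> set p" by (auto simp: is_path_def)
  ultimately show False using assms(2) by auto
qed

definition branching :: "graph \<Rightarrow> nat \<Rightarrow> bool" where
  "branching G x \<longleftrightarrow> (\<exists>a \<in> verts G. \<exists>b \<in> verts G. \<exists>c \<in> verts G. {x, a} \<in> edges G \<and> {x, b} \<in> edges G \<and>
     {x, c} \<in> edges G \<and> a \<noteq> b \<and> a \<noteq> c \<and> b \<noteq> c)"

text \<open>\<open>w\<close> is meant as the first step from \<open>x\<close> to \<open>y\<close>.
  The condition on \<open>{x}\<close> excludes steps towards pendant vertices, which satisfy the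
  condition on \<open>{x, y}\<close> anyway. If the path is a single edge, \<open>w\<close> is
  \<open>y\<close> and the last condition is trivial.\<close>

definition joined :: "graph \<Rightarrow> nat \<Rightarrow> nat \<Rightarrow> bool" where
  "joined G x y \<longleftrightarrow> (\<exists>w \<in> verts G. {x, w} \<in> edges G \<and> \<not> separated G {x} w y \<and>
     (\<forall>z \<in> verts G. branching G z \<longrightarrow> separated G {x, y} w z))"

definition pendants :: "graph \<Rightarrow> nat \<Rightarrow> nat set" where
  "pendants G x =
     {w \<in> verts G. {x, w} \<in> edges G \<and> (\<forall>z \<in> verts G. branching G z \<longrightarrow> separated G {x} w z)}"

definition path_edges :: "nat list \<Rightarrow> nat set set" where
  "path_edges p = (\<lambda>(u, v). {u, v}) ` set (zip p (tl p))"

lemma in_zip_tl_iff: "(x, y) \<in> set (zip p (tl p)) \<longleftrightarrow> (\<exists>us vs. p = us @ x # y # vs)"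
proof (induction p)
  case (Cons z p)
  show ?case
  proof (cases p)
    case (Cons w q)
    have "(x, y) \<in> set (zip (z # p) (tl (z # p))) \<longleftrightarrow> x = z \<and> y = w \<or> (x, y) \<in> set (zip p (tl p))"
      using Cons by auto
    also have "\<dots> \<longleftrightarrow> x = z \<and> y = w \<or> (\<exists>us vs. p = us @ x # y # vs)"
      by (simp add: Cons.IH)
    also have "\<dots> \<longleftrightarrow> (\<exists>us vs. z # p = us @ x # y # vs)"
    proof
      assume "\<exists>us vs. z # p = us @ x # y # vs"
      then obtain us vs where "z # p = us @ x # y # vs" by blast
      then show "x = z \<and> y = w \<or> (\<exists>us vs. p = us @ x # y # vs)"
        using Cons by (cases us) auto
    next
      assume "x = z \<and> y = w \<or> (\<exists>us vs. p = us @ x # y # vs)"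
      then show "\<exists>us vs. z # p = us @ x # y # vs"
      proof
        assume "x = z \<and> y = w"
        then show ?thesis using Cons by (intro exI[of _ "[]"] exI[of _ q]) auto
      next
        assume "\<exists>us vs. p = us @ x # y # vs"
        then show ?thesis by (metis append_Cons)
      qed
    qed
    finally show ?thesis .
  qed auto
qed simp

lemma path_edges_iff:
  "{x, y} \<in> path_edges p \<longleftrightarrow> (\<exists>us vs. p = us @ x # y # vs) \<or> (\<exists>us vs. p = us @ y # x # vs)"
  unfolding path_edges_def in_zip_tl_iff[symmetric] by (auto simp: doubleton_eq_iff)

lemma successively_iff_zip: "successively P p \<longleftrightarrow> (\<forall>(x, y) \<in> set (zip p (tl p)). P x y)"
proof (induction p)
  case (Cons x p)
  then show ?case by (cases p) auto
qed simp

lemma append_Cons_rev: "p = us @ x # y # vs \<longleftrightarrow> rev p = rev vs @ y # x # rev us"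
  by (metis append.assoc append_Cons append_Nil rev.simps(2) rev_append rev_rev_ident)

text \<open>All vertices of \<open>G\<close> are kept, so that its vertex list can be reused when
  this graph is output.\<close>

definition path_graph :: "graph \<Rightarrow> graph \<Rightarrow> (nat set \<Rightarrow> nat list) \<Rightarrow> graph" where
  "path_graph H G \<pi> = \<lparr>verts = verts G, edges = (\<Union>e \<in> edges H. path_edges (\<pi> e))\<rparr>"

text \<open>
  Three pendant vertices for each vertex of the core \<open>K\<close> make the core recognisable by degrees in
  a subdivision of \<open>H\<close>.
\<close>

locale subdivision =
  fixes H G :: graph and \<eta> :: "nat \<Rightarrow> nat" and \<pi> :: "nat set \<Rightarrow> nat list" and K :: "nat set"
  assumes H: "is_graph H" and G: "is_graph G" and model: "topological_minor_model H G \<eta> \<pi>"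
    and K: "K \<subseteq> verts H"
    and edge_meets_core: "e \<in> edges H \<Longrightarrow> e \<inter> K \<noteq> {}"
    and pendant: "p \<in> verts H - K \<Longrightarrow> e \<in> edges H \<Longrightarrow> p \<in> e \<Longrightarrow> f \<in> edges H \<Longrightarrow> p \<in> f \<Longrightarrow> e = f"
    and three: "v \<in> K \<Longrightarrow> 3 \<le> card {p \<in> verts H - K. {v, p} \<in> edges H}"
begin

definition G' :: graph where
  "G' = path_graph H G \<pi>"

text \<open>Edges of \<open>H\<close> are unordered and \<open>\<pi>\<close> lists a path in either
  direction. A fixed direction is needed to speak of the first step away from a branch
  vertex.\<close>

definition P :: "nat \<Rightarrow> nat \<Rightarrow> nat list" where
  "P a b = (if hd (\<pi> {a, b}) = \<eta> a then \<pi> {a, b} else rev (\<pi> {a, b}))"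

lemma verts_G' [simp]: "verts G' = verts G"
  by (simp add: G'_def path_graph_def)

lemma edge_verts: "{a, b} \<in> edges H \<Longrightarrow> a \<in> verts H \<and> b \<in> verts H \<and> a \<noteq> b"
  using H by (fastforce simp: is_graph_def card_2_iff)

lemma \<eta>_eq: "a \<in> verts H \<Longrightarrow> b \<in> verts H \<Longrightarrow> \<eta> a = \<eta> b \<longleftrightarrow> a = b"
  using model by (auto simp: topological_minor_model_def inj_on_def)

lemma \<eta>_verts: "a \<in> verts H \<Longrightarrow> \<eta> a \<in> verts G"
  using model by (auto simp: topological_minor_model_def)

lemma \<pi>: "e \<in> edges H \<Longrightarrow> is_path G (\<pi> e) \<and> {hd (\<pi> e), last (\<pi> e)} = \<eta> ` e"
  using model by (auto simp: topological_minor_model_def)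

lemma inner_disjoint:
  "e \<in> edges H \<Longrightarrow> f \<in> edges H \<Longrightarrow> e \<noteq> f \<Longrightarrow> x \<in> set (\<pi> e) \<Longrightarrow> x \<notin> \<eta> ` e \<Longrightarrow> x \<notin> set (\<pi> f)"
  using model \<pi>[of e] unfolding topological_minor_model_def by blast

lemma P_ends:
  assumes "{a, b} \<in> edges H"
  shows "hd (P a b) = \<eta> a" "last (P a b) = \<eta> b" "distinct (P a b)" "P a b \<noteq> []"
    "set (P a b) = set (\<pi> {a, b})"
proof -
  from \<pi>[OF assms] have *: "is_path G (\<pi> {a, b})" "{hd (\<pi> {a, b}), last (\<pi> {a, b})} = {\<eta> a, \<eta> b}"
    by auto
  from edge_verts[OF assms] have "\<eta> a \<noteq> \<eta> b" by (simp add: \<eta>_eq)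
  with * show "hd (P a b) = \<eta> a" "last (P a b) = \<eta> b" "distinct (P a b)" "P a b \<noteq> []"
    "set (P a b) = set (\<pi> {a, b})"
    by (auto simp: P_def is_path_def hd_rev last_rev doubleton_eq_iff)
qed

lemma P_rev:
  assumes "{a, b} \<in> edges H"
  shows "P b a = rev (P a b)"
proof -
  from \<pi>[OF assms] have *: "{hd (\<pi> {a, b}), last (\<pi> {a, b})} = {\<eta> a, \<eta> b}"
    by auto
  from edge_verts[OF assms] have "\<eta> a \<noteq> \<eta> b" by (simp add: \<eta>_eq)
  with * show ?thesis by (auto simp: P_def insert_commute doubleton_eq_iff)
qed

lemma edge_G'_iff:
  "{x, y} \<in> edges G' \<longleftrightarrow> (\<exists>a b us vs. {a, b} \<in> edges H \<and> P a b = us @ x # y # vs)"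
proof
  assume "{x, y} \<in> edges G'"
  then obtain e where e: "e \<in> edges H" "{x, y} \<in> path_edges (\<pi> e)"
    by (auto simp: G'_def path_graph_def)
  from e(1) H have "card e = 2" by (simp add: is_graph_def)
  then obtain a b where ab: "e = {a, b}" by (auto simp: card_2_iff)
  from e(2) have "(\<exists>us vs. P a b = us @ x # y # vs) \<or> (\<exists>us vs. P b a = us @ x # y # vs)"
    using P_rev e(1) unfolding ab path_edges_iff
    by (metis P_def append_Cons_rev rev_rev_ident)
  with e(1) show "\<exists>a b us vs. {a, b} \<in> edges H \<and> P a b = us @ x # y # vs"
    unfolding ab by (metis insert_commute)
next
  assume "\<exists>a b us vs. {a, b} \<in> edges H \<and> P a b = us @ x # y # vs"
  then obtain a b us vs where *: "{a, b} \<in> edges H" "P a b = us @ x # y # vs" by blast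
  then have "{x, y} \<in> path_edges (\<pi> {a, b})"
    unfolding path_edges_iff by (metis P_def append_Cons_rev rev_rev_ident)
  with *(1) show "{x, y} \<in> edges G'" by (auto simp: G'_def path_graph_def)
qed

lemma edges_G'_subset: "edges G' \<subseteq> edges G"
proof
  fix f assume "f \<in> edges G'"
  then obtain e where e: "e \<in> edges H" "f \<in> path_edges (\<pi> e)"
    by (auto simp: G'_def path_graph_def)
  with \<pi>[OF e(1)] show "f \<in> edges G"
    by (auto simp: is_path_def successively_iff_zip path_edges_def)
qed

lemma subgraph_G': "subgraph G' G"
  using G edges_G'_subset by (auto simp: subgraph_def is_graph_def)

lemma subpath:
  assumes "{a, b} \<in> edges H" "P a b = us @ p @ vs" "p \<noteq> []"
  shows "is_path G' p"
proof -
  have "set (P a b) \<subseteq> verts G" using P_ends(5)[OF assms(1)] \<pi>[OF assms(1)] by (simp add: is_path_def)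
  moreover have "{x, y} \<in> edges G'" if xy: "(x, y) \<in> set (zip p (tl p))" for x y
  proof -
    from xy obtain us' vs' where "p = us' @ x # y # vs'" unfolding in_zip_tl_iff by blast
    with assms(2) have "P a b = (us @ us') @ x # y # (vs' @ vs)" by simp
    with assms(1) show ?thesis unfolding edge_G'_iff by blast
  qed
  ultimately show ?thesis
    using assms P_ends(3)[OF assms(1)] by (auto simp: is_path_def successively_iff_zip)
qed

text \<open>If \<open>a\<close> were not in \<open>e\<close>, its image would be an inner vertex of
  the path of \<open>e\<close> lying on the path of \<open>{a, b}\<close>. The edge at
  \<open>a\<close> matters, since a model may route paths through images of isolated
  vertices.\<close>

lemma nonisolated_on_path:
  assumes "{a, b} \<in> edges H" "e \<in> edges H" "\<eta> a \<in> set (\<pi> e)"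
  shows "a \<in> e"
proof (rule ccontr)
  assume a: "a \<notin> e"
  have "e \<subseteq> verts H" using H assms(2) by (auto simp: is_graph_def)
  with a edge_verts[OF assms(1)] have "\<eta> a \<notin> \<eta> ` e" by (auto simp: \<eta>_eq)
  moreover have "e \<noteq> {a, b}" using a by auto
  moreover have "\<eta> a \<in> set (\<pi> {a, b})" using P_ends[OF assms(1)] by (metis hd_in_set)
  ultimately show False using inner_disjoint[OF assms(2,1)] assms(3) by blast
qed

lemma core_nonisolated: "a \<in> K \<Longrightarrow> \<exists>b. {a, b} \<in> edges H"
proof -
  assume "a \<in> K"
  from three[OF this] have "{p \<in> verts H - K. {a, p} \<in> edges H} \<noteq> {}"
    by (intro notI) (simp only: card.empty)
  then show ?thesis by blast
qed

lemma core_on_path: "a \<in> K \<Longrightarrow> e \<in> edges H \<Longrightarrow> \<eta> a \<in> set (\<pi> e) \<Longrightarrow> a \<in> e"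
  using core_nonisolated nonisolated_on_path by blast

section \<open>Neighbours and separation in the subdivision\<close>

definition second :: "nat \<Rightarrow> nat \<Rightarrow> nat" where
  "second a b = P a b ! 1"

lemma P_second:
  assumes "{a, b} \<in> edges H"
  obtains vs where "P a b = \<eta> a # second a b # vs"
proof -
  from edge_verts[OF assms] have "\<eta> a \<noteq> \<eta> b" by (simp add: \<eta>_eq)
  with P_ends[OF assms] obtain y vs where *: "P a b = \<eta> a # y # vs"
    by (cases "P a b"; cases "tl (P a b)") auto
  then have "second a b = y" by (simp add: second_def)
  with * that show thesis by blast
qed

text \<open>A path of the model through \<open>\<eta> a\<close> has it as an end, so an edge of
  \<open>G'\<close> at \<open>\<eta> a\<close> is the first step of the path for some edge at
  \<open>a\<close>.\<close>

lemma neighbour_branch_iff: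
  assumes "{a, b} \<in> edges H"
  shows "{\<eta> a, y} \<in> edges G' \<longleftrightarrow> (\<exists>c. {a, c} \<in> edges H \<and> y = second a c)"
proof
  assume "{\<eta> a, y} \<in> edges G'"
  then obtain c d us vs where *: "{c, d} \<in> edges H" "P c d = us @ \<eta> a # y # vs"
    unfolding edge_G'_iff by blast
  from P_ends(5)[OF *(1)] *(2) have "\<eta> a \<in> set (\<pi> {c, d})" by (metis in_set_conv_decomp)
  then have "a \<in> {c, d}" by (rule nonisolated_on_path[OF assms *(1)])
  moreover have "\<eta> d \<in> set (y # vs)"
    using P_ends(2)[OF *(1)] *(2) last_in_set[of "y # vs"] by simp
  then have "\<eta> a \<noteq> \<eta> d"
    using P_ends(3)[OF *(1)] *(2) by auto
  ultimately have a: "a = c" by auto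
  moreover have "us = []"
    using P_ends(1,3)[OF *(1)] *(2) a by (cases us) auto
  ultimately have "y = second a d" using *(2) by (simp add: second_def)
  with a * show "\<exists>c. {a, c} \<in> edges H \<and> y = second a c" by blast
next
  assume "\<exists>c. {a, c} \<in> edges H \<and> y = second a c"
  then obtain c where c: "{a, c} \<in> edges H" "y = second a c" by blast
  from P_second[OF c(1)] obtain vs where "P a c = [] @ \<eta> a # y # vs" unfolding c(2) by auto
  with c(1) show "{\<eta> a, y} \<in> edges G'" unfolding edge_G'_iff by blast
qed

lemma second_on_path:
  assumes "{a, b} \<in> edges H"
  shows "second a b \<in> set (\<pi> {a, b}) \<and> second a b \<noteq> \<eta> a"
proof -
  obtain vs where "P a b = \<eta> a # second a b # vs" using P_second[OF assms] .
  with P_ends(3,5)[OF assms] show ?thesis by auto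
qed

lemma second_verts: "{a, b} \<in> edges H \<Longrightarrow> second a b \<in> verts G"
  using second_on_path[of a b] \<pi>[of "{a, b}"] by (auto simp: is_path_def)

text \<open>Two paths leaving \<open>\<eta> a\<close> share no inner vertex, so a common first step
  would be the far end of both.\<close>

lemma second_inj:
  assumes "{a, b} \<in> edges H" "{a, c} \<in> edges H" "second a b = second a c"
  shows "b = c"
proof (rule ccontr)
  assume bc: "b \<noteq> c"
  have ne: "{a, b} \<noteq> {a, c}" using bc by (auto simp: doubleton_eq_iff)
  have "second a b \<in> \<eta> ` {a, b}" "second a c \<in> \<eta> ` {a, c}"
    using inner_disjoint[OF assms(1,2) ne, of "second a b"] inner_disjoint[OF assms(2,1) ne[symmetric], of "second a b"]
      second_on_path[OF assms(1)] second_on_path[OF assms(2)] assms(3) by auto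
  with second_on_path[OF assms(1)] second_on_path[OF assms(2)] assms(3) have "\<eta> b = \<eta> c" by auto
  with bc \<eta>_eq edge_verts[OF assms(1)] edge_verts[OF assms(2)] show False by simp
qed

lemma neighbour_inner:
  assumes "e \<in> edges H" "x \<in> set (\<pi> e)" "x \<notin> \<eta> ` e" "{x, y} \<in> edges G'"
  shows "{x, y} \<in> path_edges (\<pi> e)"
proof -
  from assms(4) obtain f where f: "f \<in> edges H" "{x, y} \<in> path_edges (\<pi> f)"
    by (auto simp: G'_def path_graph_def)
  then have "x \<in> set (\<pi> f)" unfolding path_edges_iff by auto
  with inner_disjoint[OF assms(1) f(1) _ assms(2,3)] have "f = e" by blast
  with f show ?thesis by simp
qed

text \<open>\<open>x\<close> occurs once, and its neighbours can only be the entries just before and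
  just after it.\<close>

lemma path_degree:
  assumes "distinct p" "{x, a} \<in> path_edges p" "{x, b} \<in> path_edges p" "{x, c} \<in> path_edges p"
  shows "a = b \<or> a = c \<or> b = c"
proof -
  have "x \<in> set p" using assms(2) unfolding path_edges_iff by auto
  then obtain us vs where p: "p = us @ x # vs" by (auto simp: in_set_conv_decomp)
  have "y = last us \<or> y = hd vs" if "{x, y} \<in> path_edges p" for y
    using that unfolding path_edges_iff
  proof (elim disjE exE)
    fix us' vs' assume "p = us' @ x # y # vs'"
    with p have "us @ x # vs = us' @ x # (y # vs')" by simp
    then have "us = us' \<and> vs = y # vs'" using p assms(1) by (subst (asm) append_Cons_eq_iff) auto
    then show ?thesis by auto
  next
    fix us' vs' assume "p = us' @ y # x # vs'"
    then have "p = (us' @ [y]) @ x # vs'" by simp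
    with p have "us @ x # vs = (us' @ [y]) @ x # vs'" by simp
    then have "us = us' @ [y] \<and> vs = vs'" using p assms(1) by (subst (asm) append_Cons_eq_iff) auto
    then show ?thesis by auto
  qed
  with assms show ?thesis by metis
qed

text \<open>Inner vertices of paths have degree at most two and ends at pendant vertices degree one,
  while the paths to the three pendant vertices of a core vertex start with different edges.\<close>

lemma branching_iff: "branching G' x \<longleftrightarrow> x \<in> \<eta> ` K"
proof
  assume "x \<in> \<eta> ` K"
  then obtain k where k: "k \<in> K" "x = \<eta> k" by blast
  from three[OF k(1)] obtain A where "A \<subseteq> {p \<in> verts H - K. {k, p} \<in> edges H}" "card A = 3"
    by (meson obtain_subset_with_card_n)
  then obtain a b c where *: "{k, a} \<in> edges H" "{k, b} \<in> edges H" "{k, c} \<in> edges H"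
    "a \<noteq> b" "a \<noteq> c" "b \<noteq> c" by (auto simp: card_3_iff)
  show "branching G' x" unfolding branching_def k(2) neighbour_branch_iff[OF *(1)]
    using * second_inj second_verts unfolding verts_G' by blast
next
  assume "branching G' x"
  then obtain a b c where *: "{x, a} \<in> edges G'" "{x, b} \<in> edges G'" "{x, c} \<in> edges G'"
    "a \<noteq> b" "a \<noteq> c" "b \<noteq> c" unfolding branching_def by blast
  from *(1) obtain e where e: "e \<in> edges H" "{x, a} \<in> path_edges (\<pi> e)"
    by (auto simp: G'_def path_graph_def)
  then have x: "x \<in> set (\<pi> e)" unfolding path_edges_iff by auto
  show "x \<in> \<eta> ` K"
  proof (cases "x \<in> \<eta> ` e")
    case False
    from \<pi>[OF e(1)] have "distinct (\<pi> e)" by (simp add: is_path_def)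
    from path_degree[OF this neighbour_inner[OF e(1) x False *(1)] neighbour_inner[OF e(1) x False *(2)]
        neighbour_inner[OF e(1) x False *(3)]] * show ?thesis by blast
  next
    case True
    then obtain k where k: "k \<in> e" "x = \<eta> k" by blast
    from e(1) H have "card e = 2" "e \<subseteq> verts H" by (auto simp: is_graph_def)
    with k(1) obtain l where l: "e = {k, l}" by (auto simp: card_2_iff)
    have "k \<in> K"
    proof (rule ccontr)
      assume kK: "k \<notin> K"
      have "y = second k l" if "{x, y} \<in> edges G'" for y
      proof -
        from that obtain m where "{k, m} \<in> edges H" "y = second k m"
          unfolding k(2) neighbour_branch_iff[OF e(1)[unfolded l]] by blast
        moreover from this(1) pendant[of k "{k, m}" "{k, l}"] kK k \<open>e \<subseteq> verts H\<close> e(1) l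
        have "{k, m} = {k, l}" by auto
        ultimately show ?thesis by (auto simp: doubleton_eq_iff)
      qed
      with * show False by blast
    qed
    with k show ?thesis by blast
  qed
qed

text \<open>An inner vertex has neighbours on its own path only; so has the image of a pendant
  vertex \<open>c\<close>, whose sole edge is \<open>{a, c}\<close>. Hence the path can be left only
  through \<open>\<eta> a\<close> or a core end.\<close>

lemma closed_inner:
  assumes "{a, c} \<in> edges H" "u \<in> set (\<pi> {a, c})" "u \<noteq> \<eta> a" "u = \<eta> c \<Longrightarrow> c \<notin> K" "{u, v} \<in> edges G'"
  shows "v \<in> set (\<pi> {a, c})"
proof (cases "u = \<eta> c")
  case False
  with assms neighbour_inner[of "{a, c}" u v] show ?thesis unfolding path_edges_iff by auto
next
  case True
  have ca: "{c, a} \<in> edges H" using assms(1) by (simp add: insert_commute)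
  from assms(5) obtain d where d: "{c, d} \<in> edges H" "v = second c d"
    unfolding True neighbour_branch_iff[OF ca] by blast
  from pendant[of c "{c, d}" "{c, a}"] assms(4) True d(1) ca edge_verts[OF ca] have "{c, d} = {c, a}" by auto
  with second_on_path[OF d(1)] d(2) show ?thesis by (simp add: insert_commute)
qed

text \<open>The path of the model without its first vertex is the witness.\<close>

lemma second_connected:
  assumes "{a, c} \<in> edges H" "Z \<inter> set (\<pi> {a, c}) \<subseteq> {\<eta> a}"
  shows "\<not> separated G' Z (second a c) (\<eta> c)"
proof -
  obtain vs where vs: "P a c = \<eta> a # second a c # vs" using P_second[OF assms(1)] .
  then have "is_path G' (second a c # vs)"
    using subpath[OF assms(1), of "[\<eta> a]" "second a c # vs" "[]"] by simp
  moreover have "last (second a c # vs) = \<eta> c" using P_ends(2)[OF assms(1)] vs by simp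
  moreover have "set (second a c # vs) \<inter> Z = {}"
    using P_ends(3,5)[OF assms(1)] vs assms(2) by auto
  ultimately show ?thesis unfolding separated_def by (metis list.sel(1))
qed

text \<open>The path to a pendant vertex is a dead end: without \<open>\<eta> a\<close> it is a
  closed set that contains no image of a core vertex.\<close>

lemma second_separated_pendant:
  assumes "{a, c} \<in> edges H" "c \<notin> K" "z \<in> K"
  shows "separated G' {\<eta> a} (second a c) (\<eta> z)"
proof (rule separated_by_closed_set[where S = "set (\<pi> {a, c}) - {\<eta> a}"])
  show "second a c \<in> set (\<pi> {a, c}) - {\<eta> a}" using second_on_path[OF assms(1)] by simp
  show "\<eta> z \<notin> set (\<pi> {a, c}) - {\<eta> a}" using core_on_path[OF assms(3,1)] assms(2,3) by auto
qed (use closed_inner[OF assms(1)] assms(2) in auto)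

text \<open>The inner vertices of the path form a set closed up to the two ends, and no image of a
  core vertex is among them.\<close>

lemma second_separated_core:
  assumes "{a, b} \<in> edges H" "z \<in> K"
  shows "separated G' {\<eta> a, \<eta> b} (second a b) (\<eta> z)"
proof (cases "second a b = \<eta> b")
  \<comment> \<open>The path is a single edge, and the starting vertex is itself deleted.\<close>
  case True
  then show ?thesis by (auto simp: separated_def is_path_def) (metis hd_in_set)
next
  case False
  show ?thesis
  proof (rule separated_by_closed_set[where S = "set (\<pi> {a, b}) - {\<eta> a, \<eta> b}"])
    show "second a b \<in> set (\<pi> {a, b}) - {\<eta> a, \<eta> b}" using second_on_path[OF assms(1)] False by simp
    show "\<eta> z \<notin> set (\<pi> {a, b}) - {\<eta> a, \<eta> b}" using core_on_path[OF assms(2,1)] by auto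
  qed (use closed_inner[OF assms(1)] in auto)
qed

lemma joined_iff:
  assumes "a \<in> K" "b \<in> K"
  shows "joined G' (\<eta> a) (\<eta> b) \<longleftrightarrow> {a, b} \<in> edges H"
  unfolding joined_def
proof (rule sym, rule iffI)
  assume ab: "{a, b} \<in> edges H"
  show "\<exists>w \<in> verts G'. {\<eta> a, w} \<in> edges G' \<and> \<not> separated G' {\<eta> a} w (\<eta> b) \<and>
     (\<forall>z \<in> verts G'. branching G' z \<longrightarrow> separated G' {\<eta> a, \<eta> b} w z)"
    using second_verts[OF ab] second_connected[OF ab, of "{\<eta> a}"] second_separated_core[OF ab]
      neighbour_branch_iff[OF ab] ab unfolding branching_iff verts_G'
    by (intro bexI[of _ "second a b"] conjI) auto
next
  assume "\<exists>w \<in> verts G'. {\<eta> a, w} \<in> edges G' \<and> \<not> separated G' {\<eta> a} w (\<eta> b) \<and>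
     (\<forall>z \<in> verts G'. branching G' z \<longrightarrow> separated G' {\<eta> a, \<eta> b} w z)"
  then obtain w where w: "{\<eta> a, w} \<in> edges G'" "\<not> separated G' {\<eta> a} w (\<eta> b)"
    "\<And>z. z \<in> K \<Longrightarrow> separated G' {\<eta> a, \<eta> b} w (\<eta> z)"
    unfolding branching_iff verts_G' using K \<eta>_verts by blast
  from core_nonisolated[OF assms(1)] w(1) obtain c where c: "{a, c} \<in> edges H" "w = second a c"
    using neighbour_branch_iff by blast
  have "a \<noteq> b" using w(2) by (auto simp: separated_def is_path_def) (metis last_in_set)
  show "{a, b} \<in> edges H"
  proof (rule ccontr)
    assume ab: "{a, b} \<notin> edges H"
    with c have "b \<noteq> c" by auto
    with \<open>a \<noteq> b\<close> have b: "\<eta> b \<notin> set (\<pi> {a, c})" using core_on_path[OF assms(2) c(1)] by auto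
    \<comment> \<open>If \<open>c\<close> is in the core, \<open>w\<close> reaches
      \<open>\<eta> c\<close> while avoiding \<open>\<eta> a\<close> and \<open>\<eta> b\<close>; if
      \<open>c\<close> is pendant, \<open>w\<close> cannot reach \<open>\<eta> b\<close> without
      \<open>\<eta> a\<close>. Either contradicts the choice of \<open>w\<close>.\<close>
    show False
    proof (cases "c \<in> K")
      case True
      with w(3)[OF True] second_connected[OF c(1), of "{\<eta> a, \<eta> b}"] b c(2) show False by auto
    next
      case False
      from second_separated_pendant[OF c(1) False assms(2)] w(2) c(2) show False by simp
    qed
  qed
qed

lemma pendant_neighbours:
  assumes "a \<in> K"
  shows "pendants G' (\<eta> a) = second a ` {p \<in> verts H - K. {a, p} \<in> edges H}" (is "_ = ?R")
  unfolding pendants_def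
proof (intro equalityI subsetI)
  fix w
  assume "w \<in> {w \<in> verts G'. {\<eta> a, w} \<in> edges G' \<and>
    (\<forall>z \<in> verts G'. branching G' z \<longrightarrow> separated G' {\<eta> a} w z)}"
  then have w: "{\<eta> a, w} \<in> edges G'" "\<And>z. z \<in> K \<Longrightarrow> separated G' {\<eta> a} w (\<eta> z)"
    unfolding branching_iff verts_G' using K \<eta>_verts by blast+
  from core_nonisolated[OF assms(1)] w(1) obtain c where c: "{a, c} \<in> edges H" "w = second a c"
    using neighbour_branch_iff by blast
  have "c \<notin> K" using second_connected[OF c(1), of "{\<eta> a}"] w(2) c(2) by auto
  with c edge_verts[OF c(1)] show "w \<in> ?R" by auto
next
  fix w assume "w \<in> ?R"
  then obtain c where c: "{a, c} \<in> edges H" "w = second a c" "c \<notin> K" by auto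
  with second_separated_pendant[OF c(1,3)] second_verts[OF c(1)] neighbour_branch_iff[OF c(1)]
  show "w \<in> {w \<in> verts G'. {\<eta> a, w} \<in> edges G' \<and>
    (\<forall>z \<in> verts G'. branching G' z \<longrightarrow> separated G' {\<eta> a} w z)}"
    unfolding branching_iff verts_G' by auto
qed

lemma card_pendants:
  assumes "a \<in> K"
  shows "card (pendants G' (\<eta> a)) = card {p \<in> verts H - K. {a, p} \<in> edges H}"
  unfolding pendant_neighbours[OF assms]
  by (rule card_image) (auto intro: inj_onI second_inj)

end

text \<open>All labels in use are at least three, so a vertex carrying one is branching and the
  formulas need no separate test for the core.\<close>

lemma branching_if_pendants:
  assumes "3 \<le> card (pendants G x)"
  shows "branching G x"
proof -
  from assms obtain A where "A \<subseteq> pendants G x" "card A = 3"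
    by (meson obtain_subset_with_card_n)
  then obtain a b c where "{a, b, c} \<subseteq> pendants G x" "a \<noteq> b" "a \<noteq> c" "b \<noteq> c"
    by (auto simp: card_3_iff)
  then show ?thesis unfolding branching_def pendants_def by blast
qed

section \<open>The translation of formulas\<close>

definition branching_fm :: "nat \<Rightarrow> conn_atom fm" where
  "branching_fm x = Exists 4 (Exists 6 (Exists 8
     (Conj (Atom (Edge x 4)) (Conj (Atom (Edge x 6)) (Conj (Atom (Edge x 8))
       (Conj (Neg (Atom (Eq 4 6))) (Conj (Neg (Atom (Eq 4 8))) (Neg (Atom (Eq 6 8))))))))))"

text \<open>The second \<open>Conn\<close> is the only atom of the translation that deletes two
  vertices.\<close>

definition joined_fm :: "nat \<Rightarrow> nat \<Rightarrow> conn_atom fm" where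
  "joined_fm x y = Exists 0 (Conj (Atom (Edge x 0)) (Conj (Atom (Conn 0 y [x]))
     (Forall 2 (Disj (Neg (branching_fm 2)) (Neg (Atom (Conn 0 2 [x, y])))))))"

definition pendant_fm :: "nat \<Rightarrow> nat \<Rightarrow> conn_atom fm" where
  "pendant_fm x w = Conj (Atom (Edge x w))
     (Forall 2 (Disj (Neg (branching_fm 2)) (Neg (Atom (Conn w 2 [x])))))"

text \<open>
  Odd variables stand for the variables of the given formula. The even ones below 14 are
  auxiliary, and the remaining ones enumerate pendant vertices.
\<close>

definition var :: "nat \<Rightarrow> nat" where
  "var x = Suc (x + x)"

definition wvar :: "nat \<Rightarrow> nat" where
  "wvar k = 14 + (k + k)"

text \<open>\<open>k\<close> stays fixed while the second argument counts down. As there is no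
  constant for truth, a trivial equality takes its place, here and in the formulas below.\<close>

fun fresh_fm :: "nat \<Rightarrow> nat \<Rightarrow> conn_atom fm" where
  "fresh_fm k 0 = Atom (Eq (wvar k) (wvar k))"
| "fresh_fm k (Suc j) = Conj (Neg (Atom (Eq (wvar k) (wvar j)))) (fresh_fm k j)"

fun pendants_fm :: "nat \<Rightarrow> nat \<Rightarrow> conn_atom fm" where
  "pendants_fm x 0 = Atom (Eq x x)"
| "pendants_fm x (Suc k) = Conj (Conj (pendant_fm x (wvar k)) (fresh_fm k k)) (pendants_fm x k)"

fun exists_fm :: "conn_atom fm \<Rightarrow> nat \<Rightarrow> conn_atom fm" where
  "exists_fm \<phi> 0 = \<phi>"
| "exists_fm \<phi> (Suc k) = Exists (wvar k) (exists_fm \<phi> k)"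

definition label_fm :: "nat \<Rightarrow> nat \<Rightarrow> conn_atom fm" where
  "label_fm k x = Conj (exists_fm (pendants_fm x k) k)
     (Neg (exists_fm (pendants_fm x (Suc k)) (Suc k)))"

text \<open>\<open>10\<close> denotes the tuple vertex. The scope of \<open>12\<close> ends with
  each entry, so one variable serves for all positions.\<close>

fun args_fm :: "(nat \<times> nat) list \<Rightarrow> conn_atom fm" where
  "args_fm [] = Atom (Eq 10 10)"
| "args_fm ((j, x) # ys) = Conj (Exists 12 (Conj (joined_fm 10 12)
     (Conj (label_fm (4 + j) 12) (joined_fm 12 (var x))))) (args_fm ys)"

definition rel_fm :: "nat \<Rightarrow> nat list \<Rightarrow> conn_atom fm" where
  "rel_fm i xs = Exists 10 (Conj (label_fm (4 + i) 10) (args_fm (List.enumerate 0 xs)))"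

fun trans_fm :: "fo_atom fm \<Rightarrow> conn_atom fm" where
  "trans_fm (Atom (FO_Eq x y)) = Atom (Eq (var x) (var y))"
| "trans_fm (Atom (FO_Rel i xs)) = rel_fm i xs"
| "trans_fm (Neg \<phi>) = Neg (trans_fm \<phi>)"
| "trans_fm (Conj \<phi> \<psi>) = Conj (trans_fm \<phi>) (trans_fm \<psi>)"
| "trans_fm (Disj \<phi> \<psi>) = Disj (trans_fm \<phi>) (trans_fm \<psi>)"
| "trans_fm (Exists x \<phi>) = Exists (var x) (Conj (label_fm 3 (var x)) (trans_fm \<phi>))"
| "trans_fm (Forall x \<phi>) = Forall (var x) (Disj (Neg (label_fm 3 (var x))) (trans_fm \<phi>))"

section \<open>Free variables and the number of deleted vertices\<close>

abbreviation (input) fv :: "conn_atom fm \<Rightarrow> nat set" where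
  "fv \<equiv> free_vars conn_atom_vars"

lemma fv_branching: "fv (branching_fm x) \<subseteq> {x}"
  by (auto simp: branching_fm_def)

lemma fv_joined: "fv (joined_fm x y) \<subseteq> {x, y}"
  using fv_branching[of 2] by (auto simp: joined_fm_def)

lemma fv_pendant: "fv (pendant_fm x w) \<subseteq> {x, w}"
  using fv_branching[of 2] by (auto simp: pendant_fm_def)

lemma fv_fresh: "fv (fresh_fm k j) \<subseteq> insert (wvar k) (wvar ` {..<j})"
  by (induction j) (auto simp: less_Suc_eq)

lemma fv_pendants: "fv (pendants_fm x k) \<subseteq> insert x (wvar ` {..<k})"
proof (induction k)
  case (Suc k)
  then show ?case using fv_pendant[of x "wvar k"] fv_fresh[of k k] by (fastforce simp: less_Suc_eq)
qed simp

lemma fv_exists: "fv (exists_fm \<phi> k) = fv \<phi> - wvar ` {..<k}"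
  by (induction k) (auto simp: less_Suc_eq)

lemma fv_label: "fv (label_fm k x) \<subseteq> {x}"
  using fv_pendants[of x k] fv_pendants[of x "Suc k"] by (auto simp: label_fm_def fv_exists simp del: pendants_fm.simps exists_fm.simps)

lemma fv_args: "fv (args_fm ys) \<subseteq> insert 10 (var ` snd ` set ys)"
proof (induction ys rule: args_fm.induct)
  case (2 j x ys)
  then show ?case
    using fv_joined[of 10 12] fv_joined[of 12 "var x"] fv_label[of "4 + j" 12] by fastforce
qed simp

lemma fv_rel: "fv (rel_fm i xs) \<subseteq> var ` set xs"
proof -
  have "snd ` set (List.enumerate 0 xs) = set xs"
    by (metis list.set_map map_snd_enumerate)
  then show ?thesis
    using fv_args[of "List.enumerate 0 xs"] fv_label[of "4 + i" 10] by (auto simp: rel_fm_def)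
qed

lemma inj_var: "var x = var y \<longleftrightarrow> x = y"
  by (auto simp: var_def)

lemma fv_trans: "fv (trans_fm \<phi>) \<subseteq> var ` free_vars fo_atom_vars \<phi>"
proof (induction \<phi> rule: trans_fm.induct)
  case (2 i xs)
  then show ?case using fv_rel by simp
next
  case (6 x \<phi>)
  then show ?case using fv_label[of 3 "var x"] by (fastforce simp: inj_var)
next
  case (7 x \<phi>)
  then show ?case using fv_label[of 3 "var x"] by (fastforce simp: inj_var)
qed auto

definition conn_le2 :: "conn_atom fm \<Rightarrow> bool" where
  "conn_le2 \<phi> \<longleftrightarrow> (\<forall>x y zs. Conn x y zs \<in> set_fm \<phi> \<longrightarrow> length zs \<le> 2)"

lemma conn_le2_simps [simp]:
  "conn_le2 (Atom (Eq x y))" "conn_le2 (Atom (Edge x y))"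
  "conn_le2 (Atom (Conn x y zs)) \<longleftrightarrow> length zs \<le> 2"
  "conn_le2 (Neg \<phi>) \<longleftrightarrow> conn_le2 \<phi>"
  "conn_le2 (Conj \<phi> \<psi>) \<longleftrightarrow> conn_le2 \<phi> \<and> conn_le2 \<psi>"
  "conn_le2 (Disj \<phi> \<psi>) \<longleftrightarrow> conn_le2 \<phi> \<and> conn_le2 \<psi>"
  "conn_le2 (Exists x \<phi>) \<longleftrightarrow> conn_le2 \<phi>" "conn_le2 (Forall x \<phi>) \<longleftrightarrow> conn_le2 \<phi>"
  by (auto simp: conn_le2_def)

lemma conn_le2_label: "conn_le2 (label_fm k x)"
proof -
  have b: "conn_le2 (pendant_fm x w)" for x w by (simp add: pendant_fm_def branching_fm_def)
  have f: "conn_le2 (fresh_fm k j)" for k j by (induction j) auto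
  have "conn_le2 (pendants_fm x k)" for x k by (induction k) (auto simp: b f)
  moreover have "conn_le2 (exists_fm \<phi> k) \<longleftrightarrow> conn_le2 \<phi>" for \<phi> k by (induction k) auto
  ultimately show ?thesis by (simp add: label_fm_def del: pendants_fm.simps exists_fm.simps)
qed

lemma conn_le2_trans: "conn_le2 (trans_fm \<phi>)"
proof (induction \<phi> rule: trans_fm.induct)
  case (2 i xs)
  have "conn_le2 (joined_fm x y)" for x y by (simp add: joined_fm_def branching_fm_def)
  then have "conn_le2 (args_fm ys)" for ys
    by (induction ys rule: args_fm.induct) (auto simp: conn_le2_label)
  then show ?case by (simp add: rel_fm_def conn_le2_label)
qed (auto simp: conn_le2_label)

lemma trans_fm_in_FO_conn_upto:
  assumes "free_vars fo_atom_vars \<phi> = {}"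
  shows "trans_fm \<phi> \<in> FO_conn_upto 2"
  using fv_trans[of \<phi>] conn_le2_trans[of \<phi>] assms
  by (auto simp: FO_conn_upto_def FO_conn_def conn_le2_def)

text \<open>The variables put in for \<open>x\<close> and \<open>y\<close> in
  \<open>joined_fm\<close>, \<open>pendant_fm\<close> and \<open>label_fm\<close>. None of these
  formulas binds one of them, so nothing is captured.\<close>

definition original_or_aux :: "nat \<Rightarrow> bool" where
  "original_or_aux x \<longleftrightarrow> x = 10 \<or> x = 12 \<or> odd x"

lemma original_or_aux_simps [simp]:
  "original_or_aux 10" "original_or_aux 12" "original_or_aux (var x)"
  by (auto simp: original_or_aux_def var_def)

lemma original_or_aux_neq:
  assumes "original_or_aux x"
  shows "x \<noteq> 0" "x \<noteq> 2" "x \<noteq> 4" "x \<noteq> 6" "x \<noteq> 8" "x \<noteq> wvar k"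
proof -
  have "even (wvar k)" by (simp add: wvar_def)
  moreover have "wvar k \<noteq> 10" "wvar k \<noteq> 12" by (simp_all add: wvar_def)
  ultimately show "x \<noteq> wvar k" using assms by (auto simp: original_or_aux_def)
qed (use assms in \<open>auto simp: original_or_aux_def intro: odd_pos\<close>)

lemma wvar_simps [simp]: "wvar k \<noteq> 0" "wvar k \<noteq> 2" "wvar k \<noteq> 4" "wvar k \<noteq> 6" "wvar k \<noteq> 8"
  "wvar j = wvar k \<longleftrightarrow> j = k"
  by (auto simp: wvar_def)

section \<open>Semantics of the translated formulas\<close>

context
  fixes G :: graph
  assumes G: "is_graph G"
begin

abbreviation (input) holds :: "(nat \<Rightarrow> nat) \<Rightarrow> conn_atom fm \<Rightarrow> bool" where
  "holds \<equiv> sat (verts G) (conn_atom_holds G)"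

lemma sat_branching: "holds \<sigma> (branching_fm 2) \<longleftrightarrow> branching G (\<sigma> 2)"
  by (simp add: branching_fm_def branching_def)

lemma holds_conn:
  "conn_atom_holds G \<sigma> (Conn x y zs) \<longleftrightarrow> \<not> separated G (\<sigma> ` set zs) (\<sigma> x) (\<sigma> y)"
  by (auto simp: separated_def)

lemma sat_joined:
  assumes "original_or_aux x" "original_or_aux y"
  shows "holds \<sigma> (joined_fm x y) \<longleftrightarrow> joined G (\<sigma> x) (\<sigma> y)"
  using original_or_aux_neq[OF assms(1)] original_or_aux_neq[OF assms(2)]
  by (simp add: joined_fm_def joined_def sat_branching holds_conn
      del: conn_atom_holds.simps(3))

lemma sat_pendant:
  assumes "original_or_aux x" "\<sigma> (wvar k) \<in> verts G"
  shows "holds \<sigma> (pendant_fm x (wvar k)) \<longleftrightarrow> \<sigma> (wvar k) \<in> pendants G (\<sigma> x)"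
  using original_or_aux_neq[OF assms(1)] assms(2)
  by (simp add: pendant_fm_def pendants_def sat_branching holds_conn
      del: conn_atom_holds.simps(3))

lemma sat_fresh: "holds \<sigma> (fresh_fm k j) \<longleftrightarrow> (\<forall>i<j. \<sigma> (wvar k) \<noteq> \<sigma> (wvar i))"
  by (induction j) (auto simp: less_Suc_eq)

lemma sat_pendants:
  assumes "original_or_aux x" "\<And>i. i < k \<Longrightarrow> \<sigma> (wvar i) \<in> verts G"
  shows "holds \<sigma> (pendants_fm x k) \<longleftrightarrow>
    (\<lambda>i. \<sigma> (wvar i)) ` {..<k} \<subseteq> pendants G (\<sigma> x) \<and> inj_on (\<lambda>i. \<sigma> (wvar i)) {..<k}"
  using assms(2)
proof (induction k)
  case (Suc k)
  have "inj_on (\<lambda>i. \<sigma> (wvar i)) {..<Suc k} \<longleftrightarrow>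
      inj_on (\<lambda>i. \<sigma> (wvar i)) {..<k} \<and> (\<forall>i<k. \<sigma> (wvar k) \<noteq> \<sigma> (wvar i))"
    unfolding lessThan_Suc inj_on_insert by auto
  moreover have "holds \<sigma> (pendants_fm x k) \<longleftrightarrow>
      (\<lambda>i. \<sigma> (wvar i)) ` {..<k} \<subseteq> pendants G (\<sigma> x) \<and> inj_on (\<lambda>i. \<sigma> (wvar i)) {..<k}"
    using Suc by simp
  ultimately show ?case using Suc.prems[of k] assms(1)
    by (auto simp: sat_pendant sat_fresh lessThan_Suc)
qed simp

text \<open>Turns a block of quantifiers into the choice of one assignment, so that counting pendant
  vertices becomes the existence of an injection.\<close>

lemma sat_exists:
  "holds \<sigma> (exists_fm \<phi> k) \<longleftrightarrow> (\<exists>\<tau>. (\<forall>i<k. \<tau> (wvar i) \<in> verts G) \<and>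
     (\<forall>v. v \<notin> wvar ` {..<k} \<longrightarrow> \<tau> v = \<sigma> v) \<and> holds \<tau> \<phi>)" (is "_ \<longleftrightarrow> (\<exists>\<tau>. ?Q k \<sigma> \<tau>)")
proof (induction k arbitrary: \<sigma>)
  case 0
  have "\<tau> = \<sigma>" if "\<forall>v. \<tau> v = \<sigma> v" for \<tau> using that by (simp add: fun_eq_iff)
  then show ?case by auto
next
  case (Suc k)
  have "holds \<sigma> (exists_fm \<phi> (Suc k)) \<longleftrightarrow> (\<exists>a \<in> verts G. \<exists>\<tau>. ?Q k (\<sigma>(wvar k := a)) \<tau>)"
    by (simp only: exists_fm.simps sat.simps Suc.IH)
  also have "\<dots> \<longleftrightarrow> (\<exists>\<tau>. ?Q (Suc k) \<sigma> \<tau>)"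
  proof
    assume "\<exists>a \<in> verts G. \<exists>\<tau>. ?Q k (\<sigma>(wvar k := a)) \<tau>"
    then obtain a \<tau> where a: "a \<in> verts G" and \<tau>: "?Q k (\<sigma>(wvar k := a)) \<tau>" by blast
    have "wvar k \<notin> wvar ` {..<k}" by auto
    with \<tau> have "\<tau> (wvar k) = a" by simp
    with a \<tau> have "?Q (Suc k) \<sigma> \<tau>" by (auto simp: less_Suc_eq lessThan_Suc)
    then show "\<exists>\<tau>. ?Q (Suc k) \<sigma> \<tau>" by blast
  next
    assume "\<exists>\<tau>. ?Q (Suc k) \<sigma> \<tau>"
    then obtain \<tau> where "?Q (Suc k) \<sigma> \<tau>" by blast
    then have "?Q k (\<sigma>(wvar k := \<tau> (wvar k))) \<tau>" "\<tau> (wvar k) \<in> verts G"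
      by (auto simp: lessThan_Suc)
    then show "\<exists>a \<in> verts G. \<exists>\<tau>. ?Q k (\<sigma>(wvar k := a)) \<tau>" by blast
  qed
  finally show ?case .
qed

lemma finite_pendants: "finite (pendants G x)"
  using G by (simp add: pendants_def is_graph_def)

lemma sat_at_least:
  assumes "original_or_aux x"
  shows "holds \<sigma> (exists_fm (pendants_fm x k) k) \<longleftrightarrow> k \<le> card (pendants G (\<sigma> x))"
proof
  assume "holds \<sigma> (exists_fm (pendants_fm x k) k)"
  then obtain \<tau> where \<tau>: "\<forall>i<k. \<tau> (wvar i) \<in> verts G" "\<forall>v. v \<notin> wvar ` {..<k} \<longrightarrow> \<tau> v = \<sigma> v"
    "holds \<tau> (pendants_fm x k)" unfolding sat_exists by blast
  have "\<tau> x = \<sigma> x" using \<tau>(2) original_or_aux_neq(6)[OF assms] by blast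
  with \<tau> sat_pendants[OF assms, of k \<tau>] have
    "(\<lambda>i. \<tau> (wvar i)) ` {..<k} \<subseteq> pendants G (\<sigma> x)" "inj_on (\<lambda>i. \<tau> (wvar i)) {..<k}" by auto
  from card_inj_on_le[OF this(2,1) finite_pendants] show "k \<le> card (pendants G (\<sigma> x))" by simp
next
  assume "k \<le> card (pendants G (\<sigma> x))"
  then obtain f where f: "f ` {..<k} \<subseteq> pendants G (\<sigma> x)" "inj_on f {..<k}"
    using inj_on_iff_card_le[OF _ finite_pendants, of "{..<k}" "\<sigma> x"] by auto
  \<comment> \<open>\<open>(v - 14) div 2\<close> inverts \<open>wvar\<close>.\<close>
  define \<tau> where "\<tau> v = (if v \<in> wvar ` {..<k} then f ((v - 14) div 2) else \<sigma> v)" for v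
  have \<tau>: "\<tau> (wvar i) = f i" if "i < k" for i
    using that by (simp add: \<tau>_def) (simp add: wvar_def)
  have "\<tau> x = \<sigma> x" using original_or_aux_neq(6)[OF assms] by (auto simp: \<tau>_def)
  moreover have "\<forall>i<k. \<tau> (wvar i) \<in> verts G"
    using f(1) by (auto simp: \<tau> pendants_def)
  moreover have "(\<lambda>i. \<tau> (wvar i)) ` {..<k} \<subseteq> pendants G (\<sigma> x)" using f(1) by (auto simp: \<tau>)
  moreover have "inj_on (\<lambda>i. \<tau> (wvar i)) {..<k}" using f(2) by (simp add: \<tau> inj_on_def)
  moreover have "\<forall>v. v \<notin> wvar ` {..<k} \<longrightarrow> \<tau> v = \<sigma> v" by (simp add: \<tau>_def)
  ultimately show "holds \<sigma> (exists_fm (pendants_fm x k) k)"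
    unfolding sat_exists using sat_pendants[OF assms, of k \<tau>] by auto
qed

lemma sat_label:
  assumes "original_or_aux x"
  shows "holds \<sigma> (label_fm k x) \<longleftrightarrow> card (pendants G (\<sigma> x)) = k"
  using sat_at_least[OF assms, of \<sigma> k] sat_at_least[OF assms, of \<sigma> "Suc k"]
  by (auto simp: label_fm_def simp del: pendants_fm.simps exists_fm.simps)

lemma sat_args:
  "holds \<sigma> (args_fm ys) \<longleftrightarrow> (\<forall>(j, x) \<in> set ys. \<exists>q \<in> verts G. joined G (\<sigma> 10) q \<and>
     card (pendants G q) = 4 + j \<and> joined G q (\<sigma> (var x)))"
proof (induction ys rule: args_fm.induct)
  case (2 j x ys)
  have "var x \<noteq> 12" "12 \<noteq> var x" unfolding var_def by presburger+
  with 2 show ?case by (simp add: sat_joined sat_label)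
qed simp

lemma sat_rel:
  "holds \<sigma> (rel_fm i xs) \<longleftrightarrow> (\<exists>\<tau> \<in> verts G. card (pendants G \<tau>) = 4 + i \<and>
     (\<forall>j < length xs. \<exists>q \<in> verts G. joined G \<tau> q \<and>
        card (pendants G q) = 4 + j \<and> joined G q (\<sigma> (var (xs ! j)))))"
proof -
  have "10 \<noteq> var x" "var x \<noteq> 10" for x unfolding var_def by presburger+
  moreover have "(\<forall>(j, x) \<in> set (List.enumerate 0 xs). Q j x) \<longleftrightarrow> (\<forall>j < length xs. Q j (xs ! j))" for Q
    by (auto simp: in_set_enumerate_eq)
  ultimately show ?thesis by (simp add: rel_fm_def sat_label sat_args)
qed

text \<open>Only two facts about the graph enter: vertices with three pendant neighbours name the
  elements, and the gadget of a relation occurs exactly for its tuples. The assignments have to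
  correspond on free variables only, so for a sentence they may be unrelated.\<close>

lemma sat_trans:
  assumes el: "{x \<in> verts G. card (pendants G x) = 3} = el ` {..<fst A}" "inj_on el {..<fst A}"
    and rel: "\<And>i as. i < length (snd A) \<Longrightarrow> length as = fst (snd A ! i) \<Longrightarrow> set as \<subseteq> {..<fst A} \<Longrightarrow>
      (\<exists>\<tau> \<in> verts G. card (pendants G \<tau>) = 4 + i \<and>
       (\<forall>j < length as. \<exists>q \<in> verts G. joined G \<tau> q \<and> card (pendants G q) = 4 + j \<and>
          joined G q (el (as ! j)))) \<longleftrightarrow> as \<in> set (snd (snd A ! i))"
    and "\<And>x. x \<in> free_vars fo_atom_vars \<phi> \<Longrightarrow> \<rho> x < fst A \<and> \<sigma> (var x) = el (\<rho> x)"
    and "\<forall>a \<in> set_fm \<phi>. fo_atom_fits A a"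
  shows "holds \<sigma> (trans_fm \<phi>) \<longleftrightarrow> sat {..<fst A} (fo_atom_holds A) \<rho> \<phi>"
  using assms(4,5)
proof (induction \<phi> arbitrary: \<sigma> \<rho>)
  case (Atom a)
  show ?case
  proof (cases a)
    case (FO_Eq x y)
    with Atom.prems(1)[of x] Atom.prems(1)[of y] inj_onD[OF el(2), of "\<rho> x" "\<rho> y"] show ?thesis by auto
  next
    case (FO_Rel i xs)
    with Atom.prems have *: "\<rho> x < fst A \<and> \<sigma> (var x) = el (\<rho> x)" if "x \<in> set xs" for x
      using that by simp
    have "(\<forall>j < length xs. \<exists>q \<in> verts G. joined G \<tau> q \<and>
        card (pendants G q) = 4 + j \<and> joined G q (\<sigma> (var (xs ! j)))) \<longleftrightarrow>
      (\<forall>j < length (map \<rho> xs). \<exists>q \<in> verts G. joined G \<tau> q \<and>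
        card (pendants G q) = 4 + j \<and> joined G q (el (map \<rho> xs ! j)))" for \<tau>
      using * by simp
    moreover have "i < length (snd A)" "length (map \<rho> xs) = fst (snd A ! i)" "set (map \<rho> xs) \<subseteq> {..<fst A}"
      using Atom.prems(2) * FO_Rel by auto
    ultimately show ?thesis using rel[of i "map \<rho> xs"] FO_Rel by (simp only: trans_fm.simps sat_rel sat.simps fo_atom_holds.simps)
  qed
next
  case (Exists x \<phi>)
  have IH: "holds (\<sigma>(var x := el a)) (trans_fm \<phi>) \<longleftrightarrow>
      sat {..<fst A} (fo_atom_holds A) (\<rho>(x := a)) \<phi>" if "a < fst A" for a
    using that Exists.prems by (intro Exists.IH) (auto simp: inj_var)
  have "holds \<sigma> (trans_fm (Exists x \<phi>)) \<longleftrightarrow>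
      (\<exists>v \<in> {x \<in> verts G. card (pendants G x) = 3}. holds (\<sigma>(var x := v)) (trans_fm \<phi>))"
    by (auto simp: sat_label)
  then show ?case unfolding el(1) using IH by simp
next
  case (Forall x \<phi>)
  have IH: "holds (\<sigma>(var x := el a)) (trans_fm \<phi>) \<longleftrightarrow>
      sat {..<fst A} (fo_atom_holds A) (\<rho>(x := a)) \<phi>" if "a < fst A" for a
    using that Forall.prems by (intro Forall.IH) (auto simp: inj_var)
  have "holds \<sigma> (trans_fm (Forall x \<phi>)) \<longleftrightarrow>
      (\<forall>v \<in> {x \<in> verts G. card (pendants G x) = 3}. holds (\<sigma>(var x := v)) (trans_fm \<phi>))"
    by (auto simp: sat_label)
  then show ?case unfolding el(1) using IH by simp
next
  case (Conj \<phi>1 \<phi>2)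
  have "holds \<sigma> (trans_fm \<phi>1) \<longleftrightarrow> sat {..<fst A} (fo_atom_holds A) \<rho> \<phi>1"
    using Conj.prems by (intro Conj.IH(1)) auto
  moreover have "holds \<sigma> (trans_fm \<phi>2) \<longleftrightarrow> sat {..<fst A} (fo_atom_holds A) \<rho> \<phi>2"
    using Conj.prems by (intro Conj.IH(2)) auto
  ultimately show ?case by simp
next
  case (Disj \<phi>1 \<phi>2)
  have "holds \<sigma> (trans_fm \<phi>1) \<longleftrightarrow> sat {..<fst A} (fo_atom_holds A) \<rho> \<phi>1"
    using Disj.prems by (intro Disj.IH(1)) auto
  moreover have "holds \<sigma> (trans_fm \<phi>2) \<longleftrightarrow> sat {..<fst A} (fo_atom_holds A) \<rho> \<phi>2"
    using Disj.prems by (intro Disj.IH(2)) auto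
  ultimately show ?case by simp
qed auto

end

section \<open>Computing the translation\<close>

text \<open>The functions with prefix \<open>v\<close> imitate formula constructors on encodings.
  Lemmas with prefix \<open>enc_\<close> show the agreement, after which only functions on trees
  have to be timed.\<close>

definition vAtom :: "val \<Rightarrow> val" where "vAtom a = Node (enc_nat 0) a"
definition vNeg :: "val \<Rightarrow> val" where "vNeg a = Node (enc_nat 1) a"
definition vConj :: "val \<Rightarrow> val \<Rightarrow> val" where "vConj a b = Node (enc_nat 2) (Node a b)"
definition vDisj :: "val \<Rightarrow> val \<Rightarrow> val" where "vDisj a b = Node (enc_nat 3) (Node a b)"
definition vExists :: "val \<Rightarrow> val \<Rightarrow> val" where "vExists x a = Node (enc_nat 4) (Node x a)"
definition vForall :: "val \<Rightarrow> val \<Rightarrow> val" where "vForall x a = Node (enc_nat 5) (Node x a)"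
definition vEq :: "val \<Rightarrow> val \<Rightarrow> val" where "vEq x y = vAtom (Node (enc_nat 0) (Node x y))"
definition vEdge :: "val \<Rightarrow> val \<Rightarrow> val" where "vEdge x y = vAtom (Node (enc_nat 1) (Node x y))"
definition vConn :: "val \<Rightarrow> val \<Rightarrow> val \<Rightarrow> val" where
  "vConn x y zs = vAtom (Node (enc_nat 2) (Node x (Node y zs)))"

lemmas v_defs = vAtom_def vNeg_def vConj_def vDisj_def vExists_def vForall_def vEq_def vEdge_def vConn_def

abbreviation (input) enc_conn :: "conn_atom fm \<Rightarrow> val" where
  "enc_conn \<equiv> enc_fm enc_conn_atom"

lemma enc_conn_simps:
  "enc_conn (Atom (Eq x y)) = vEq (enc_nat x) (enc_nat y)"
  "enc_conn (Atom (Edge x y)) = vEdge (enc_nat x) (enc_nat y)"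
  "enc_conn (Atom (Conn x y zs)) = vConn (enc_nat x) (enc_nat y) (enc_list enc_nat zs)"
  "enc_conn (Neg \<phi>) = vNeg (enc_conn \<phi>)"
  "enc_conn (Conj \<phi> \<psi>) = vConj (enc_conn \<phi>) (enc_conn \<psi>)"
  "enc_conn (Disj \<phi> \<psi>) = vDisj (enc_conn \<phi>) (enc_conn \<psi>)"
  "enc_conn (Exists x \<phi>) = vExists (enc_nat x) (enc_conn \<phi>)"
  "enc_conn (Forall x \<phi>) = vForall (enc_nat x) (enc_conn \<phi>)"
  by (simp_all add: v_defs del: enc_nat.simps)

definition vbranching :: "val \<Rightarrow> val" where
  "vbranching x = vExists (enc_nat 4) (vExists (enc_nat 6) (vExists (enc_nat 8)
     (vConj (vEdge x (enc_nat 4)) (vConj (vEdge x (enc_nat 6)) (vConj (vEdge x (enc_nat 8))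
       (vConj (vNeg (vEq (enc_nat 4) (enc_nat 6))) (vConj (vNeg (vEq (enc_nat 4) (enc_nat 8)))
         (vNeg (vEq (enc_nat 6) (enc_nat 8))))))))))"

definition vjoined :: "val \<Rightarrow> val \<Rightarrow> val" where
  "vjoined x y = vExists (enc_nat 0) (vConj (vEdge x (enc_nat 0))
     (vConj (vConn (enc_nat 0) y (Node x Leaf))
       (vForall (enc_nat 2) (vDisj (vNeg (vbranching (enc_nat 2)))
         (vNeg (vConn (enc_nat 0) (enc_nat 2) (Node x (Node y Leaf))))))))"

definition vpendant :: "val \<Rightarrow> val \<Rightarrow> val" where
  "vpendant x w = vConj (vEdge x w) (vForall (enc_nat 2) (vDisj (vNeg (vbranching (enc_nat 2)))
     (vNeg (vConn w (enc_nat 2) (Node x Leaf)))))"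

definition vvar :: "val \<Rightarrow> val" where
  "vvar x = Node Leaf (app x x)"

definition vwvar :: "val \<Rightarrow> val" where
  "vwvar k = app (enc_nat 14) (app k k)"

fun vfresh :: "val \<Rightarrow> val \<Rightarrow> val" where
  "vfresh k Leaf = vEq (vwvar k) (vwvar k)"
| "vfresh k (Node a j) = vConj (vNeg (vEq (vwvar k) (vwvar j))) (vfresh k j)"

fun vpendants :: "val \<Rightarrow> val \<Rightarrow> val" where
  "vpendants x Leaf = vEq x x"
| "vpendants x (Node a k) = vConj (vConj (vpendant x (vwvar k)) (vfresh k k)) (vpendants x k)"

fun vexists :: "val \<Rightarrow> val \<Rightarrow> val" where
  "vexists f Leaf = f"
| "vexists f (Node a k) = vExists (vwvar k) (vexists f k)"

definition vlabel :: "val \<Rightarrow> val \<Rightarrow> val" where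
  "vlabel k x = vConj (vexists (vpendants x k) k)
     (vNeg (vexists (vpendants x (Node Leaf k)) (Node Leaf k)))"

definition vplus4 :: "val \<Rightarrow> val" where
  "vplus4 k = Node Leaf (Node Leaf (Node Leaf (Node Leaf k)))"

definition varg :: "val \<Rightarrow> val" where
  "varg p = vExists (enc_nat 12) (vConj (vjoined (enc_nat 10) (enc_nat 12))
     (vConj (vlabel (vplus4 (left p)) (enc_nat 12)) (vjoined (enc_nat 12) (vvar (right p)))))"

fun vargs :: "val \<Rightarrow> val" where
  "vargs Leaf = vEq (enc_nat 10) (enc_nat 10)"
| "vargs (Node p l) = vConj (varg p) (vargs l)"

definition vrel :: "val \<Rightarrow> val \<Rightarrow> val" where
  "vrel i xs = vExists (enc_nat 10) (vConj (vlabel (vplus4 i) (enc_nat 10)) (vargs (venum xs)))"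

definition vatom :: "val \<Rightarrow> val" where
  "vatom a = (if left a = Leaf then vEq (vvar (left (right a))) (vvar (right (right a)))
     else vrel (left (right a)) (right (right a)))"

lemma enc_nat_add4: "enc_nat (4 + k) = vplus4 (enc_nat k)"
  by (simp add: vplus4_def eval_nat_numeral)

lemma enc_var: "enc_nat (var x) = vvar (enc_nat x)"
  by (simp add: var_def vvar_def app_enc_nat)

lemma enc_wvar: "enc_nat (wvar k) = vwvar (enc_nat k)"
  unfolding wvar_def vwvar_def app_enc_nat ..

lemma enc_branching: "enc_conn (branching_fm x) = vbranching (enc_nat x)"
  unfolding branching_fm_def vbranching_def enc_conn_simps ..

lemma enc_joined: "enc_conn (joined_fm x y) = vjoined (enc_nat x) (enc_nat y)"
  unfolding joined_fm_def vjoined_def enc_conn_simps enc_branching enc_list.simps ..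

lemma enc_pendant: "enc_conn (pendant_fm x y) = vpendant (enc_nat x) (enc_nat y)"
  unfolding pendant_fm_def vpendant_def enc_conn_simps enc_branching enc_list.simps ..

lemma enc_fresh: "enc_conn (fresh_fm k j) = vfresh (enc_nat k) (enc_nat j)"
  by (induction j) (simp_all add: enc_conn_simps enc_wvar del: enc_fm.simps)

lemma enc_pendants: "enc_conn (pendants_fm x k) = vpendants (enc_nat x) (enc_nat k)"
  by (induction k)
    (simp_all add: enc_conn_simps enc_wvar enc_fresh enc_pendant del: enc_fm.simps)

lemma enc_exists: "enc_conn (exists_fm \<phi> k) = vexists (enc_conn \<phi>) (enc_nat k)"
  by (induction k) (simp_all add: enc_conn_simps enc_wvar del: enc_fm.simps)

lemma enc_label: "enc_conn (label_fm k x) = vlabel (enc_nat k) (enc_nat x)"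
  unfolding label_fm_def vlabel_def enc_conn_simps enc_exists enc_pendants by simp

lemma enc_args: "enc_conn (args_fm ys) = vargs (enc_list (\<lambda>(j, x). Node (enc_nat j) (enc_nat x)) ys)"
proof (induction ys rule: args_fm.induct)
  case 1
  show ?case by (simp only: args_fm.simps enc_list.simps vargs.simps enc_conn_simps)
next
  case (2 j x ys)
  show ?case
    by (simp only: args_fm.simps enc_list.simps vargs.simps enc_conn_simps enc_joined enc_label
        varg_def enc_var enc_nat_add4 2 left.simps right.simps prod.case)
qed

lemma enc_rel: "enc_conn (rel_fm i xs) = vrel (enc_nat i) (enc_list enc_nat xs)"
  unfolding rel_fm_def vrel_def enc_conn_simps enc_label enc_args enc_nat_add4 venum_enc_list ..

lemma enc_atom: "enc_conn (trans_fm (Atom a)) = vatom (enc_fo_atom a)"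
proof (cases a)
  case (FO_Eq x y)
  show ?thesis unfolding FO_Eq trans_fm.simps enc_conn_simps enc_var vatom_def by simp
next
  case (FO_Rel i xs)
  show ?thesis unfolding FO_Rel trans_fm.simps enc_rel vatom_def by simp
qed

text \<open>The nested tests count the unary tag \<open>a\<close>; \<open>t\<close>,
  \<open>p\<close> and \<open>q\<close> stand for the translations of \<open>l\<close> and of its
  two subtrees. For quantifiers, \<open>left l\<close> is the variable and \<open>q\<close> belongs
  to the body.\<close>

definition vstep :: "val \<Rightarrow> val \<Rightarrow> val \<Rightarrow> val \<Rightarrow> val \<Rightarrow> val" where
  "vstep a l t p q =
    (if a = Leaf then vatom l
     else if right a = Leaf then Node a t
     else if right (right a) = Leaf then Node a (Node p q)
     else if right (right (right a)) = Leaf then Node a (Node p q)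
     else if right (right (right (right a))) = Leaf
     then vExists (vvar (left l)) (vConj (vlabel (enc_nat 3) (vvar (left l))) q)
     else vForall (vvar (left l)) (vDisj (vNeg (vlabel (enc_nat 3) (vvar (left l)))) q))"

text \<open>
  The translation of a formula \<open>Node a l\<close> needs those of \<open>l\<close> or of the two
  subtrees of \<open>l\<close>; hence the recursion carries along the translations of both subtrees.
\<close>

primrec vtrans_rec :: "val \<Rightarrow> val" where
  "vtrans_rec Leaf = Node Leaf (Node Leaf Leaf)"
| "vtrans_rec (Node a l) = Node (vstep a l (left (vtrans_rec l)) (left (right (vtrans_rec l)))
     (right (right (vtrans_rec l)))) (Node (left (vtrans_rec a)) (left (vtrans_rec l)))"

definition vtrans :: "val \<Rightarrow> val" where
  "vtrans v = left (vtrans_rec v)"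

lemma vtrans_rec_eq: "vtrans_rec v = Node (vtrans v) (Node (vtrans (left v)) (vtrans (right v)))"
  by (cases v) (simp_all add: vtrans_def)

lemma vtrans_simps:
  "vtrans Leaf = Leaf"
  "vtrans (Node a l) = vstep a l (vtrans l) (vtrans (left l)) (vtrans (right l))"
proof -
  have "left (right (vtrans_rec l)) = vtrans (left l)" "right (right (vtrans_rec l)) = vtrans (right l)"
    by (subst vtrans_rec_eq, simp)+
  then show "vtrans (Node a l) = vstep a l (vtrans l) (vtrans (left l)) (vtrans (right l))"
    by (simp add: vtrans_def)
qed (simp add: vtrans_def)

lemma vtrans_enc_fm: "vtrans (enc_fm enc_fo_atom \<phi>) = enc_conn (trans_fm \<phi>)"
proof (induction \<phi>)
  case (Atom a)
  show ?case unfolding enc_atom by (simp add: vtrans_simps vstep_def)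
next
  case (Exists x \<phi>)
  show ?case unfolding trans_fm.simps enc_conn_simps enc_label enc_var Exists[symmetric]
    by (simp add: vtrans_simps(2) vstep_def eval_nat_numeral)
next
  case (Forall x \<phi>)
  show ?case unfolding trans_fm.simps enc_conn_simps enc_label enc_var Forall[symmetric]
    by (simp add: vtrans_simps(2) vstep_def eval_nat_numeral)
qed (simp_all add: vtrans_simps(2) vstep_def eval_nat_numeral)

text \<open>Each step puts a piece computed from the input in front of the previous result. The size
  thus grows additively, and no separate size bound is needed for each function of this
  form.\<close>

lemma ptime_lrec_Node:
  assumes B: "ptime B" and g: "ptime (\<lambda>z. g (left z) (right z))"
    and F: "\<And>x. F x Leaf = B x" "\<And>x a l. F x (Node a l) = Node c (Node (g x (Node a l)) (F x l))"
    and L: "ptime C" "ptime L"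
  shows "ptime (\<lambda>x. F (C x) (L x))"
proof -
  obtain hb where hb: "polyf hb" "\<And>x n. vsize x \<le> n \<Longrightarrow> vsize (B x) \<le> hb n"
    using B by (rule ptime_vsize) blast
  obtain hg where hg: "polyf hg"
    "\<And>x n. vsize x \<le> n \<Longrightarrow> vsize (g (left x) (right x)) \<le> hg n"
    using g by (rule ptime_vsize) blast
  show ?thesis
  proof (rule ptime_lrec[where F = F and B = B and G = "\<lambda>x v r. Node c (Node (g x v) r)"])
    show "ptime (\<lambda>z. Node c (Node (g (left (left z)) (right (left z))) (right z)))"
      by (intro ptime_intros ptime_comp2[OF g])
    show "polyf (\<lambda>n. hb n + n * (2 + vsize c + hg (n + 1)))"
      by (intro polyf_intros hb(1) polyf_comp[OF hg(1)])
    fix x v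
    show "vsize (F x v) \<le> hb (vsize x + vsize v) + (vsize x + vsize v) *
        (2 + vsize c + hg (vsize x + vsize v + 1))"
    proof -
      have "vsize (F x w) \<le> hb n + vsize w * (2 + vsize c + hg (n + 1))" if "vsize x + vsize w \<le> n" for w n
        using that
      proof (induction w)
        case Leaf
        then show ?case using hb(2)[of x n] by (simp add: F)
      next
        case (Node a l)
        then have "vsize (g x (Node a l)) \<le> hg (n + 1)"
          using hg(2)[of "Node x (Node a l)" "n + 1"] by simp
        with Node show ?case by (simp add: F add_mult_distrib)
      qed
      from this[OF order_refl] show ?thesis
        by (rule order_trans) (intro add_left_mono mult_le_mono1, simp)
    qed
  qed (use F B L in auto)
qed

section \<open>Polynomial time of the translation\<close>

lemma ptime_v1:
  assumes "ptime F"
  shows "ptime (\<lambda>x. vAtom (F x))" "ptime (\<lambda>x. vNeg (F x))"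
    "ptime (\<lambda>x. vvar (F x))" "ptime (\<lambda>x. vwvar (F x))" "ptime (\<lambda>x. vplus4 (F x))"
  unfolding v_defs vvar_def vwvar_def vplus4_def by (intro ptime_intros ptime_app assms)+

lemma ptime_v2:
  assumes "ptime F" "ptime G"
  shows "ptime (\<lambda>x. vConj (F x) (G x))"
    "ptime (\<lambda>x. vDisj (F x) (G x))" "ptime (\<lambda>x. vExists (F x) (G x))"
    "ptime (\<lambda>x. vForall (F x) (G x))" "ptime (\<lambda>x. vEq (F x) (G x))" "ptime (\<lambda>x. vEdge (F x) (G x))"
  unfolding v_defs by (intro ptime_intros assms)+

lemma ptime_vConn: "ptime F \<Longrightarrow> ptime G \<Longrightarrow> ptime H \<Longrightarrow> ptime (\<lambda>x. vConn (F x) (G x) (H x))"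
  unfolding v_defs by (intro ptime_intros)

lemmas ptime_v_intros = ptime_v1 ptime_v2 ptime_vConn ptime_intros

lemma ptime_vbranching: "ptime F \<Longrightarrow> ptime (\<lambda>x. vbranching (F x))"
  unfolding vbranching_def by (intro ptime_v_intros)

lemma ptime_vjoined: "ptime F \<Longrightarrow> ptime G \<Longrightarrow> ptime (\<lambda>x. vjoined (F x) (G x))"
  unfolding vjoined_def by (intro ptime_v_intros ptime_vbranching)

lemma ptime_vpendant: "ptime F \<Longrightarrow> ptime G \<Longrightarrow> ptime (\<lambda>x. vpendant (F x) (G x))"
  unfolding vpendant_def by (intro ptime_v_intros ptime_vbranching)

lemma ptime_vfresh: "ptime F \<Longrightarrow> ptime G \<Longrightarrow> ptime (\<lambda>x. vfresh (F x) (G x))"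
  by (rule ptime_lrec_Node[where F = vfresh and B = "\<lambda>k. vEq (vwvar k) (vwvar k)" and c = "enc_nat 2"
        and g = "\<lambda>k v. vNeg (vEq (vwvar k) (vwvar (right v)))"])
    (auto intro!: ptime_v_intros simp: vConj_def)

lemma ptime_vpendants: "ptime F \<Longrightarrow> ptime G \<Longrightarrow> ptime (\<lambda>x. vpendants (F x) (G x))"
  by (rule ptime_lrec_Node[where F = vpendants and B = "\<lambda>x. vEq x x" and c = "enc_nat 2"
        and g = "\<lambda>x v. vConj (vpendant x (vwvar (right v))) (vfresh (right v) (right v))"])
    (auto intro!: ptime_v_intros ptime_vpendant ptime_vfresh simp: vConj_def)

lemma ptime_vexists: "ptime F \<Longrightarrow> ptime G \<Longrightarrow> ptime (\<lambda>x. vexists (F x) (G x))"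
  by (rule ptime_lrec_Node[where F = vexists and B = "\<lambda>x. x" and c = "enc_nat 4"
        and g = "\<lambda>x v. vwvar (right v)"])
    (auto intro!: ptime_v_intros simp: vExists_def)

lemma ptime_vlabel: "ptime F \<Longrightarrow> ptime G \<Longrightarrow> ptime (\<lambda>x. vlabel (F x) (G x))"
  unfolding vlabel_def by (intro ptime_v_intros ptime_vexists ptime_vpendants)

lemma ptime_varg: "ptime F \<Longrightarrow> ptime (\<lambda>x. varg (F x))"
  unfolding varg_def by (intro ptime_v_intros ptime_vjoined ptime_vlabel)

lemma ptime_vargs: "ptime F \<Longrightarrow> ptime (\<lambda>x. vargs (F x))"
  by (rule ptime_lrec_Node[where F = "\<lambda>x. vargs" and B = "\<lambda>x. vEq (enc_nat 10) (enc_nat 10)"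
        and c = "enc_nat 2" and g = "\<lambda>x v. varg (left v)" and C = "\<lambda>x. x"])
    (auto intro!: ptime_v_intros ptime_varg simp: vConj_def)

lemma ptime_vatom: "ptime F \<Longrightarrow> ptime (\<lambda>x. vatom (F x))"
  unfolding vatom_def vrel_def
  by (intro ptime_v_intros ptime_vlabel ptime_vargs ptime_venum)

text \<open>\<open>K\<close> is evaluated at a bound \<open>n\<close> for the whole tree and held
  fixed during the induction. The sizes then add up linearly, since a step uses either the
  translation of \<open>l\<close> or those of its two subtrees, but not both.\<close>

lemma polyf_vtrans: "\<exists>K. polyf K \<and> (\<forall>v. vsize (vtrans v) \<le> vsize v * K (vsize v))"
proof -
  obtain h1 where h1: "polyf h1" "\<And>x n. vsize x \<le> n \<Longrightarrow> vsize (vatom x) \<le> h1 n"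
    using ptime_vatom[OF ptime_id] by (rule ptime_vsize) blast
  have "ptime (\<lambda>x. vvar (left x))" by (intro ptime_v_intros)
  then obtain h2 where h2: "polyf h2" "\<And>x n. vsize x \<le> n \<Longrightarrow> vsize (vvar (left x)) \<le> h2 n"
    by (rule ptime_vsize) blast
  have "ptime (\<lambda>x. vlabel (enc_nat 3) (vvar (left x)))" by (intro ptime_v_intros ptime_vlabel)
  then obtain h3 where h3: "polyf h3"
    "\<And>x n. vsize x \<le> n \<Longrightarrow> vsize (vlabel (enc_nat 3) (vvar (left x))) \<le> h3 n"
    by (rule ptime_vsize) blast
  define K where "K n = h1 n + h2 n + h3 n + n + 50" for n
  have "vsize (vtrans v) \<le> vsize v * K n" if "vsize v \<le> n" for v n
    using that
  proof (induction v rule: measure_induct_rule[of vsize])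
    case (less v)
    show ?case
    proof (cases v)
      case Leaf
      then show ?thesis by (simp add: vtrans_simps K_def)
    next
      case (Node a l)
      have l: "vsize (vtrans l) \<le> vsize l * K n" using less Node by simp
      have "vsize (left l) < vsize v" "vsize (right l) < vsize v"
        using vsize_left_right[of l] Node by auto
      then have "vsize (vtrans (left l)) \<le> vsize (left l) * K n"
        "vsize (vtrans (right l)) \<le> vsize (right l) * K n" using less by auto
      then have "vsize (vtrans (left l)) + vsize (vtrans (right l)) \<le>
          (vsize (left l) + vsize (right l)) * K n" by (simp add: add_mult_distrib)
      \<comment> \<open>The \<open>+ 1\<close> is for \<open>l = Leaf\<close>, both of whose
        subtrees are \<open>Leaf\<close> again.\<close>
      also have "\<dots> \<le> (vsize l + 1) * K n"
        by (rule mult_le_mono1) (cases l; simp)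
      finally have pq: "vsize (vtrans (left l)) + vsize (vtrans (right l)) \<le> (vsize l + 1) * K n" .
      have v: "vsize a + vsize l < n" using less.prems Node by simp
      have "vsize (vtrans v) \<le> h1 n + h2 n + h3 n + n + 50 + (vsize l + 1) * K n"
        using h1(2)[of l n] h2(2)[of l n] h3(2)[of l n] l pq v
        unfolding Node vtrans_simps vstep_def v_defs by (simp add: eval_nat_numeral)
      also have "\<dots> = (vsize l + 2) * K n" by (simp add: K_def[symmetric] add_mult_distrib)
      also have "\<dots> \<le> vsize v * K n"
        using Node vsize_pos[of a] by (intro mult_le_mono1) simp
      finally show ?thesis .
    qed
  qed
  moreover have "polyf K" unfolding K_def by (intro polyf_intros h1 h2 h3)
  ultimately show ?thesis by blast
qed

lemma ptime_vtrans: "ptime vtrans"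
proof -
  obtain K where K: "polyf K" "\<And>v. vsize (vtrans v) \<le> vsize v * K (vsize v)"
    using polyf_vtrans by blast
  have *: "vsize (vtrans w) \<le> n * K n" if "vsize w \<le> n" for w n
    using K(2)[of w] mult_mono[OF that polyf_mono[OF K(1) that]] by simp
  have "ptime (\<lambda>z. (\<lambda>x. vtrans_rec) (left z) (right z))"
  proof (rule ptime_rec[where F = "\<lambda>x. vtrans_rec" and B = "\<lambda>x. Node Leaf (Node Leaf Leaf)"
        and C = "\<lambda>x. x" and D = "\<lambda>x. x" and S = "\<lambda>n. 2 + 3 * (n * K n)"
        and G = "\<lambda>x v ra rl. Node (vstep (left v) (right v) (left rl) (left (right rl)) (right (right rl)))
          (Node (left ra) (left rl))"])
    show "polyf (\<lambda>n. 2 + 3 * (n * K n))" by (intro polyf_intros K)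
    show "vsize (vtrans_rec v) \<le> 2 + 3 * ((vsize x + vsize v) * K (vsize x + vsize v))" for x v
    proof -
      let ?n = "vsize x + vsize v"
      have "vsize (vtrans v) \<le> ?n * K ?n" "vsize (vtrans (left v)) \<le> ?n * K ?n"
        "vsize (vtrans (right v)) \<le> ?n * K ?n"
        using vsize_left_right[of v] by (intro *; simp)+
      then show ?thesis by (subst vtrans_rec_eq) simp
    qed
    show "ptime (\<lambda>z. Node (vstep (left (right (left z))) (right (right (left z)))
        (left (right (right z))) (left (right (right (right z)))) (right (right (right (right z)))))
        (Node (left (left (right z))) (left (right (right z)))))"
      unfolding vstep_def by (intro ptime_v_intros ptime_vatom ptime_vlabel)
  qed (auto intro: ptime_intros)
  from ptime_comp[OF this ptime_Node[OF ptime_const ptime_id]]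
  have "ptime (\<lambda>x. vtrans_rec x)" by simp
  from ptime_left[OF this] show ?thesis by (simp add: vtrans_def[abs_def])
qed

section \<open>The graph of a structure\<close>

text \<open>
  \<open>El a\<close> is an element, \<open>Tup (i, t)\<close> the tuple \<open>t\<close> of the relation \<open>i\<close>, and \<open>Inc p j\<close>
  subdivides the edge from the tuple \<open>p\<close> to its entry at position \<open>j\<close>. The number of pendant
  vertices \<open>Pen v k\<close> at \<open>v\<close> encodes the relation or the position.
\<close>

datatype node = El nat | Tup "nat \<times> nat list" | Inc "nat \<times> nat list" nat | Pen node nat

definition enc_tuple :: "nat \<times> nat list \<Rightarrow> val" where
  "enc_tuple = (\<lambda>(i, t). Node (enc_nat i) (enc_list enc_nat t))"

fun enc_node :: "node \<Rightarrow> val" where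
  "enc_node (El a) = Node (enc_nat 0) (enc_nat a)"
| "enc_node (Tup p) = Node (enc_nat 1) (enc_tuple p)"
| "enc_node (Inc p j) = Node (enc_nat 2) (Node (enc_tuple p) (enc_nat j))"
| "enc_node (Pen v k) = Node (enc_nat 3) (Node (enc_node v) (enc_nat k))"

lemma enc_tuple_inj: "enc_tuple p = enc_tuple q \<longleftrightarrow> p = q"
  by (auto simp: enc_tuple_def enc_nat_inj enc_list_inj split: prod.splits)

lemma enc_node_inj: "enc_node u = enc_node v \<longleftrightarrow> u = v"
proof (induction u arbitrary: v)
qed (case_tac v; simp add: enc_nat_inj enc_tuple_inj del: enc_nat.simps)+

text \<open>Tuples and positions share the labels from 4 on. They are not confused, as within the
  core only positions are linked to elements, and the label 3 is reserved for elements.\<close>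

fun label :: "node \<Rightarrow> nat" where
  "label (El a) = 3"
| "label (Tup p) = 4 + fst p"
| "label (Inc p j) = 4 + j"
| "label (Pen v k) = 0"

definition tuples :: "struct \<Rightarrow> (nat \<times> nat list) list" where
  "tuples A = concat (map (\<lambda>(i, r, T). map (Pair i) T) (List.enumerate 0 (snd A)))"

definition entries :: "struct \<Rightarrow> ((nat \<times> nat list) \<times> (nat \<times> nat)) list" where
  "entries A = concat (map (\<lambda>p. map (Pair p) (List.enumerate 0 (snd p))) (tuples A))"

definition core_nodes :: "struct \<Rightarrow> node list" where
  "core_nodes A = map El (rev [0..<fst A]) @ map Tup (tuples A) @ map (\<lambda>(p, j, a). Inc p j) (entries A)"

definition pens :: "struct \<Rightarrow> (node \<times> nat) list" where
  "pens A = concat (map (\<lambda>v. map (Pair v) (rev [0..<label v])) (core_nodes A))"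

definition nodes :: "struct \<Rightarrow> node list" where
  "nodes A = core_nodes A @ map (\<lambda>(v, k). Pen v k) (pens A)"

definition links :: "struct \<Rightarrow> (node \<times> node) list" where
  "links A = map (\<lambda>(p, j, a). (Tup p, Inc p j)) (entries A) @
     map (\<lambda>(p, j, a). (Inc p j, El a)) (entries A) @ map (\<lambda>(v, k). (v, Pen v k)) (pens A)"

lemma set_tuples: "(i, t) \<in> set (tuples A) \<longleftrightarrow> i < length (snd A) \<and> t \<in> set (snd (snd A ! i))"
proof -
  have "(i, t) \<in> set (tuples A) \<longleftrightarrow>
      (\<exists>x \<in> set (List.enumerate 0 (snd A)). fst x = i \<and> t \<in> set (snd (snd x)))"
    unfolding tuples_def by (auto simp: case_prod_unfold image_iff)
  then show ?thesis
    by (auto simp: in_set_enumerate_eq intro!: bexI[of _ "(i, snd A ! i)"])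
qed

lemma set_entries: "(p, j, a) \<in> set (entries A) \<longleftrightarrow> p \<in> set (tuples A) \<and> j < length (snd p) \<and> a = snd p ! j"
  unfolding entries_def by (auto simp: in_set_enumerate_eq image_iff)

lemma set_core_nodes:
  "El a \<in> set (core_nodes A) \<longleftrightarrow> a < fst A"
  "Tup p \<in> set (core_nodes A) \<longleftrightarrow> p \<in> set (tuples A)"
  "Inc p j \<in> set (core_nodes A) \<longleftrightarrow> p \<in> set (tuples A) \<and> j < length (snd p)"
  "Pen v k \<notin> set (core_nodes A)"
proof -
  have "Inc p j \<in> (\<lambda>(p, j, a). Inc p j) ` set (entries A) \<longleftrightarrow> (\<exists>a. (p, j, a) \<in> set (entries A))"
    by (cases p) (auto simp: image_iff Bex_def)
  then show "Inc p j \<in> set (core_nodes A) \<longleftrightarrow> p \<in> set (tuples A) \<and> j < length (snd p)"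
    by (auto simp: core_nodes_def set_entries)
qed (auto simp: core_nodes_def)

lemma set_pens: "(v, k) \<in> set (pens A) \<longleftrightarrow> v \<in> set (core_nodes A) \<and> k < label v"
  unfolding pens_def by (auto simp: image_iff)

lemma set_nodes: "v \<in> set (nodes A) \<longleftrightarrow>
    v \<in> set (core_nodes A) \<or> (\<exists>u k. v = Pen u k \<and> u \<in> set (core_nodes A) \<and> k < label u)"
  unfolding nodes_def by (auto simp: set_pens)

lemma set_links: "(u, v) \<in> set (links A) \<longleftrightarrow>
    (\<exists>p j. u = Tup p \<and> v = Inc p j \<and> p \<in> set (tuples A) \<and> j < length (snd p)) \<or>
    (\<exists>p j. u = Inc p j \<and> v = El (snd p ! j) \<and> p \<in> set (tuples A) \<and> j < length (snd p)) \<or>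
    (\<exists>k. v = Pen u k \<and> u \<in> set (core_nodes A) \<and> k < label u)"
  unfolding links_def by (auto simp: set_pens set_entries image_iff Bex_def)

lemma label_core: "v \<in> set (core_nodes A) \<Longrightarrow> 3 \<le> label v"
  by (cases v) (auto simp: set_core_nodes)

lemma distinct_concat_map:
  assumes "distinct xs" "\<And>x. x \<in> set xs \<Longrightarrow> distinct (f x)"
    and "\<And>x y. x \<in> set xs \<Longrightarrow> y \<in> set xs \<Longrightarrow> x \<noteq> y \<Longrightarrow> set (f x) \<inter> set (f y) = {}"
  shows "distinct (concat (map f xs))"
  using assms
proof (induction xs)
  case (Cons x xs)
  then show ?case by (auto simp: disjoint_iff)
qed simp

lemma is_structD:
  assumes "is_struct A" "(i, t) \<in> set (tuples A)"
  shows "length t = fst (snd A ! i)" "set t \<subseteq> {..<fst A}"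
proof -
  have "snd A ! i \<in> set (snd A)" "t \<in> set (snd (snd A ! i))"
    using assms(2) by (simp_all add: set_tuples)
  with assms(1) show "length t = fst (snd A ! i)" "set t \<subseteq> {..<fst A}"
    by (auto simp: is_struct_def case_prod_unfold)
qed

lemma distinct_tuples:
  assumes "is_struct A"
  shows "distinct (tuples A)"
  unfolding tuples_def
proof (rule distinct_concat_map)
  fix x assume x: "x \<in> set (List.enumerate 0 (snd A))"
  then have "snd x \<in> set (snd A)"
    using nth_mem[of "fst x" "snd A"] by (simp add: in_set_enumerate_eq)
  with assms have "distinct (snd (snd x))" by (auto simp: is_struct_def)
  then show "distinct ((\<lambda>(i, r, T). map (Pair i) T) x)"
    by (simp add: case_prod_unfold distinct_map inj_on_def)
qed (auto simp: in_set_enumerate_eq)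

lemma distinct_entries:
  assumes "is_struct A"
  shows "distinct (entries A)"
  unfolding entries_def
  by (rule distinct_concat_map) (auto simp: distinct_tuples[OF assms] distinct_map inj_on_def)

lemma distinct_core_nodes:
  assumes "is_struct A"
  shows "distinct (core_nodes A)"
proof -
  have "inj_on (\<lambda>(p, j, a). Inc p j) (set (entries A))"
    by (auto simp: inj_on_def set_entries)
  then show ?thesis
    by (auto simp: core_nodes_def distinct_map distinct_tuples[OF assms] distinct_entries[OF assms]
        inj_on_def)
qed

lemma distinct_pens:
  assumes "is_struct A"
  shows "distinct (pens A)"
  unfolding pens_def
  by (rule distinct_concat_map) (auto simp: distinct_core_nodes[OF assms] distinct_map inj_on_def)

lemma distinct_nodes:
  assumes "is_struct A"
  shows "distinct (nodes A)"
  by (auto simp: nodes_def distinct_core_nodes[OF assms] distinct_pens[OF assms] distinct_map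
      inj_on_def set_core_nodes)

lemma distinct_links:
  assumes "is_struct A"
  shows "distinct (links A)"
proof -
  have "inj_on (\<lambda>(p, j, a). (Tup p, Inc p j)) (set (entries A))"
    "inj_on (\<lambda>(p, j, a). (Inc p j, El a)) (set (entries A))"
    "inj_on (\<lambda>(v, k). (v, Pen v k)) (set (pens A))"
    by (auto simp: inj_on_def set_entries)
  then show ?thesis
    by (auto simp: links_def distinct_map distinct_entries[OF assms] distinct_pens[OF assms])
qed

text \<open>Links lead from tuples to positions, from positions to elements and from core to pendant
  vertices. Since no link also occurs reversed, distinct links stay distinct as undirected
  edges.\<close>

lemma links_subset:
  assumes "is_struct A" "(u, v) \<in> set (links A)"
  shows "u \<in> set (core_nodes A)" "v \<in> set (nodes A)" "u \<noteq> v" "(v, u) \<notin> set (links A)"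
proof -
  have "snd p ! j < fst A" if "p \<in> set (tuples A)" "j < length (snd p)" for p j
    using subsetD[OF is_structD(2)[OF assms(1), of "fst p" "snd p"] nth_mem[of j "snd p"]] that by simp
  with assms(2) show "u \<in> set (core_nodes A)" "v \<in> set (nodes A)" "u \<noteq> v" "(v, u) \<notin> set (links A)"
    by (auto simp: set_links set_nodes set_core_nodes)
qed

text \<open>Vertices of graphs are natural numbers; the position in the vertex list is a name that a
  search through the encoded list computes.\<close>

abbreviation num :: "struct \<Rightarrow> node \<Rightarrow> nat" where
  "num A v \<equiv> index v (nodes A)"

definition graph_verts :: "struct \<Rightarrow> nat list" where
  "graph_verts A = map (num A) (nodes A)"

definition graph_edges :: "struct \<Rightarrow> (nat \<times> nat) list" where
  "graph_edges A = map (\<lambda>(u, v). (num A u, num A v)) (links A)"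

definition struct_graph :: "struct \<Rightarrow> graph" where
  "struct_graph A = \<lparr>verts = num A ` set (nodes A), edges = (\<lambda>(u, v). {num A u, num A v}) ` set (links A)\<rparr>"

lemma num_eq: "u \<in> set (nodes A) \<Longrightarrow> v \<in> set (nodes A) \<Longrightarrow> num A u = num A v \<longleftrightarrow> u = v"
  using inj_on_index[of "nodes A"] by (auto simp: inj_on_def)

lemma core_in_nodes: "v \<in> set (core_nodes A) \<Longrightarrow> v \<in> set (nodes A)"
  by (simp add: nodes_def)

lemma struct_graph_edge:
  assumes "is_struct A" "u \<in> set (nodes A)" "v \<in> set (nodes A)"
  shows "{num A u, num A v} \<in> edges (struct_graph A) \<longleftrightarrow> (u, v) \<in> set (links A) \<or> (v, u) \<in> set (links A)"
proof
  assume "{num A u, num A v} \<in> edges (struct_graph A)"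
  then obtain u' v' where *: "(u', v') \<in> set (links A)" "{num A u, num A v} = {num A u', num A v'}"
    by (auto simp: struct_graph_def)
  have "u' \<in> set (nodes A)" "v' \<in> set (nodes A)"
    using links_subset[OF assms(1) *(1)] core_in_nodes by auto
  with *(2) assms(2,3) have "u = u' \<and> v = v' \<or> u = v' \<and> v = u'"
    by (simp add: doubleton_eq_iff num_eq)
  with *(1) show "(u, v) \<in> set (links A) \<or> (v, u) \<in> set (links A)" by auto
qed (force simp: struct_graph_def insert_commute)

lemma is_graph_struct_graph:
  assumes "is_struct A"
  shows "is_graph (struct_graph A)"
  unfolding is_graph_def
proof (intro conjI ballI)
  show "finite (verts (struct_graph A))" by (simp add: struct_graph_def)
  fix e assume "e \<in> edges (struct_graph A)"
  then obtain u v where *: "(u, v) \<in> set (links A)" "e = {num A u, num A v}"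
    by (auto simp: struct_graph_def)
  from links_subset[OF assms *(1)] core_in_nodes
  have "u \<in> set (nodes A)" "v \<in> set (nodes A)" "u \<noteq> v" by auto
  with *(2) show "e \<subseteq> verts (struct_graph A)" "card e = 2"
    by (auto simp: struct_graph_def num_eq)
qed

lemma lists_struct_graph:
  assumes "is_struct A"
  shows "lists_graph (graph_verts A) (graph_edges A) (struct_graph A)"
proof -
  have "inj_on (\<lambda>(u, v). {num A u, num A v}) (set (links A))"
  proof (rule inj_onI, clarify)
    fix u v u' v'
    assume l: "(u, v) \<in> set (links A)" "(u', v') \<in> set (links A)"
      and e: "{num A u, num A v} = {num A u', num A v'}"
    have "u \<in> set (nodes A)" "v \<in> set (nodes A)" "u' \<in> set (nodes A)" "v' \<in> set (nodes A)"
      using links_subset[OF assms l(1)] links_subset[OF assms l(2)] core_in_nodes by auto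
    with e have "u = u' \<and> v = v' \<or> u = v' \<and> v = u'" by (simp add: doubleton_eq_iff num_eq)
    with links_subset(4)[OF assms l(1)] l(2) show "u = u' \<and> v = v'" by auto
  qed
  then show ?thesis
    using inj_on_index[of "nodes A"]
    by (auto simp: lists_graph_def graph_verts_def graph_edges_def struct_graph_def distinct_map
        distinct_nodes[OF assms] distinct_links[OF assms] comp_def case_prod_unfold image_image)
qed

lemma subdivision_struct_graph:
  assumes A: "is_struct A" and "is_graph G" "topological_minor_model (struct_graph A) G \<eta> \<pi>"
  shows "subdivision (struct_graph A) G \<eta> \<pi> (num A ` set (core_nodes A))"
    and "v \<in> set (core_nodes A) \<Longrightarrow> card {p \<in> verts (struct_graph A) - num A ` set (core_nodes A).
        {num A v, p} \<in> edges (struct_graph A)} = label v"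
proof -
  have core: "num A v \<in> num A ` set (core_nodes A) \<longleftrightarrow> v \<in> set (core_nodes A)"
    if "v \<in> set (nodes A)" for v
    using that by (auto simp: num_eq core_in_nodes)
  have noncore: "\<exists>u k. p = num A (Pen u k) \<and> u \<in> set (core_nodes A) \<and> k < label u"
    if "p \<in> verts (struct_graph A) - num A ` set (core_nodes A)" for p
    using that by (auto simp: struct_graph_def set_nodes) blast
  show card: "card {p \<in> verts (struct_graph A) - num A ` set (core_nodes A).
        {num A v, p} \<in> edges (struct_graph A)} = label v" if v: "v \<in> set (core_nodes A)" for v
  proof -
    have pen: "Pen u k \<in> set (nodes A)" if "u \<in> set (core_nodes A)" "k < label u" for u k
      using that by (simp add: set_nodes)
    have "{p \<in> verts (struct_graph A) - num A ` set (core_nodes A). {num A v, p} \<in> edges (struct_graph A)} =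
        (\<lambda>k. num A (Pen v k)) ` {..<label v}" (is "?L = ?R")
    proof (intro equalityI subsetI)
      fix p assume p: "p \<in> ?L"
      then obtain u k where u: "p = num A (Pen u k)" "u \<in> set (core_nodes A)" "k < label u"
        using noncore by blast
      with p struct_graph_edge[OF A core_in_nodes[OF v] pen[OF u(2,3)]] v show "p \<in> ?R"
        by (auto simp: set_links set_core_nodes)
    next
      fix p assume "p \<in> ?R"
      then obtain k where k: "k < label v" "p = num A (Pen v k)" by auto
      with struct_graph_edge[OF A core_in_nodes[OF v] pen[OF v k(1)]] core[OF pen[OF v k(1)]] pen[OF v k(1)] v
      show "p \<in> ?L" by (auto simp: set_links set_core_nodes struct_graph_def)
    qed
    moreover have "inj_on (\<lambda>k. num A (Pen v k)) {..<label v}"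
      using pen[OF v] by (auto simp: inj_on_def num_eq)
    ultimately show ?thesis by (simp add: card_image)
  qed
  show "subdivision (struct_graph A) G \<eta> \<pi> (num A ` set (core_nodes A))"
  proof (unfold_locales)
    show "num A ` set (core_nodes A) \<subseteq> verts (struct_graph A)"
      by (auto simp: struct_graph_def core_in_nodes)
    show "e \<inter> num A ` set (core_nodes A) \<noteq> {}" if "e \<in> edges (struct_graph A)" for e
      using that links_subset(1)[OF A] by (auto simp: struct_graph_def)
    show "e = f" if "p \<in> verts (struct_graph A) - num A ` set (core_nodes A)" "e \<in> edges (struct_graph A)"
      "p \<in> e" "f \<in> edges (struct_graph A)" "p \<in> f" for p e f
    proof -
      from noncore[OF that(1)] obtain u k where u: "p = num A (Pen u k)" "u \<in> set (core_nodes A)" "k < label u"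
        by blast
      \<comment> \<open>A pendant vertex occurs in links only as second component, next to its own
        core vertex.\<close>
      have "g = {num A u, p}" if g: "g \<in> edges (struct_graph A)" "p \<in> g" for g
      proof -
        from g(1) obtain v w where vw: "(v, w) \<in> set (links A)" "g = {num A v, num A w}"
          by (auto simp: struct_graph_def)
        have "v \<in> set (core_nodes A)" "v \<in> set (nodes A)" "w \<in> set (nodes A)"
          using links_subset[OF A vw(1)] core_in_nodes by auto
        moreover have "Pen u k \<in> set (nodes A)" using u by (simp add: set_nodes)
        ultimately have "w = Pen u k" using g(2) vw(2) u(1) by (auto simp: num_eq set_core_nodes)
        with vw(1) have "v = u" by (auto simp: set_links)
        with vw(2) \<open>w = Pen u k\<close> u(1) show ?thesis by simp
      qed
      from this[OF that(2,3)] this[OF that(4,5)] show ?thesis by simp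
    qed
    show "3 \<le> card {p \<in> verts (struct_graph A) - num A ` set (core_nodes A). {v, p} \<in> edges (struct_graph A)}"
      if v: "v \<in> num A ` set (core_nodes A)" for v
    proof -
      from v obtain u where "u \<in> set (core_nodes A)" "v = num A u" by blast
      then show ?thesis using card[of u] label_core[of u A] by simp
    qed
  qed (use assms is_graph_struct_graph in auto)
qed

section \<open>Computing the graph from the encoded structure\<close>

definition vtuples :: "val \<Rightarrow> val" where
  "vtuples R = vconcat (vmap (\<lambda>e. vmap (Node (left e)) (right (right e))) (venum R))"

definition ventries :: "val \<Rightarrow> val" where
  "ventries T = vconcat (vmap (\<lambda>p. vmap (Node p) (venum (right p))) T)"

definition vinc :: "val \<Rightarrow> val" where
  "vinc e = Node (enc_nat 2) (Node (left e) (left (right e)))"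

text \<open>Every core vertex is stored together with its label in unary, from which
  \<open>vpens\<close> produces the pendant vertices.\<close>

definition vcores :: "val \<Rightarrow> val \<Rightarrow> val \<Rightarrow> val" where
  "vcores n T I = app (app
     (vmap (\<lambda>e. Node (vinc e) (vplus4 (left (right e)))) I)
     (vmap (\<lambda>p. Node (Node (enc_nat 1) p) (vplus4 (left p))) T))
     (vmap (\<lambda>a. Node (Node (enc_nat 0) a) (enc_nat 3)) (vtails n))"

definition vpens :: "val \<Rightarrow> val" where
  "vpens C = vconcat (vmap (\<lambda>c. vmap (Node (left c)) (vtails (right c))) C)"

definition vlinks :: "val \<Rightarrow> val \<Rightarrow> val" where
  "vlinks I P = app (app
     (vmap (\<lambda>p. Node (left p) (Node (enc_nat 3) p)) P)
     (vmap (\<lambda>e. Node (vinc e) (Node (enc_nat 0) (right (right e)))) I))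
     (vmap (\<lambda>e. Node (Node (enc_nat 1) (left e)) (vinc e)) I)"

definition vnodes :: "val \<Rightarrow> val \<Rightarrow> val" where
  "vnodes C P = app (vmap (Node (enc_nat 3)) P) (vmap left C)"

definition vnumber :: "val \<Rightarrow> val \<Rightarrow> val" where
  "vnumber V L = Node (vmap (\<lambda>v. vindex v V) V) (vmap (\<lambda>e. Node (vindex (left e) V) (vindex (right e) V)) L)"

definition vgraph :: "val \<Rightarrow> val \<Rightarrow> val \<Rightarrow> val" where
  "vgraph n T I = vnumber (vnodes (vcores n T I) (vpens (vcores n T I))) (vlinks I (vpens (vcores n T I)))"

definition vbuild :: "val \<Rightarrow> val" where
  "vbuild A = vgraph (left A) (vtuples (right A)) (ventries (vtuples (right A)))"

lemma vmap_enc: "(\<And>x. F (c x) = c' (f x)) \<Longrightarrow> vmap F (enc_list c xs) = enc_list c' (map f xs)"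
  by (induction xs) auto

lemma vconcat_vmap_enc:
  "(\<And>x. F (c x) = enc_list c' (f x)) \<Longrightarrow> vconcat (vmap F (enc_list c xs)) = enc_list c' (concat (map f xs))"
  by (induction xs) (auto simp: app_enc_list)

definition enc_pair :: "('a \<Rightarrow> val) \<Rightarrow> ('b \<Rightarrow> val) \<Rightarrow> 'a \<times> 'b \<Rightarrow> val" where
  "enc_pair c d = (\<lambda>(x, y). Node (c x) (d y))"

lemma enc_pair_simp [simp]: "enc_pair c d (x, y) = Node (c x) (d y)"
  by (simp add: enc_pair_def)

lemma venum_enc: "venum (enc_list c xs) = enc_list (enc_pair enc_nat c) (List.enumerate 0 xs)"
  unfolding venum_enc_list enc_pair_def ..

lemma vtuples: "vtuples (right (enc_struct A)) = enc_list enc_tuple (tuples A)"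
proof -
  have "vmap (Node (enc_nat i)) (enc_list (enc_list enc_nat) T) = enc_list enc_tuple (map (Pair i) T)" for i T
    by (rule vmap_enc) (simp add: enc_tuple_def)
  then show ?thesis
    unfolding vtuples_def enc_struct_def right.simps venum_enc tuples_def
    by (intro vconcat_vmap_enc) (auto split: prod.splits)
qed

abbreviation "enc_entry \<equiv> enc_pair enc_tuple (enc_pair enc_nat enc_nat)"

lemma ventries: "ventries (enc_list enc_tuple (tuples A)) = enc_list enc_entry (entries A)"
  unfolding ventries_def entries_def
proof (rule vconcat_vmap_enc)
  fix p
  have "right (enc_tuple p) = enc_list enc_nat (snd p)" by (cases p) (simp add: enc_tuple_def)
  then show "vmap (Node (enc_tuple p)) (venum (right (enc_tuple p))) =
      enc_list enc_entry (map (Pair p) (List.enumerate 0 (snd p)))"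
    by (simp only: venum_enc) (rule vmap_enc, simp)
qed

lemma vinc: "vinc (enc_entry (p, j, a)) = enc_node (Inc p j)"
  by (simp add: vinc_def)

lemma left_enc_tuple: "left (enc_tuple p) = enc_nat (fst p)"
  by (cases p) (simp add: enc_tuple_def)

abbreviation "enc_labelled \<equiv> (\<lambda>v. Node (enc_node v) (enc_nat (label v)))"

lemma vcores:
  "vcores (enc_nat (fst A)) (enc_list enc_tuple (tuples A)) (enc_list enc_entry (entries A)) =
    enc_list enc_labelled (core_nodes A)"
proof -
  have "vmap (\<lambda>e. Node (vinc e) (vplus4 (left (right e)))) (enc_list enc_entry (entries A)) =
      enc_list enc_labelled (map (\<lambda>(p, j, a). Inc p j) (entries A))"
    by (rule vmap_enc) (clarsimp simp: vinc[simplified] enc_nat_add4 simp del: enc_nat.simps)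
  moreover have "vmap (\<lambda>p. Node (Node (enc_nat 1) p) (vplus4 (left p))) (enc_list enc_tuple (tuples A)) =
      enc_list enc_labelled (map Tup (tuples A))"
    by (rule vmap_enc) (simp add: left_enc_tuple enc_nat_add4 del: enc_nat.simps)
  moreover have "vmap (\<lambda>a. Node (Node (enc_nat 0) a) (enc_nat 3)) (vtails (enc_nat (fst A))) =
      enc_list enc_labelled (map El (rev [0..<fst A]))"
    unfolding vtails_enc_nat by (rule vmap_enc) simp
  ultimately show ?thesis
    by (simp only: vcores_def core_nodes_def app_enc_list)
qed

abbreviation "enc_pen \<equiv> enc_pair enc_node enc_nat"

lemma vpens: "vpens (enc_list enc_labelled (core_nodes A)) = enc_list enc_pen (pens A)"
  unfolding vpens_def pens_def
proof (rule vconcat_vmap_enc)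
  fix v
  show "vmap (Node (left (enc_labelled v))) (vtails (right (enc_labelled v))) =
      enc_list enc_pen (map (Pair v) (rev [0..<label v]))"
    by (simp only: left.simps right.simps vtails_enc_nat) (rule vmap_enc, simp)
qed

lemma vnodes: "vnodes (enc_list enc_labelled (core_nodes A)) (enc_list enc_pen (pens A)) =
    enc_list enc_node (nodes A)"
proof -
  have "vmap (Node (enc_nat 3)) (enc_list enc_pen (pens A)) =
      enc_list enc_node (map (\<lambda>(v, k). Pen v k) (pens A))"
    by (rule vmap_enc) (clarsimp simp del: enc_nat.simps)
  moreover have "vmap left (enc_list enc_labelled (core_nodes A)) = enc_list enc_node (map id (core_nodes A))"
    by (rule vmap_enc) simp
  ultimately show ?thesis by (simp only: vnodes_def nodes_def app_enc_list list.map_id)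
qed

abbreviation "enc_link \<equiv> enc_pair enc_node enc_node"

lemma vlinks: "vlinks (enc_list enc_entry (entries A)) (enc_list enc_pen (pens A)) =
    enc_list enc_link (links A)"
proof -
  have "vmap (\<lambda>p. Node (left p) (Node (enc_nat 3) p)) (enc_list enc_pen (pens A)) =
      enc_list enc_link (map (\<lambda>(v, k). (v, Pen v k)) (pens A))"
    by (rule vmap_enc) (clarsimp simp del: enc_nat.simps)
  moreover have "vmap (\<lambda>e. Node (vinc e) (Node (enc_nat 0) (right (right e)))) (enc_list enc_entry (entries A)) =
      enc_list enc_link (map (\<lambda>(p, j, a). (Inc p j, El a)) (entries A))"
    by (rule vmap_enc) (clarsimp simp: vinc[simplified] simp del: enc_nat.simps)
  moreover have "vmap (\<lambda>e. Node (Node (enc_nat 1) (left e)) (vinc e)) (enc_list enc_entry (entries A)) =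
      enc_list enc_link (map (\<lambda>(p, j, a). (Tup p, Inc p j)) (entries A))"
    by (rule vmap_enc) (clarsimp simp: vinc[simplified] simp del: enc_nat.simps)
  ultimately show ?thesis by (simp only: vlinks_def links_def app_enc_list append_assoc)
qed

lemma vnumber: "vnumber (enc_list enc_node (nodes A)) (enc_list enc_link (links A)) =
    enc_graph (graph_verts A) (graph_edges A)"
proof -
  have inj: "inj enc_node" by (simp add: inj_def enc_node_inj)
  have "vmap (\<lambda>v. vindex v (enc_list enc_node (nodes A))) (enc_list enc_node (nodes A)) =
      enc_list enc_nat (graph_verts A)"
    unfolding graph_verts_def by (rule vmap_enc) (simp add: vindex_enc_list[OF inj])
  moreover have "vmap (\<lambda>e. Node (vindex (left e) (enc_list enc_node (nodes A)))
        (vindex (right e) (enc_list enc_node (nodes A)))) (enc_list enc_link (links A)) =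
      enc_list (\<lambda>(u, v). Node (enc_nat u) (enc_nat v)) (graph_edges A)"
    unfolding graph_edges_def by (rule vmap_enc) (auto simp: vindex_enc_list[OF inj])
  ultimately show ?thesis by (simp only: vnumber_def enc_graph_def)
qed

lemma vbuild_enc_struct: "vbuild (enc_struct A) = enc_graph (graph_verts A) (graph_edges A)"
proof -
  have "left (enc_struct A) = enc_nat (fst A)" by (simp add: enc_struct_def)
  then show ?thesis
    by (simp only: vbuild_def vgraph_def vtuples ventries vcores vpens vnodes vlinks vnumber)
qed

lemma ptime_vinc: "ptime F \<Longrightarrow> ptime (\<lambda>x. vinc (F x))"
  unfolding vinc_def by (intro ptime_intros)

lemma ptime_vcores: "ptime F \<Longrightarrow> ptime G \<Longrightarrow> ptime H \<Longrightarrow> ptime (\<lambda>x. vcores (F x) (G x) (H x))"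
  unfolding vcores_def
  by (intro ptime_v_intros ptime_app ptime_vmap ptime_vinc ptime_vtails ptime_comp[of _ right])

lemma ptime_vpens: "ptime F \<Longrightarrow> ptime (\<lambda>x. vpens (F x))"
  unfolding vpens_def
  by (intro ptime_vconcat ptime_vmap ptime_intros ptime_vtails)

lemma ptime_vlinks: "ptime F \<Longrightarrow> ptime G \<Longrightarrow> ptime (\<lambda>x. vlinks (F x) (G x))"
  unfolding vlinks_def by (intro ptime_app ptime_vmap ptime_intros ptime_vinc)

lemma ptime_vnodes: "ptime F \<Longrightarrow> ptime G \<Longrightarrow> ptime (\<lambda>x. vnodes (F x) (G x))"
  unfolding vnodes_def by (intro ptime_app ptime_vmap ptime_intros)

lemma ptime_vnumber: "ptime F \<Longrightarrow> ptime G \<Longrightarrow> ptime (\<lambda>x. vnumber (F x) (G x))"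
proof (erule (1) ptime_comp2[rotated])
  show "ptime (\<lambda>z. vnumber (left z) (right z))"
    unfolding vnumber_def by (intro ptime_intros ptime_vmap ptime_vindex)
qed

lemma ptime_vtuples: "ptime F \<Longrightarrow> ptime (\<lambda>x. vtuples (F x))"
  unfolding vtuples_def by (intro ptime_vconcat ptime_vmap ptime_intros ptime_venum)

lemma ptime_ventries: "ptime F \<Longrightarrow> ptime (\<lambda>x. ventries (F x))"
  unfolding ventries_def by (intro ptime_vconcat ptime_vmap ptime_intros ptime_venum)

lemma ptime_vbuild: "ptime vbuild"
  unfolding vbuild_def[abs_def] vgraph_def
  by (intro ptime_vnumber ptime_vnodes ptime_vlinks ptime_vpens ptime_vcores ptime_ventries
      ptime_vtuples ptime_intros)

section \<open>Extracting the subdivision from a model\<close>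

definition vpaths :: "val \<Rightarrow> val" where
  "vpaths m = Node (left (left m)) (vconcat (vmap vsucc_pairs (right (right m))))"

lemma ptime_vpaths: "ptime vpaths"
  unfolding vpaths_def[abs_def] by (intro ptime_intros ptime_vconcat ptime_vmap ptime_vsucc_pairs)

text \<open>The edges \<open>ds\<close> of the host are dropped and replaced by the steps of the
  listed paths, while its vertices \<open>ws\<close> are kept.\<close>

lemma vpaths_enc: "vpaths (Node (enc_graph ws ds) (enc_model vs es \<eta> \<pi>)) =
    enc_graph ws (concat (map (\<lambda>(u, v). zip (\<pi> {u, v}) (tl (\<pi> {u, v}))) es))"
proof -
  have "vmap vsucc_pairs (enc_list (\<lambda>(u, v). enc_list enc_nat (\<pi> {u, v})) es) =
      enc_list (enc_list (\<lambda>(u, v). Node (enc_nat u) (enc_nat v))) (map (\<lambda>(u, v). zip (\<pi> {u, v}) (tl (\<pi> {u, v}))) es)"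
    by (rule vmap_enc) (auto simp: vsucc_pairs_enc_list)
  then show ?thesis
    by (simp add: vpaths_def enc_graph_def enc_model_def vconcat_enc_list)
qed

lemma distinct_path_steps:
  "distinct p \<Longrightarrow> distinct (map (\<lambda>(u, v). {u, v}) (zip p (tl p)))"
proof (induction p)
  case (Cons x p)
  show ?case
  proof (cases p)
    case (Cons y q)
    have "{x, y} \<noteq> {u, v}" if "(u, v) \<in> set (zip p (tl p))" for u v
    proof -
      have "u \<in> set p" "v \<in> set p" using that unfolding in_zip_tl_iff by auto
      with Cons.prems show ?thesis by (auto simp: doubleton_eq_iff)
    qed
    with Cons.IH Cons.prems Cons show ?thesis by fastforce
  qed simp
qed simp

text \<open>The ends of a common edge lie on both paths and hence are inner in neither; so
  \<open>e\<close> and \<open>f\<close> have the same images, against injectivity. This excludes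
  repetitions in the concatenated edge list.\<close>

lemma (in subdivision) path_edges_disjoint:
  assumes "e \<in> edges H" "f \<in> edges H" "e \<noteq> f"
  shows "path_edges (\<pi> e) \<inter> path_edges (\<pi> f) = {}"
proof (rule ccontr)
  assume "path_edges (\<pi> e) \<inter> path_edges (\<pi> f) \<noteq> {}"
  then obtain g where g: "g \<in> path_edges (\<pi> e)" "g \<in> path_edges (\<pi> f)" by blast
  then obtain x y where "g = {x, y}" by (auto simp: path_edges_def)
  with g have xy: "{x, y} \<in> path_edges (\<pi> e)" "{x, y} \<in> path_edges (\<pi> f)" by simp_all
  have "distinct (\<pi> e)" using \<pi>[OF assms(1)] by (simp add: is_path_def)
  with xy(1) have "x \<noteq> y" unfolding path_edges_iff by auto
  have mem: "x \<in> set (\<pi> e)" "y \<in> set (\<pi> e)" "x \<in> set (\<pi> f)" "y \<in> set (\<pi> f)"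
    using xy unfolding path_edges_iff by auto
  have sub: "{x, y} \<subseteq> \<eta> ` e" "{x, y} \<subseteq> \<eta> ` f"
    using inner_disjoint[OF assms] inner_disjoint[OF assms(2,1) assms(3)[symmetric]] mem by auto
  have card: "card e = 2" "card f = 2" "e \<subseteq> verts H" "f \<subseteq> verts H"
    using H assms by (auto simp: is_graph_def)
  then have fin: "finite e" "finite f" by (auto intro: card_ge_0_finite)
  have "card {x, y} = 2" using \<open>x \<noteq> y\<close> by simp
  with card fin sub have "\<eta> ` e = {x, y}" "\<eta> ` f = {x, y}"
    by (metis card_image_le card_seteq finite_imageI)+
  moreover have "inj_on \<eta> (verts H)" using \<eta>_eq by (auto simp: inj_on_def)
  ultimately have "e = f" using card(3,4) inj_on_image_eq_iff[of \<eta> "verts H" e f] by simp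
  with assms(3) show False ..
qed

lemma (in subdivision) lists_path_graph:
  assumes "lists_graph vs es H" "lists_graph ws ds G"
  shows "lists_graph ws (concat (map (\<lambda>(u, v). zip (\<pi> {u, v}) (tl (\<pi> {u, v}))) es)) G'"
proof -
  let ?h = "\<lambda>(u, v). {u, v :: nat}"
  have es: "distinct (map ?h es)" "?h ` set es = edges H"
    using assms(1) by (auto simp: lists_graph_def)
  have "distinct (concat (map (\<lambda>e. map ?h (zip (\<pi> e) (tl (\<pi> e)))) (map ?h es)))"
  proof (rule distinct_concat_map[OF es(1)])
    show "distinct (map ?h (zip (\<pi> e) (tl (\<pi> e))))" if "e \<in> set (map ?h es)" for e
      using that es(2) \<pi>[of e] by (intro distinct_path_steps) (auto simp: is_path_def)
    show "set (map ?h (zip (\<pi> e) (tl (\<pi> e)))) \<inter> set (map ?h (zip (\<pi> f) (tl (\<pi> f)))) = {}"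
      if "e \<in> set (map ?h es)" "f \<in> set (map ?h es)" "e \<noteq> f" for e f
      using path_edges_disjoint[of e f] that es(2) by (simp add: path_edges_def)
  qed
  moreover have "map ?h (concat (map (\<lambda>(u, v). zip (\<pi> {u, v}) (tl (\<pi> {u, v}))) es)) =
      concat (map (\<lambda>e. map ?h (zip (\<pi> e) (tl (\<pi> e)))) (map ?h es))"
    by (simp add: map_concat comp_def case_prod_unfold)
  moreover have "?h ` set (concat (map (\<lambda>(u, v). zip (\<pi> {u, v}) (tl (\<pi> {u, v}))) es)) = edges G'"
  proof -
    have "edges G' = (\<Union>e \<in> ?h ` set es. path_edges (\<pi> e))"
      by (simp add: G'_def path_graph_def es(2))
    then show ?thesis by (auto simp: path_edges_def case_prod_unfold)
  qed
  ultimately show ?thesis using assms(2) by (simp add: lists_graph_def)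
qed

section \<open>Correctness of the reduction\<close>

lemma path_graph_models_iff:
  assumes A: "is_struct A" and \<phi>: "fo_sentence_for A \<phi>"
    and minor: "is_graph G" "topological_minor_model (struct_graph A) G \<eta> \<pi>"
  shows "graph_models (path_graph (struct_graph A) G \<pi>) (trans_fm \<phi>) \<longleftrightarrow> struct_models A \<phi>"
proof -
  interpret subdivision "struct_graph A" G \<eta> \<pi> "num A ` set (core_nodes A)"
    by (rule subdivision_struct_graph[OF A minor])
  define \<theta> where "\<theta> v = \<eta> (num A v)" for v
  have graph: "is_graph G'" using subgraph_G' by (simp add: subgraph_def)
  have card: "card (pendants G' (\<theta> v)) = label v" if "v \<in> set (core_nodes A)" for v
    using card_pendants[of "num A v"] subdivision_struct_graph(2)[OF A minor that] that
    by (simp add: \<theta>_def)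
  have joined: "joined G' (\<theta> u) (\<theta> v) \<longleftrightarrow> (u, v) \<in> set (links A) \<or> (v, u) \<in> set (links A)"
    if "u \<in> set (core_nodes A)" "v \<in> set (core_nodes A)" for u v
    using joined_iff[of "num A u" "num A v"] struct_graph_edge[OF A core_in_nodes core_in_nodes, OF that] that
    by (simp add: \<theta>_def)
  have verts: "\<theta> v \<in> verts G" if "v \<in> set (core_nodes A)" for v
    using \<eta>_verts[of "num A v"] K that by (auto simp: \<theta>_def)
  have core: "\<exists>v \<in> set (core_nodes A). x = \<theta> v \<and> label v = card (pendants G' x)"
    if "3 \<le> card (pendants G' x)" for x
  proof -
    from branching_if_pendants[OF that] obtain v where "v \<in> set (core_nodes A)" "x = \<theta> v"
      unfolding branching_iff by (auto simp: \<theta>_def)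
    with card show ?thesis by auto
  qed
  have \<theta>_inj: "\<theta> u = \<theta> v \<longleftrightarrow> u = v" if "u \<in> set (core_nodes A)" "v \<in> set (core_nodes A)" for u v
    using that K \<eta>_eq[of "num A u" "num A v"] num_eq[OF core_in_nodes core_in_nodes, OF that]
    by (auto simp: \<theta>_def)
  have el: "{x \<in> verts G'. card (pendants G' x) = 3} = (\<lambda>a. \<theta> (El a)) ` {..<fst A}"
  proof (intro equalityI subsetI)
    fix x assume x: "x \<in> {x \<in> verts G'. card (pendants G' x) = 3}"
    then obtain v where v: "v \<in> set (core_nodes A)" "x = \<theta> v" "label v = 3"
      using core[of x] by auto
    then show "x \<in> (\<lambda>a. \<theta> (El a)) ` {..<fst A}"
      by (cases v rule: node.exhaust) (auto simp: set_core_nodes)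
  qed (auto simp: card verts set_core_nodes)
  have inj: "inj_on (\<lambda>a. \<theta> (El a)) {..<fst A}"
    by (auto simp: inj_on_def \<theta>_inj set_core_nodes)
  have rel: "(\<exists>\<tau> \<in> verts G'. card (pendants G' \<tau>) = 4 + i \<and>
       (\<forall>j < length as. \<exists>q \<in> verts G'. joined G' \<tau> q \<and> card (pendants G' q) = 4 + j \<and>
          joined G' q (\<theta> (El (as ! j))))) \<longleftrightarrow> as \<in> set (snd (snd A ! i))"
    if i: "i < length (snd A)" and as: "length as = fst (snd A ! i)" "set as \<subseteq> {..<fst A}" for i as
  proof
    assume "as \<in> set (snd (snd A ! i))"
    with i have p: "(i, as) \<in> set (tuples A)" by (simp add: set_tuples)
    have el: "El (as ! j) \<in> set (core_nodes A)" if "j < length as" for j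
      using as(2) nth_mem[OF that] by (auto simp: set_core_nodes)
    show "\<exists>\<tau> \<in> verts G'. card (pendants G' \<tau>) = 4 + i \<and>
       (\<forall>j < length as. \<exists>q \<in> verts G'. joined G' \<tau> q \<and> card (pendants G' q) = 4 + j \<and>
          joined G' q (\<theta> (El (as ! j))))"
    proof (rule bexI[of _ "\<theta> (Tup (i, as))"], intro conjI allI impI)
      fix j assume j: "j < length as"
      have Inc: "Inc (i, as) j \<in> set (core_nodes A)" "Tup (i, as) \<in> set (core_nodes A)"
        using p j by (simp_all add: set_core_nodes)
      show "\<exists>q \<in> verts G'. joined G' (\<theta> (Tup (i, as))) q \<and> card (pendants G' q) = 4 + j \<and>
          joined G' q (\<theta> (El (as ! j)))"
        using p j Inc el[OF j]
        by (intro bexI[of _ "\<theta> (Inc (i, as) j)"]) (auto simp: joined card verts set_links)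
    qed (use p in \<open>auto simp: card verts set_core_nodes\<close>)
  next
    assume "\<exists>\<tau> \<in> verts G'. card (pendants G' \<tau>) = 4 + i \<and>
       (\<forall>j < length as. \<exists>q \<in> verts G'. joined G' \<tau> q \<and> card (pendants G' q) = 4 + j \<and>
          joined G' q (\<theta> (El (as ! j))))"
    then obtain \<tau> where \<tau>: "card (pendants G' \<tau>) = 4 + i"
      and arg: "\<And>j. j < length as \<Longrightarrow> \<exists>q \<in> verts G'. joined G' \<tau> q \<and> card (pendants G' q) = 4 + j \<and>
          joined G' q (\<theta> (El (as ! j)))" by blast
    obtain u where u: "u \<in> set (core_nodes A)" "\<tau> = \<theta> u" "label u = 4 + i"
      using core[of \<tau>] \<tau> by auto
    have u_j: "\<exists>p. u = Tup p \<and> p \<in> set (tuples A) \<and> j < length (snd p) \<and> snd p ! j = as ! j"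
      if j: "j < length as" for j
    proof -
      obtain q where q: "joined G' \<tau> q" "card (pendants G' q) = 4 + j" "joined G' q (\<theta> (El (as ! j)))"
        using arg[OF j] by blast
      obtain v where v: "v \<in> set (core_nodes A)" "q = \<theta> v" "label v = 4 + j"
        using core[of q] q(2) by auto
      have "El (as ! j) \<in> set (core_nodes A)"
        using as(2) nth_mem[OF j] by (auto simp: set_core_nodes)
      from q(3) joined[OF v(1) this]
      have "(v, El (as ! j)) \<in> set (links A) \<or> (El (as ! j), v) \<in> set (links A)"
        unfolding v(2) by simp
      \<comment> \<open>Within the core, only positions are adjacent to elements; the label of
        \<open>v\<close> then tells which position it is.\<close>
      with v(1) have "(v, El (as ! j)) \<in> set (links A)"
        by (auto simp: set_links set_core_nodes)
      then obtain p k where p: "v = Inc p k" "p \<in> set (tuples A)" "k < length (snd p)" "snd p ! k = as ! j"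
        by (auto simp: set_links)
      with v(3) have "k = j" by simp
      from q(1) joined[OF u(1) v(1)] have "(u, v) \<in> set (links A) \<or> (v, u) \<in> set (links A)"
        unfolding u(2) v(2) by simp
      \<comment> \<open>The core neighbours of a position are its tuple and one element, and the
        label \<open>4 + i\<close> rules out the element.\<close>
      with p u(1,3) have "u = Tup p" by (auto simp: set_links set_core_nodes)
      with p \<open>k = j\<close> show ?thesis by blast
    qed
    \<comment> \<open>Positive arity provides a position 0, which is what forces \<open>u\<close> to
      be a tuple vertex.\<close>
    have "0 < fst (snd A ! i)"
      using A nth_mem[OF i] by (auto simp: is_struct_def case_prod_unfold)
    with u_j[of 0] as(1) obtain p where p: "u = Tup p" "p \<in> set (tuples A)" by auto
    with u(3) have p': "(i, snd p) \<in> set (tuples A)" by (cases p) simp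
    have "snd p = as"
    proof (rule nth_equalityI)
      show "length (snd p) = length as" using is_structD(1)[OF A p'] as(1) by simp
      then show "snd p ! j = as ! j" if "j < length (snd p)" for j
        using u_j[of j] that p(1) by auto
    qed
    with p' show "as \<in> set (snd (snd A ! i))" by (simp add: set_tuples)
  qed
  have sat: "sat (verts G') (conn_atom_holds G') \<sigma> (trans_fm \<phi>) \<longleftrightarrow> sat {..<fst A} (fo_atom_holds A) \<rho> \<phi>"
    for \<sigma> \<rho>
    using sat_trans[OF graph el inj rel, of \<phi> \<rho> \<sigma>] \<phi> by (simp add: fo_sentence_for_def)
  then show ?thesis unfolding graph_models_def struct_models_def G'_def[symmetric] by blast
qed

text \<open>Admitting any set of sentences above the small fragment makes both claims of the theorem
  instances.\<close>

lemma MC_FO_reduction: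
  assumes C: "\<forall>G \<in> \<C>. is_graph G" "subgraph_closed \<C>"
    and enc: "efficient_encoding_of_topological_minors \<C>"
    and \<Phi>: "FO_conn_upto 2 \<subseteq> \<Phi>"
    and P: "fpt_reducible P MC_FO"
  shows "fpt_reducible P (MC_conn \<Phi> \<C>)"
proof -
  obtain p c d where p: "\<And>H vs es. is_graph H \<Longrightarrow> lists_graph vs es H \<Longrightarrow>
        \<exists>G \<in> \<C>. \<exists>\<eta> \<pi> ws ds t.
           topological_minor_model H G \<eta> \<pi> \<and> lists_graph ws ds G \<and>
           eval p p (enc_graph vs es) (Node (enc_graph ws ds) (enc_model vs es \<eta> \<pi>)) t \<and>
           t \<le> c * vsize (enc_graph vs es) ^ d"
    using enc unfolding efficient_encoding_of_topological_minors_def run_def by blast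
  obtain b hb where b: "polyf hb" "\<And>x n. vsize x \<le> n \<Longrightarrow> \<exists>t \<le> hb n. eval b b x (vbuild x) t"
    using ptime_vbuild by (rule ptimeE) blast
  obtain q hq where q: "polyf hq" "\<And>x n. vsize x \<le> n \<Longrightarrow> \<exists>t \<le> hq n. eval q q x (vpaths x) t"
    using ptime_vpaths by (rule ptimeE) blast
  obtain f hf where f: "polyf hf" "\<And>x n. vsize x \<le> n \<Longrightarrow> \<exists>t \<le> hf n. eval f f x (vtrans x) t"
    using ptime_vtrans by (rule ptimeE) blast
  \<comment> \<open>The constructed graph has size at most \<open>hb n\<close>, so
    \<open>?m n\<close> bounds the time of the encoding program on it, and thereby the size of the
    host graph with the model.\<close>
  let ?m = "\<lambda>n. c * hb n ^ d"
  have m: "polyf ?m" by (intro polyf_intros b(1))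
  define h where "h n = 2 * n + hb n + ?m n + hq (?m n) + hf n + 10" for n
  have "polyf h"
    unfolding h_def by (intro polyf_intros b(1) q(1) f(1) polyf_comp[OF q(1) m])
  let ?r = "Cons (Apply q (Apply p (Apply b (Hd Arg)))) (Apply f (Tl Arg))"
  show ?thesis
  proof (rule fpt_reducible_polyf_trans[OF P \<open>polyf h\<close> f(1)])
    fix y assume "y \<in> instances MC_FO"
    then obtain A \<phi> where y: "y = Node (enc_struct A) (enc_fm enc_fo_atom \<phi>)"
      and A: "is_struct A" and \<phi>: "fo_sentence_for A \<phi>"
      by (auto simp: MC_FO_def)
    let ?vs = "graph_verts A" and ?es = "graph_edges A" and ?n = "vsize y"
    obtain G \<eta> \<pi> ws ds t where in_C: "G \<in> \<C>" and model: "topological_minor_model (struct_graph A) G \<eta> \<pi>"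
      and ws: "lists_graph ws ds G"
      and t: "eval p p (enc_graph ?vs ?es) (Node (enc_graph ws ds) (enc_model ?vs ?es \<eta> \<pi>)) t"
        "t \<le> c * vsize (enc_graph ?vs ?es) ^ d"
      using p[OF is_graph_struct_graph[OF A] lists_struct_graph[OF A]] by blast
    have "is_graph G" using in_C C(1) by blast
    interpret subdivision "struct_graph A" G \<eta> \<pi> "num A ` set (core_nodes A)"
      by (rule subdivision_struct_graph[OF A \<open>is_graph G\<close> model])
    define ds' where "ds' = concat (map (\<lambda>(u, v). zip (\<pi> {u, v}) (tl (\<pi> {u, v}))) ?es)"
    have G': "G' \<in> \<C>" "lists_graph ws ds' G'"
      using C(2) in_C subgraph_G' lists_path_graph[OF lists_struct_graph[OF A] ws]
      by (auto simp: subgraph_closed_def ds'_def)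
    define z where "z = Node (enc_graph ws ds') (enc_fm enc_conn_atom (trans_fm \<phi>))"
    have fm: "trans_fm \<phi> \<in> \<Phi>"
      using \<Phi> trans_fm_in_FO_conn_upto \<phi> by (auto simp: fo_sentence_for_def)
    obtain tb where tb: "eval b b (enc_struct A) (enc_graph ?vs ?es) tb" "tb \<le> hb ?n"
      using b(2)[of "enc_struct A" ?n] by (auto simp: y vbuild_enc_struct)
    have t_le: "t \<le> ?m ?n"
      using t(2) vsize_le_time[OF tb(1)] tb(2)
      by (meson le_trans mult_le_mono2 power_mono zero_le)
    obtain tq where tq: "eval q q (Node (enc_graph ws ds) (enc_model ?vs ?es \<eta> \<pi>)) (enc_graph ws ds') tq"
      "tq \<le> hq (?m ?n)"
      using q(2)[OF order_trans[OF vsize_le_time[OF t(1)] t_le]] by (auto simp: vpaths_enc ds'_def)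
    obtain tf where tf: "eval f f (enc_fm enc_fo_atom \<phi>) (enc_fm enc_conn_atom (trans_fm \<phi>)) tf" "tf \<le> hf ?n"
      using f(2)[of "enc_fm enc_fo_atom \<phi>" ?n] by (auto simp: y vtrans_enc_fm)
    have hd: "eval ?r (Hd Arg) y (enc_struct A) (?n + 1)" and tl: "eval ?r (Tl Arg) y (enc_fm enc_fo_atom \<phi>) (?n + 1)"
      unfolding y by (rule eval_Hd eval_Tl, rule eval.Arg)+
    have run: "run ?r y z ((?n + 1 + tb + 1 + t + 1 + tq + 1) + (?n + 1 + tf + 1) + 1)"
      unfolding run_def z_def
      using eval.Cons[OF eval.Apply[OF eval.Apply[OF eval.Apply[OF hd tb(1)] t(1)] tq(1)] eval.Apply[OF tl tf(1)]] .
    have time: "(?n + 1 + tb + 1 + t + 1 + tq + 1) + (?n + 1 + tf + 1) + 1 \<le> h ?n"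
      using tb(2) t_le tq(2) tf(2) unfolding h_def by linarith
    have inst: "z \<in> instances (MC_conn \<Phi> \<C>)"
      unfolding z_def MC_conn_def using G' fm by auto
    have "z \<in> yes (MC_conn \<Phi> \<C>) \<longleftrightarrow> graph_models G' (trans_fm \<phi>)"
    proof
      assume "z \<in> yes (MC_conn \<Phi> \<C>)"
      \<comment> \<open>Membership in \<open>yes\<close> only provides some graph with this
        encoding; since the lists determine the graph, it is \<open>G'\<close>.\<close>
      then obtain vs'' es'' G'' where G'': "enc_graph ws ds' = enc_graph vs'' es''"
        "lists_graph vs'' es'' G''" "graph_models G'' (trans_fm \<phi>)"
        by (auto simp: z_def MC_conn_def enc_fm_inj[OF enc_conn_atom_inj])
      then have "G'' = G'" using G'(2) by (auto simp: enc_graph_inj lists_graph_def)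
      with G''(3) show "graph_models G' (trans_fm \<phi>)" by simp
    next
      assume "graph_models G' (trans_fm \<phi>)"
      with G' fm show "z \<in> yes (MC_conn \<Phi> \<C>)" unfolding z_def MC_conn_def by auto
    qed
    also have "\<dots> \<longleftrightarrow> struct_models A \<phi>"
      unfolding G'_def by (rule path_graph_models_iff[OF A \<phi> \<open>is_graph G\<close> model])
    also have "\<dots> \<longleftrightarrow> y \<in> yes MC_FO"
      using A \<phi> by (cases A) (auto simp: y MC_FO_def enc_struct_inj enc_fm_inj[OF enc_fo_atom_inj])
    finally have yes: "y \<in> yes MC_FO \<longleftrightarrow> z \<in> yes (MC_conn \<Phi> \<C>)" by simp
    \<comment> \<open>The sentence is translated without looking at the structure, so the time of
      the translation on the sentence alone bounds the new parameter.\<close>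
    have "vsize (enc_fm enc_conn_atom (trans_fm \<phi>)) \<le> hf (vsize (enc_fm enc_fo_atom \<phi>))"
      using f(2)[OF order_refl, of "enc_fm enc_fo_atom \<phi>"] vsize_le_time
      unfolding vtrans_enc_fm by (meson le_trans)
    then have "param (MC_conn \<Phi> \<C>) z \<le> hf (param MC_FO y)"
      by (simp add: MC_conn_def MC_FO_def formula_length_def z_def y)
    with run time inst yes show "\<exists>z t. run ?r y z t \<and> t \<le> h (vsize y) \<and> z \<in> instances (MC_conn \<Phi> \<C>) \<and>
        (y \<in> yes MC_FO \<longleftrightarrow> z \<in> yes (MC_conn \<Phi> \<C>)) \<and> param (MC_conn \<Phi> \<C>) z \<le> hf (param MC_FO y)"
      by blast
  qed
qed

theorem theorem1p3:
  fixes \<C> :: "graph set"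
  assumes "\<forall>G \<in> \<C>. is_graph G"
    and "subgraph_closed \<C>"
    and "efficient_encoding_of_topological_minors \<C>"
  shows "AW_star_hard (MC_conn FO_conn \<C>) \<and> AW_star_hard (MC_conn (FO_conn_upto 2) \<C>)"
  using MC_FO_reduction[OF assms]
  by (auto simp: AW_star_hard_def AW_star_def FO_conn_upto_def)

end
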